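(* Let $k\ge1$ and let $J_\infty^{(0)}$ be a $k$-periodic Jacobi matrix with entries $a_n^{(0)}>0$, $b_n^{(0)}\in\mathbb R$, and let $\theta(\mathbf a,\mathbf b)$ be its generating function (see the context). Let $J_\infty$ be an infinite complex Jacobi matrix with entries $a_n,b_n,c_n\in\mathbb C$ which is Cesàro asymptotically $k$-periodic with background $J_\infty^{(0)}$, i.e. $$\lim_{n\to\infty}\frac1n\sum_{j=1}^n\bigl(|a_j-a_j^{(0)}|+|b_j-b_j^{(0)}|+|c_j-a_j^{(0)}|\bigr)=0,$$ and let $J_n$ be the principal (leading) $n\times n$ block of $J_\infty$. Then $\{J_n\}\sim_\lambda(\theta(\mathbf a,\mathbf b),[-\pi,\pi])$, $\{J_n\}$ is weakly clustered at $S(\theta(\mathbf a,\mathbf b))$, and every point $s\in S(\theta(\mathbf a,\mathbf b))$ strongly attracts $\{J_n\}$ with infinite order.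
   Context: $J_\infty$ is the infinite tridiagonal matrix $$J_\infty=\begin{pmatrix} b_0&c_1&&&\\ a_1&b_1&c_2&&\\ &a_2&b_2&c_3&\\ &&\ddots&\ddots&\ddots\end{pmatrix},$$ and $J_\infty^{(0)}$ is the infinite symmetric tridiagonal matrix with diagonal $b_0^{(0)},b_1^{(0)},b_2^{(0)},\dots$ and both off-diagonals $a_1^{(0)},a_2^{(0)},\dots$, where $a_n^{(0)}>0$, $b_n^{(0)}\in\mathbb R$ and $a_{n+k}^{(0)}=a_n^{(0)}$, $b_{n+k}^{(0)}=b_n^{(0)}$ for all $n\ge0$. Put $\mathbf a=(a_0^{(0)},\dots,a_{k-1}^{(0)})$, $\mathbf b=(b_0^{(0)},\dots,b_{k-1}^{(0)})$, and let $J_k[\mathbf a,\mathbf b]$ be the leading $k\times k$ block of $J_\infty^{(0)}$. The generating function is the $k\times k$ Hermitian-matrix-valued trigonometric polynomial $$\theta(\mathbf a,\mathbf b,t)=J_k[\mathbf a,\mathbf b]+a_0^{(0)}e^{it}E_{1,k}+a_0^{(0)}e^{-it}E_{k,1},$$ where $E_{p,q}$ is the $k\times k$ matrix unit (for $k=1$ this is $b_0^{(0)}+2a_0^{(0)}\cos t$). A matrix sequence $\{A_n\}$ is a sequence of complex matrices with $A_n$ of size $n\times n$; $\lambda_1(A_n),\dots,\lambda_n(A_n)$ are its eigenvalues counted with multiplicity. Distribution: for a $k\times k$ matrix-valued Lebesgue integrable function $\theta$ on $G$, with $0<m(G)<\infty$ ($m$ Lebesgue measure) and with eigenvalues $\lambda_1(\theta(t)),\dots,\lambda_k(\theta(t))$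 labelled so as to be measurable in $t$, $\{A_n\}\sim_\lambda(\theta,G)$ (distributed as $(\theta,G)$ in the sense of eigenvalues) means that for every continuous $F:\mathbb C\to\mathbb C$ with bounded support, $$\lim_{n\to\infty}\frac1n\sum_{j=1}^nF(\lambda_j(A_n))=\frac1{k\,m(G)}\sum_{j=1}^k\int_GF(\lambda_j(\theta(t)))\,dt.$$ Essential range: $S(\theta)=\bigcup_{j=1}^kS(\lambda_j(\theta))$, where for a scalar measurable function $f$ on $G$, $S(f)$ is the set of $s\in\mathbb C$ such that $\{t\in G:|f(t)-s|<\varepsilon\}$ has positive measure for every $\varepsilon>0$. Weak clustering: for a nonempty closed $S\subset\mathbb C$ and $\varepsilon>0$ let $D(S,\varepsilon)=\bigcup_{s\in S}\{z\in\mathbb C:|z-s|<\varepsilon\}$. $\{A_n\}$ is weakly clustered at $S$ if for every $\varepsilon>0$ the number of indices $j$ with $\lambda_j(A_n)\notin D(S,\varepsilon)$ is $o(n)$. Attraction: a point $s\in\mathbb C$ strongly attracts $\{A_n\}$ with infinite order if, ordering the eigenvalues so that $|\lambda_1(A_n)-s|\le\cdots\le|\lambda_n(A_n)-s|$, one has $\lim_{n\to\infty}|\lambda_j(A_n)-s|=0$ for every fixed $j$. *)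

theory Defs
  imports
    "HOL-Analysis.Analysis"
    "HOL-Library.Landau_Symbols"
    "HOL-Computational_Algebra.Fundamental_Theorem_Algebra"
    "Jordan_Normal_Form.Char_Poly"
begin

section \<open>Eigenvalues and matrix sequences\<close>

text \<open>Eigenvalues with algebraic multiplicity.\<close>

definition eigs :: "complex mat \<Rightarrow> complex multiset" where
  "eigs A = proots (char_poly A)"

lemma size_eigs: "A \<in> carrier_mat n n \<Longrightarrow> size (eigs A) = n"
  by (simp add: eigs_def size_proots_complex degree_monic_char_poly)

lemma set_eigs:
  assumes "A \<in> carrier_mat n n"
  shows "set_mset (eigs A) = {z. eigenvalue A z}"
proof -
  have "char_poly A \<noteq> 0"
    using degree_monic_char_poly[OF assms] by auto
  then show ?thesis
    by (simp add: eigs_def eigenvalue_root_char_poly[OF assms])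
qed

definition matrix_sequence :: "(nat \<Rightarrow> complex mat) \<Rightarrow> bool" where
  "matrix_sequence A \<longleftrightarrow> (\<forall>n. A n \<in> carrier_mat n n)"


section \<open>Jacobi matrices and the generating function\<close>

text \<open>
  Infinite matrices are functions of a row and a column index, both starting at 0. The entries of
  row \<open>n\<close> are \<open>a n\<close>, \<open>b n\<close>, \<open>c (n + 1)\<close>; the values \<open>a 0\<close> and \<open>c 0\<close> do not occur.
\<close>

definition jacobi ::
  "(nat \<Rightarrow> complex) \<Rightarrow> (nat \<Rightarrow> complex) \<Rightarrow> (nat \<Rightarrow> complex) \<Rightarrow> nat \<Rightarrow> nat \<Rightarrow> complex" where
  "jacobi a b c i j =
     (if i = j then b i else if i = j + 1 then a i else if j = i + 1 then c j else 0)"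

definition leading_block :: "(nat \<Rightarrow> nat \<Rightarrow> complex) \<Rightarrow> nat \<Rightarrow> complex mat" where
  "leading_block J n = Matrix.mat n n (\<lambda>(i, j). J i j)"

definition symmetric_jacobi :: "(nat \<Rightarrow> real) \<Rightarrow> (nat \<Rightarrow> real) \<Rightarrow> nat \<Rightarrow> nat \<Rightarrow> complex" where
  "symmetric_jacobi a b =
     jacobi (\<lambda>n. complex_of_real (a n)) (\<lambda>n. complex_of_real (b n)) (\<lambda>n. complex_of_real (a n))"

text \<open>The matrix unit, with indices starting at 0.\<close>

definition matrix_unit :: "nat \<Rightarrow> nat \<Rightarrow> nat \<Rightarrow> complex mat" where
  "matrix_unit k p q = Matrix.mat k k (\<lambda>(i, j). if i = p \<and> j = q then 1 else 0)"

text \<open>Only the first \<open>k\<close> terms of \<open>a\<close> and \<open>b\<close> enter.\<close>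

definition generating_function ::
  "nat \<Rightarrow> (nat \<Rightarrow> real) \<Rightarrow> (nat \<Rightarrow> real) \<Rightarrow> real \<Rightarrow> complex mat" where
  "generating_function k a b t =
     leading_block (symmetric_jacobi a b) k
       + (complex_of_real (a 0) * exp (\<i> * complex_of_real t)) \<cdot>\<^sub>m matrix_unit k 0 (k - 1)
       + (complex_of_real (a 0) * exp (- \<i> * complex_of_real t)) \<cdot>\<^sub>m matrix_unit k (k - 1) 0"

lemma generating_function_1:
  "generating_function 1 a b t $$ (0, 0) = complex_of_real (b 0 + 2 * a 0 * cos t)"
proof -
  have "exp (\<i> * complex_of_real t) + exp (- \<i> * complex_of_real t)
      = 2 * cos (complex_of_real t)"
    by (simp add: cos_exp_eq)
  then show ?thesis
    by (simp add: generating_function_def leading_block_def symmetric_jacobi_def jacobi_def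
        matrix_unit_def cos_of_real add.assoc flip: distrib_left)
qed


section \<open>Distribution in the sense of eigenvalues\<close>

definition measurable_eigenvalues ::
  "nat \<Rightarrow> ('a::euclidean_space \<Rightarrow> complex mat) \<Rightarrow> 'a set \<Rightarrow> (nat \<Rightarrow> 'a \<Rightarrow> complex) \<Rightarrow> bool" where
  "measurable_eigenvalues k \<theta> G l \<longleftrightarrow>
     (\<forall>j<k. l j \<in> borel_measurable (lebesgue_on G)) \<and>
     (\<forall>t\<in>G. eigs (\<theta> t) = image_mset (\<lambda>j. l j t) (mset_set {..<k}))"

text \<open>
  At each \<open>t\<close> the sum of \<open>F (l j t)\<close> over \<open>j < k\<close> is the sum of \<open>F\<close> over the multiset
  \<open>eigs (\<theta> t)\<close>, so the limit relation does not depend on the measurable labelling \<open>l\<close>; the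
  existential quantifier asserts that one exists.
\<close>

definition eigenvalue_distributed ::
  "(nat \<Rightarrow> complex mat) \<Rightarrow> nat \<Rightarrow> ('a::euclidean_space \<Rightarrow> complex mat) \<Rightarrow> 'a set \<Rightarrow> bool" where
  "eigenvalue_distributed A k \<theta> G \<longleftrightarrow>
     matrix_sequence A \<and>
     G \<in> lmeasurable \<and> 0 < measure lebesgue G \<and>
     (\<forall>t\<in>G. \<theta> t \<in> carrier_mat k k) \<and>
     (\<forall>p<k. \<forall>q<k. integrable (lebesgue_on G) (\<lambda>t. \<theta> t $$ (p, q))) \<and>
     (\<exists>l. measurable_eigenvalues k \<theta> G l \<and>
        (\<forall>F::complex \<Rightarrow> complex. continuous_on UNIV F \<longrightarrow> bounded {z. F z \<noteq> 0} \<longrightarrow>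
           (\<lambda>n. (1 / of_nat n) * (\<Sum>z\<in>#eigs (A n). F z)) \<longlonglongrightarrow>
             (1 / (of_nat k * complex_of_real (measure lebesgue G)))
               * (\<Sum>j<k. \<integral>t. F (l j t) \<partial>lebesgue_on G)))"


section \<open>Essential range\<close>

definition essential_range :: "'a::euclidean_space set \<Rightarrow> ('a \<Rightarrow> complex) \<Rightarrow> complex set" where
  "essential_range G f = {s. \<forall>\<epsilon>>0. emeasure lebesgue {t\<in>G. cmod (f t - s) < \<epsilon>} > 0}"

text \<open>
  The union over \<open>j\<close> of the essential ranges of the eigenvalue functions does not depend on their
  labelling (\<open>essential_range_mat_eq\<close> below), so the union over all measurable labellings used here
  is the union for any one of them.
\<close>

definition essential_range_mat ::
  "nat \<Rightarrow> 'a::euclidean_space set \<Rightarrow> ('a \<Rightarrow> complex mat) \<Rightarrow> complex set" where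
  "essential_range_mat k G \<theta> =
     (\<Union>l\<in>{l. measurable_eigenvalues k \<theta> G l}. \<Union>j<k. essential_range G (l j))"

lemma essential_range_labelling_subset:
  assumes G: "G \<in> sets lebesgue"
    and l: "measurable_eigenvalues k \<theta> G l"
    and l': "measurable_eigenvalues k \<theta> G l'"
  shows "(\<Union>j<k. essential_range G (l j)) \<subseteq> (\<Union>j<k. essential_range G (l' j))"
proof
  fix s
  assume "s \<in> (\<Union>j<k. essential_range G (l j))"
  then obtain i where i: "i < k" "s \<in> essential_range G (l i)"
    by auto
  show "s \<in> (\<Union>j<k. essential_range G (l' j))"
  proof (rule ccontr)
    assume "\<not> ?thesis"
    then have "\<forall>j. \<exists>e. j < k \<longrightarrow> e > 0 \<and> emeasure lebesgue {t\<in>G. cmod (l' j t - s) < e} = 0"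
      by (auto simp: essential_range_def)
    then obtain e where e: "\<And>j. j < k \<Longrightarrow> e j > 0"
      "\<And>j. j < k \<Longrightarrow> emeasure lebesgue {t\<in>G. cmod (l' j t - s) < e j} = 0"
      by metis
    define d where "d = Min (e ` {..<k})"
    have d: "d > 0" "\<And>j. j < k \<Longrightarrow> d \<le> e j"
    proof -
      have ne: "finite (e ` {..<k})" "e ` {..<k} \<noteq> {}"
        using i by auto
      show "d > 0"
        using Min_in[OF ne] e(1) by (auto simp: d_def)
      show "d \<le> e j" if "j < k" for j
        using that by (simp add: d_def)
    qed
    have null: "{t\<in>G. cmod (l' j t - s) < e j} \<in> null_sets lebesgue" if "j < k" for j
    proof -
      have "l' j \<in> borel_measurable (lebesgue_on G)"
        using l' that by (auto simp: measurable_eigenvalues_def)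
      then have "(\<lambda>t. cmod (l' j t - s)) \<in> borel_measurable (lebesgue_on G)"
        by measurable
      then have "{t \<in> space (lebesgue_on G). cmod (l' j t - s) < e j} \<in> sets (lebesgue_on G)"
        by (simp add: borel_measurable_iff_less)
      then show ?thesis
        using G e(2)[OF that] by (auto simp: null_sets_def sets_restrict_space_iff)
    qed
    have sub: "{t\<in>G. cmod (l i t - s) < d} \<subseteq> (\<Union>j<k. {t\<in>G. cmod (l' j t - s) < e j})"
    proof
      fix t
      assume t: "t \<in> {t\<in>G. cmod (l i t - s) < d}"
      then have "image_mset (\<lambda>j. l j t) (mset_set {..<k})
          = image_mset (\<lambda>j. l' j t) (mset_set {..<k})"
        using l l' by (auto simp: measurable_eigenvalues_def)
      then have "(\<lambda>j. l j t) ` {..<k} = (\<lambda>j. l' j t) ` {..<k}"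
        by (metis finite_lessThan finite_set_mset_mset_set set_image_mset)
      then obtain j where "j < k" "l i t = l' j t"
        using i by (metis (no_types, lifting) imageE imageI lessThan_iff)
      then show "t \<in> (\<Union>j<k. {t\<in>G. cmod (l' j t - s) < e j})"
        using t d(2)[of j] by (auto intro!: bexI[of _ j])
    qed
    have "(\<Union>j<k. {t\<in>G. cmod (l' j t - s) < e j}) \<in> null_sets lebesgue"
      using null by (intro null_sets_UN') auto
    then have "{t\<in>G. cmod (l i t - s) < d} \<in> null_sets lebesgue"
      using sub by (meson null_sets_completion_subset)
    then show False
      using i(2) d(1) by (auto simp: essential_range_def null_sets_def)
  qed
qed

lemma essential_range_mat_eq:
  assumes "G \<in> sets lebesgue" and "measurable_eigenvalues k \<theta> G l"
  shows "essential_range_mat k G \<theta> = (\<Union>j<k. essential_range G (l j))"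
  using essential_range_labelling_subset[OF assms(1) _ assms(2)] assms(2)
  unfolding essential_range_mat_def by blast


section \<open>Clustering and attraction\<close>

definition weakly_clustered :: "(nat \<Rightarrow> complex mat) \<Rightarrow> complex set \<Rightarrow> bool" where
  "weakly_clustered A S \<longleftrightarrow>
     matrix_sequence A \<and> S \<noteq> {} \<and> closed S \<and>
     (\<forall>\<epsilon>>0. (\<lambda>n. real (size {#z \<in># eigs (A n). z \<notin> (\<Union>s\<in>S. ball s \<epsilon>)#})) \<in> o(\<lambda>n. real n))"

text \<open>
  \<open>xs\<close> lists the eigenvalues of \<open>A\<close> by increasing distance from \<open>s\<close>. The order of eigenvalues at
  equal distance is free, and attraction is required for all such lists; \<open>L n ! j\<close> is
  meaningful for \<open>j < n\<close>, hence for almost all \<open>n\<close> when \<open>j\<close> is fixed.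
\<close>

definition ordered_eigenvalues :: "complex \<Rightarrow> complex mat \<Rightarrow> complex list \<Rightarrow> bool" where
  "ordered_eigenvalues s A xs \<longleftrightarrow> mset xs = eigs A \<and> sorted (map (\<lambda>z. cmod (z - s)) xs)"

lemma ex_ordered_eigenvalues: "\<exists>xs. ordered_eigenvalues s A xs"
proof -
  obtain ys where "mset ys = eigs A"
    using ex_mset by blast
  then have "ordered_eigenvalues s A (sort_key (\<lambda>z. cmod (z - s)) ys)"
    by (simp add: ordered_eigenvalues_def)
  then show ?thesis ..
qed

definition strongly_attracts_infinite_order :: "complex \<Rightarrow> (nat \<Rightarrow> complex mat) \<Rightarrow> bool" where
  "strongly_attracts_infinite_order s A \<longleftrightarrow>
     matrix_sequence A \<and>
     (\<forall>L. (\<forall>n. ordered_eigenvalues s (A n) (L n)) \<longrightarrow>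
        (\<forall>j. (\<lambda>n. cmod (L n ! j - s)) \<longlonglongrightarrow> 0))"

end

theory Submission
  imports Defs "HOL-Real_Asymp.Real_Asymp"
begin

text \<open>
  Let \<open>D n z\<close> be the characteristic polynomial of the \<open>n\<close>-th leading block. The matrices are not Hermitian
  and their entries may be unbounded, so that neither interlacing nor moments are
  available. The proof compares logarithmic potentials \<open>ln \<bar>D n z\<bar> / n\<close>, for which an upper bound turns out to be
  enough.

  Upper bound. For nonreal \<open>z\<close> the periodic background has a \<open>k\<close>-periodic continued fraction
  \<open>Q (n+1) = z - b0 (n+1) - (a0 (n+1))\<^sup>2 / Q n\<close> in the half-plane of \<open>z\<close> (lemma \<open>periodic_continued_fraction\<close>).
  The polynomials \<open>D n\<close> satisfy the perturbed three-term recurrence, and a Lyapunov function shows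
  \<open>\<bar>D n\<bar> \<le> C * (\<Prod>i<n. \<bar>Q i\<bar>) * exp (C' * S n)\<close>, where \<open>S n\<close> is the sum of the perturbations up to \<open>n\<close>
  (\<open>perturbed_recurrence_bound\<close>). On the other hand \<open>z - \<theta>(t)\<close> has an \<open>LU\<close> factorisation built from \<open>Q\<close>, and
  the mean over \<open>t\<close> of \<open>ln \<bar>det (z - \<theta>(t))\<bar>\<close> is the sum of \<open>ln \<bar>Q i\<bar>\<close> over a period
  (\<open>potential_generating_function\<close>). As \<open>S n\<close> is \<open>o(n)\<close>, the upper limit of the potentials of the leading
  blocks is at most the potential of the eigenvalue distribution of \<open>\<theta>\<close>, for every nonreal \<open>z\<close>.

  From one side to both. The eigenvalues of \<open>\<theta>\<close> lie in an interval \<open>[-2\<rho>, 2\<rho>]\<close>. Put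
  \<open>z = \<rho> * (w + 1 / w)\<close> and let \<open>w\<close> run through a circle of radius \<open>r > 1\<close>, so that \<open>z\<close> runs through an ellipse
  around the interval. After subtracting the constant \<open>ln (\<rho> * r)\<close>, the potential of a unit mass inside the ellipse
  has mean zero, and outside it the mean is positive. A nonnegative function of small mean is small
  in \<open>L\<^sup>1\<close>; this turns the upper bound into \<open>L\<^sup>1\<close> convergence of the potentials on the ellipse (lemma \<open>jensen\<close>).
  The means show that only \<open>o(n)\<close> eigenvalues lie outside the ellipse. The Fourier coefficients are multiples of
  Chebyshev moments, so the moments of the remaining eigenvalues converge. Ellipses with \<open>r\<close> close to 1 shrink to the
  interval, and Weierstrass approximation gives the distribution result (\<open>weak_convergence\<close>).

  Clustering and attraction follow from the distribution result by testing it with suitable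
  continuous functions.
\<close>

section \<open>Periodic continued fractions\<close>

lemma periodic_bounded:
  fixes f :: "nat \<Rightarrow> real"
  assumes "k \<ge> 1" "\<And>n. f (n + k) = f n"
  shows "\<exists>B. \<forall>n. f n \<le> B"
proof -
  have e: "f n = f (n mod k)" for n
  proof (induction n rule: less_induct)
    case (less n)
    show ?case
    proof (cases "n < k")
      case False
      then have "f n = f (n - k)" using assms(2)[of "n - k"] by simp
      also have "\<dots> = f ((n - k) mod k)" using less[of "n - k"] False assms(1) by simp
      finally show ?thesis using False by (simp add: le_mod_geq)
    qed simp
  qed
  have "f n \<le> Max (f ` {..<k})" for n
    using assms(1) by (subst e) (auto intro!: Max_ge)
  then show ?thesis by blast
qed

lemma periodic_average:
  fixes f :: "nat \<Rightarrow> real"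
  assumes k: "k \<ge> 1" and p: "\<And>n. f (n + k) = f n"
  shows "(\<lambda>n. (\<Sum>i<n. f i) / real n) \<longlonglongrightarrow> (\<Sum>i<k. f i) / real k"
proof -
  define S where "S = (\<Sum>i<k. f i) / real k"
  \<comment> \<open>the deviation from the linear trend is periodic, hence bounded\<close>
  define g where "g n = (\<Sum>i<n. f i) - real n * S" for n
  have gper: "g (n + k) = g n" for n
  proof (induction n)
    case 0 then show ?case using k by (simp add: g_def S_def)
  next
    case (Suc n)
    have "g (Suc n + k) = g (n + k) + f (n + k) - S" by (simp add: g_def algebra_simps)
    also have "\<dots> = g (Suc n)" using Suc p[of n] by (simp add: g_def algebra_simps)
    finally show ?case .
  qed
  then have "\<exists>B. \<forall>n. \<bar>g n\<bar> \<le> B" using k by (intro periodic_bounded[of k]) simp_all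
  then obtain B where B: "\<And>n. \<bar>g n\<bar> \<le> B" by blast
  have "(\<lambda>n. g n / real n) \<longlonglongrightarrow> 0"
  proof (rule tendsto_sandwich)
    show "\<forall>\<^sub>F n in sequentially. - (B / real n) \<le> g n / real n"
    proof (intro always_eventually allI)
      fix n show "- (B / real n) \<le> g n / real n"
        using B[of n] by (metis abs_le_D2 divide_right_mono minus_divide_left neg_le_iff_le of_nat_0_le_iff minus_le_iff)
    qed
    show "\<forall>\<^sub>F n in sequentially. g n / real n \<le> B / real n"
      using B by (intro always_eventually allI divide_right_mono) (auto simp: abs_le_iff)
  qed real_asymp+
  then have "(\<lambda>n. g n / real n + S) \<longlonglongrightarrow> 0 + S" by (intro tendsto_add) auto
  moreover have "\<forall>\<^sub>F n in sequentially. g n / real n + S = (\<Sum>i<n. f i) / real n"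
    using eventually_gt_at_top[of 0] by eventually_elim (simp add: g_def diff_divide_distrib)
  ultimately show ?thesis unfolding S_def[symmetric] by (simp add: tendsto_cong)
qed

lemma upper_half_plane_step:
  fixes z q :: complex and a b \<eta> :: real
  assumes "Im z \<ge> \<eta>" "\<eta> > 0" "Im q \<ge> \<eta>"
  shows "Im (z - of_real b - of_real (a\<^sup>2) / q) = Im z + a\<^sup>2 * Im q / (cmod q)\<^sup>2"
    and "Im (z - of_real b - of_real (a\<^sup>2) / q) \<ge> \<eta>"
    and "cmod (z - of_real b - of_real (a\<^sup>2) / q) \<le> cmod z + \<bar>b\<bar> + a\<^sup>2 / \<eta>"
proof -
  show 1: "Im (z - of_real b - of_real (a\<^sup>2) / q) = Im z + a\<^sup>2 * Im q / (cmod q)\<^sup>2"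
    by (simp add: Im_divide cmod_power2)
  have "0 \<le> a\<^sup>2 * Im q / (cmod q)\<^sup>2" using assms by (intro divide_nonneg_nonneg mult_nonneg_nonneg) auto
  then show "Im (z - of_real b - of_real (a\<^sup>2) / q) \<ge> \<eta>" unfolding 1 using assms(1) by linarith
  have "\<eta> \<le> cmod q" using assms(3) abs_Im_le_cmod[of q] by linarith
  then have "cmod (of_real (a\<^sup>2) / q) \<le> a\<^sup>2 / \<eta>"
    using assms(2) by (simp add: norm_divide norm_power divide_left_mono frac_le del: of_real_power)
  moreover have "cmod (z - of_real b - of_real (a\<^sup>2) / q) \<le> cmod z + cmod (of_real b :: complex) + cmod (of_real (a\<^sup>2) / q)"
    by (metis (no_types, opaque_lifting) norm_triangle_ineq4 norm_triangle_le_diff norm_triangle_mono order_refl add_mono dual_order.trans)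
  ultimately show "cmod (z - of_real b - of_real (a\<^sup>2) / q) \<le> cmod z + \<bar>b\<bar> + a\<^sup>2 / \<eta>" by simp
qed

text \<open>
  The Moebius map \<open>q \<mapsto> z - b - a\<^sup>2 / q\<close> sends the half-plane \<open>Im q \<ge> Im z\<close> into itself, and the image of that
  half-plane is bounded. One period of such maps is therefore a continuous self-map of a compact
  convex set, and Brouwer's theorem yields a fixed point, from which the periodic sequence starts.
\<close>

lemma periodic_continued_fraction_upper:
  fixes a b :: "nat \<Rightarrow> real" and z :: complex
  assumes k: "k \<ge> 1" and pa: "\<And>n. a (n + k) = a n" and pb: "\<And>n. b (n + k) = b n"
    and z: "Im z > 0"
  shows "\<exists>Q. (\<forall>n. Q (n + k) = Q n) \<and> (\<forall>n. Im (Q n) \<ge> Im z) \<and>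
           (\<forall>n. Q (Suc n) = z - of_real (b (Suc n)) - of_real ((a (Suc n))\<^sup>2) / Q n)"
proof -
  define \<eta> where "\<eta> = Im z"
  have eta: "\<eta> > 0" "Im z \<ge> \<eta>" using z by (auto simp: \<eta>_def)
  obtain A where A: "\<And>n. (a n)\<^sup>2 \<le> A" using periodic_bounded[of k "\<lambda>n. (a n)\<^sup>2"] k pa by auto
  obtain B where B: "\<And>n. \<bar>b n\<bar> \<le> B" using periodic_bounded[of k "\<lambda>n. \<bar>b n\<bar>"] k pb by auto
  define R where "R = cmod z + B + A / \<eta>"
  define S where "S = {w. Im w \<ge> \<eta>} \<inter> cball 0 R"
  define F where "F n w = rec_nat w (\<lambda>n q. z - of_real (b (Suc n)) - of_real ((a (Suc n))\<^sup>2) / q) n" for n w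
  have F0: "F 0 w = w" and FS: "F (Suc n) w = z - of_real (b (Suc n)) - of_real ((a (Suc n))\<^sup>2) / F n w" for n w
    by (simp_all add: F_def)
  have FS_S: "F n w \<in> S" if "w \<in> S" for n w
  proof (induction n)
    case 0 show ?case using that by (simp add: F0)
  next
    case (Suc n)
    then have q: "Im (F n w) \<ge> \<eta>" by (simp add: S_def)
    have "cmod z + \<bar>b (Suc n)\<bar> + (a (Suc n))\<^sup>2 / \<eta> \<le> R"
      unfolding R_def using A[of "Suc n"] B[of "Suc n"] eta by (intro add_mono divide_right_mono) auto
    then show ?case
      using upper_half_plane_step(2,3)[OF eta(2,1) q, of "b (Suc n)" "a (Suc n)"]
      unfolding S_def FS by auto
  qed
  have cont: "continuous_on S (F n)" for n
  proof (induction n)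
    case 0 show ?case by (simp add: F0 cong: continuous_on_cong)
  next
    case (Suc n)
    have "F n w \<noteq> 0" if "w \<in> S" for w using FS_S[OF that, of n] eta by (auto simp: S_def)
    then have "continuous_on S (\<lambda>w. z - of_real (b (Suc n)) - of_real ((a (Suc n))\<^sup>2) / F n w)"
      by (intro continuous_intros Suc) auto
    then show ?case by (simp add: FS cong: continuous_on_cong)
  qed
  have "compact S" unfolding S_def
    by (intro closed_Int_compact closed_Collect_le continuous_intros compact_cball)
  moreover have "convex S" unfolding S_def by (intro convex_Int convex_halfspace_Im_ge convex_cball)
  moreover have "S \<noteq> {}"
  proof -
    have "\<eta> \<le> R" using eta A[of 0] B[of 0] abs_Im_le_cmod[of z] unfolding R_def \<eta>_def
      by (smt (verit) divide_nonneg_pos zero_le_power2)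
    then have "\<i> * of_real \<eta> \<in> S" using eta by (simp add: S_def norm_mult)
    then show ?thesis by blast
  qed
  ultimately obtain w where w: "w \<in> S" "F k w = w"
    using brouwer[of S "F k"] cont[of k] FS_S by blast
  define Q where "Q n = F n w" for n
  have rec: "Q (Suc n) = z - of_real (b (Suc n)) - of_real ((a (Suc n))\<^sup>2) / Q n" for n
    by (simp add: Q_def FS)
  have "Q (n + k) = Q n" for n
  proof (induction n)
    case 0 show ?case using w by (simp add: Q_def F0)
  next
    case (Suc n)
    show ?case using rec[of "n + k"] rec[of n] Suc pa[of "Suc n"] pb[of "Suc n"] by simp
  qed
  moreover have "Im (Q n) \<ge> Im z" for n using FS_S[OF w(1), of n] by (simp add: S_def Q_def \<eta>_def)
  ultimately show ?thesis using rec by blast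
qed

text \<open>
  Taking imaginary parts in the recursion gives
  \<open>(a (n+1))\<^sup>2 / \<bar>Q n\<bar>\<^sup>2 = (Im (Q (n+1)) - Im z) / Im (Q n)\<close>. Hence the ratios
  \<open>(a (n+1))\<^sup>2 / (Q n * Q (n+1))\<close>, which may exceed 1 individually, contract by a fixed factor \<open>q < 1\<close> when
  they are measured with the weights \<open>\<kappa> n = \<bar>Q n\<bar> / Im (Q n)\<close>. For \<open>Im z < 0\<close> conjugate.
\<close>

lemma periodic_continued_fraction:
  fixes a b :: "nat \<Rightarrow> real" and z :: complex
  assumes k: "k \<ge> 1" and pa: "\<And>n. a (n + k) = a n" and pb: "\<And>n. b (n + k) = b n"
    and z: "Im z \<noteq> 0"
  obtains Q :: "nat \<Rightarrow> complex" and \<eta> :: real and \<kappa> :: "nat \<Rightarrow> real" and X q :: real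
  where "\<And>n. Q (n + k) = Q n" "\<And>n. Q (Suc n) = z - of_real (b (Suc n)) - of_real ((a (Suc n))\<^sup>2) / Q n"
    "\<eta> > 0" "\<And>n. cmod (Q n) \<ge> \<eta>" "\<And>n. \<kappa> (n + k) = \<kappa> n" "\<And>n. 1 \<le> \<kappa> n" "\<And>n. \<kappa> n \<le> X" "0 \<le> q" "q < 1"
    "\<And>n. (a (Suc n))\<^sup>2 / (cmod (Q n) * cmod (Q (Suc n))) * \<kappa> (Suc n) \<le> q * \<kappa> n"
proof -
  note result = that
  have upper: thesis if w: "Im w > 0" and wz: "\<And>Q. (\<forall>n. Q (Suc n) = w - of_real (b (Suc n)) - of_real ((a (Suc n))\<^sup>2) / Q n) \<Longrightarrow>
     \<forall>n. h (Q (Suc n)) = z - of_real (b (Suc n)) - of_real ((a (Suc n))\<^sup>2) / h (Q n)"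
      and h: "\<And>x. cmod (h x) = cmod x" for w and h :: "complex \<Rightarrow> complex"
  proof -
    obtain Q where Qp: "\<And>n. Q (n + k) = Q n" and QI: "\<And>n. Im (Q n) \<ge> Im w"
      and QS: "\<And>n. Q (Suc n) = w - of_real (b (Suc n)) - of_real ((a (Suc n))\<^sup>2) / Q n"
      using periodic_continued_fraction_upper[where a=a and b=b, OF k pa pb w] by metis
    define \<kappa> where "\<kappa> n = cmod (Q n) / Im (Q n)" for n
    have Ip: "Im (Q n) > 0" for n using QI[of n] w by linarith
    have cp: "cmod (Q n) \<ge> Im w" for n using QI[of n] abs_Im_le_cmod[of "Q n"] by linarith
    obtain V where V: "\<And>n. Im (Q n) \<le> V" using periodic_bounded[of k "\<lambda>n. Im (Q n)"] k Qp by auto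
    obtain X where X: "\<And>n. \<kappa> n \<le> X" using periodic_bounded[of k \<kappa>] k Qp by (auto simp: \<kappa>_def)
    define q where "q = 1 - Im w / V"
    have Vp: "V > 0" "Im w \<le> V" using V[of 0] Ip[of 0] QI[of 0] by linarith+
    show thesis
    proof (rule result[of "\<lambda>n. h (Q n)" "Im w" \<kappa> X q])
      show "h (Q (n + k)) = h (Q n)" for n by (simp add: Qp)
      show "h (Q (Suc n)) = z - of_real (b (Suc n)) - of_real ((a (Suc n))\<^sup>2) / h (Q n)" for n
        using wz[of Q] QS by blast
      show "Im w > 0" by fact
      show "cmod (h (Q n)) \<ge> Im w" for n using cp by (simp add: h)
      show "\<kappa> (n + k) = \<kappa> n" for n by (simp add: \<kappa>_def Qp)
      show "1 \<le> \<kappa> n" for n using Ip[of n] abs_Im_le_cmod[of "Q n"] by (simp add: \<kappa>_def)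
      show "\<kappa> n \<le> X" for n by fact
      show "0 \<le> q" "q < 1" using Vp w by (simp_all add: q_def)
      fix n
      define v v' where "v = Im (Q n)" and "v' = Im (Q (Suc n))"
      have vp: "v > 0" "v' > 0" using Ip by (auto simp: v_def v'_def)
      have v': "v' = Im w + (a (Suc n))\<^sup>2 * v / (cmod (Q n))\<^sup>2"
        unfolding v'_def v_def QS using upper_half_plane_step(1)[of "Im w" w "Q n"] w QI by blast
      have c0: "cmod (Q n) > 0" "cmod (Q (Suc n)) > 0" using cp[of n] cp[of "Suc n"] w by linarith+
      have "(a (Suc n))\<^sup>2 / (cmod (Q n))\<^sup>2 = (v' - Im w) / v" using v' vp by simp
      then have "(a (Suc n))\<^sup>2 = (v' - Im w) / v * (cmod (Q n))\<^sup>2" using c0 by (simp add: divide_eq_eq)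
      then have "(a (Suc n))\<^sup>2 / (cmod (Q n) * cmod (Q (Suc n))) * \<kappa> (Suc n) = (1 - Im w / v') * \<kappa> n"
        unfolding \<kappa>_def v'_def[symmetric] v_def[symmetric] using c0 vp by (simp add: field_simps power2_eq_square)
      also have "\<dots> \<le> q * \<kappa> n"
        using V[of "Suc n"] vp w c0 Vp unfolding q_def \<kappa>_def v'_def v_def
        by (intro mult_right_mono) (auto intro!: divide_left_mono mult_pos_pos)
      finally show "(a (Suc n))\<^sup>2 / (cmod (h (Q n)) * cmod (h (Q (Suc n)))) * \<kappa> (Suc n) \<le> q * \<kappa> n"
        by (simp add: h)
    qed
  qed
  show thesis
  proof (cases "Im z > 0")
    case True
    show thesis by (rule upper[OF True, of "\<lambda>x. x"]) auto
  next
    case False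
    show thesis
    proof (rule upper[of "cnj z" cnj])
      show "Im (cnj z) > 0" using False z by simp
      fix Q :: "nat \<Rightarrow> complex"
      assume "\<forall>n. Q (Suc n) = cnj z - of_real (b (Suc n)) - of_real ((a (Suc n))\<^sup>2) / Q n"
      then show "\<forall>n. cnj (Q (Suc n)) = z - of_real (b (Suc n)) - of_real ((a (Suc n))\<^sup>2) / cnj (Q n)"
        by simp
    qed auto
  qed
qed

text \<open>
  Around one period the weights telescope, so the contraction forces
  \<open>(\<Prod>a i)\<^sup>2 / \<bar>\<Prod>Q i\<bar>\<^sup>2 \<le> q\<^sup>k < 1\<close>.
\<close>

lemma periodic_subdominant:
  fixes a \<kappa> :: "nat \<Rightarrow> real" and Q :: "nat \<Rightarrow> complex"
  assumes k: "k \<ge> 1" and pa: "\<And>n. a (n + k) = a n"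
    and Qp: "\<And>n. Q (n + k) = Q n" and \<kappa>p: "\<And>n. \<kappa> (n + k) = \<kappa> n" and \<kappa>1: "\<And>n. 1 \<le> \<kappa> n"
    and Q0: "\<And>n. Q n \<noteq> 0" and q: "0 \<le> q" "q < 1"
    and step: "\<And>n. (a (Suc n))\<^sup>2 / (cmod (Q n) * cmod (Q (Suc n))) * \<kappa> (Suc n) \<le> q * \<kappa> n"
  shows "(\<Prod>i<k. a i) < cmod (\<Prod>i<k. Q i)"
proof -
  have sh: "(\<Prod>i<k. f (Suc i)) = (\<Prod>i<k. f i)" if "\<And>n. f (n + k) = f n" for f :: "nat \<Rightarrow> real"
  proof -
    obtain k' where k': "k = Suc k'" using k by (cases k) auto
    have "f (Suc k') = f 0" using that[of 0] k' by simp
    then show ?thesis unfolding k' by (simp add: prod.lessThan_Suc_shift[of f] mult.commute del: prod.lessThan_Suc) (simp add: mult.commute)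
  qed
  have ind: "(\<Prod>i<n. (a (Suc i))\<^sup>2 / (cmod (Q i) * cmod (Q (Suc i)))) * \<kappa> n \<le> q ^ n * \<kappa> 0" for n
  proof (induction n)
    case (Suc n)
    have "(\<Prod>i<Suc n. (a (Suc i))\<^sup>2 / (cmod (Q i) * cmod (Q (Suc i)))) * \<kappa> (Suc n)
       \<le> (\<Prod>i<n. (a (Suc i))\<^sup>2 / (cmod (Q i) * cmod (Q (Suc i)))) * (q * \<kappa> n)"
      using mult_left_mono[OF step[of n], of "\<Prod>i<n. (a (Suc i))\<^sup>2 / (cmod (Q i) * cmod (Q (Suc i)))"]
      by (simp add: prod_nonneg mult.assoc)
    also have "\<dots> = q * ((\<Prod>i<n. (a (Suc i))\<^sup>2 / (cmod (Q i) * cmod (Q (Suc i)))) * \<kappa> n)" by simp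
    also have "\<dots> \<le> q * (q ^ n * \<kappa> 0)" using Suc q by (intro mult_left_mono) auto
    finally show ?case by simp
  qed simp
  have "(\<Prod>i<k. (a (Suc i))\<^sup>2 / (cmod (Q i) * cmod (Q (Suc i)))) * \<kappa> 0 \<le> q ^ k * \<kappa> 0"
    using ind[of k] \<kappa>p[of 0] by simp
  then have "(\<Prod>i<k. (a (Suc i))\<^sup>2 / (cmod (Q i) * cmod (Q (Suc i)))) \<le> q ^ k"
    using \<kappa>1[of 0] by (simp add: mult_le_cancel_right)
  also have "\<dots> < 1" using q k by (simp add: power_less_one_iff)
  also have "(\<Prod>i<k. (a (Suc i))\<^sup>2 / (cmod (Q i) * cmod (Q (Suc i)))) = ((\<Prod>i<k. a i) / cmod (\<Prod>i<k. Q i))\<^sup>2"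
    using sh[of "\<lambda>i. (a i)\<^sup>2"] sh[of "\<lambda>i. cmod (Q i)"]
    by (simp add: prod_dividef prod.distrib pa Qp prod_norm power_divide prod_power_distrib flip: power2_eq_square)
  finally have "(\<Prod>i<k. a i) / cmod (\<Prod>i<k. Q i) < 1"
    by (metis abs_square_less_1 abs_ge_self order_le_less_trans)
  then show ?thesis using Q0 by (simp add: divide_less_eq split: if_splits)
qed

section \<open>Perturbed three-term recurrences\<close>

text \<open>
  Comparison of a perturbed recurrence with its periodic background. Write \<open>D n = x n * \<Prod>i<n. Q i\<close>.
  For the unperturbed recurrence the differences \<open>x (n+1) - x n\<close> contract in the weights \<open>\<kappa>\<close>, so that
  \<open>N n = \<bar>x (n+1)\<bar> + K * \<kappa> n * \<bar>x (n+1) - x n\<bar>\<close> is nonincreasing for a suitable \<open>K\<close>. A perturbation multiplies \<open>N\<close>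
  at step \<open>n\<close> by at most \<open>exp\<close> of a multiple of its size; the quadratic term from the product \<open>a * c\<close> is
  absorbed in a product of three factors \<open>1 + C * e\<close>. The perturbations thus enter only
  through the sum of their sizes.
\<close>

lemma perturbed_recurrence_bound:
  fixes D a b c Q :: "nat \<Rightarrow> complex" and a0 b0 \<kappa> :: "nat \<Rightarrow> real"
  assumes D: "\<And>n. D (Suc (Suc n)) = (z - b (Suc n)) * D (Suc n) - a (Suc n) * c (Suc n) * D n"
    and Q: "\<And>n. Q (Suc n) = z - of_real (b0 (Suc n)) - of_real ((a0 (Suc n))\<^sup>2) / Q n"
    and \<eta>: "\<eta> > 0" "\<And>n. cmod (Q n) \<ge> \<eta>"
    and \<kappa>: "\<And>n. 1 \<le> \<kappa> n" "\<And>n. \<kappa> n \<le> X"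
    and q: "0 \<le> q" "q < 1"
    and step: "\<And>n. (a0 (Suc n))\<^sup>2 / (cmod (Q n) * cmod (Q (Suc n))) * \<kappa> (Suc n) \<le> q * \<kappa> n"
    and A: "\<And>n. \<bar>a0 n\<bar> \<le> A"
  shows "\<exists>C1 C2. \<forall>n. cmod (D (Suc n)) \<le> C1 * (\<Prod>i<Suc n. cmod (Q i)) *
     exp (C2 * (\<Sum>j=1..n. cmod (a j - of_real (a0 j)) + cmod (b j - of_real (b0 j)) + cmod (c j - of_real (a0 j))))"
proof -
  define e where "e j = cmod (a j - of_real (a0 j)) + cmod (b j - of_real (b0 j)) + cmod (c j - of_real (a0 j))" for j
  define P where "P n = (\<Prod>i<n. Q i)" for n
  define x where "x n = D n / P n" for n
  \<comment> \<open>this choice gives \<open>(1 + K) * q \<le> K\<close>, so the contraction pays for the increment of \<open>x\<close>\<close>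
  define K where "K = 1 / (1 - q)"
  define N where "N n = cmod (x (Suc n)) + K * \<kappa> n * cmod (x (Suc n) - x n)" for n
  have Q0: "Q n \<noteq> 0" for n using \<eta>(2)[of n] \<eta>(1) by auto
  have P0: "P n \<noteq> 0" for n by (simp add: P_def Q0)
  have PS: "P (Suc n) = P n * Q n" for n by (simp add: P_def)
  have K1: "K \<ge> 1" using q by (simp add: K_def)
  have Kq: "(1 + K) * q \<le> K"
  proof -
    have "(1 + K) * q = K - 1 + q - (1 - q) + (1-q)" using q by (simp add: K_def field_simps)
    then show ?thesis using q by simp
  qed
  have X1: "X \<ge> 1" using \<kappa>[of 0] by linarith
  have A0: "A \<ge> 0" using A[of 0] by linarith
  \<comment> \<open>large enough to absorb the linear terms, and at least 1 so that \<open>C \<le> C\<^sup>2\<close> handles the quadratic one\<close>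
  define C where "C = max 1 ((1 + K) * X * max (1/\<eta>) (1/\<eta>\<^sup>2) * (1 + A))"
  have CX: "(1 + K) * X * (1/\<eta> * s) \<le> C * s" "(1 + K) * X * (1/\<eta>\<^sup>2 * s) \<le> C * s"
     "(1 + K) * X * (1/\<eta>\<^sup>2 * (A * s)) \<le> C * s" if "s \<ge> 0" for s
  proof -
    have m: "(1 + K) * X * u * v \<le> C" if "u \<ge> 0" "u \<le> max (1/\<eta>) (1/\<eta>\<^sup>2)" "v \<le> 1 + A" "v \<ge> 0" for u v
    proof -
      have "(1 + K) * X * u * v \<le> (1 + K) * X * max (1/\<eta>) (1/\<eta>\<^sup>2) * (1 + A)"
        using that K1 X1 \<eta>(1) by (intro mult_mono mult_nonneg_nonneg) (auto simp: le_max_iff_disj)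
      then show ?thesis by (simp add: C_def)
    qed
    show "(1 + K) * X * (1/\<eta> * s) \<le> C * s" using mult_right_mono[OF m[of "1/\<eta>" 1] that] A0 \<eta>(1) by (simp add: ac_simps)
    show "(1 + K) * X * (1/\<eta>\<^sup>2 * s) \<le> C * s" using mult_right_mono[OF m[of "1/\<eta>\<^sup>2" 1] that] A0 \<eta>(1) by (simp add: ac_simps)
    show "(1 + K) * X * (1/\<eta>\<^sup>2 * (A * s)) \<le> C * s"
      using mult_right_mono[OF m[of "1/\<eta>\<^sup>2" A] that] A0 \<eta>(1) by (simp add: ac_simps)
  qed
  have C1: "C \<ge> 1" by (simp add: C_def)
  have Nstep: "N (Suc n) \<le> N n * exp (C * e (Suc n))" for n
  proof -
    define ea eb ec where "ea = cmod (a (Suc n) - of_real (a0 (Suc n)))" "eb = cmod (b (Suc n) - of_real (b0 (Suc n)))"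
      "ec = cmod (c (Suc n) - of_real (a0 (Suc n)))"
    have e0: "ea \<ge> 0" "eb \<ge> 0" "ec \<ge> 0" by (simp_all add: ea_eb_ec_def)
    define \<Delta> \<Delta>' where "\<Delta> = x (Suc n) - x n" and "\<Delta>' = x (Suc (Suc n)) - x (Suc n)"
    define g where "g = a (Suc n) * c (Suc n) - of_real ((a0 (Suc n))\<^sup>2)"
    have D': "\<Delta>' = ((of_real (b0 (Suc n)) - b (Suc n)) / Q (Suc n)) * x (Suc n)
        + (of_real ((a0 (Suc n))\<^sup>2) / (Q n * Q (Suc n))) * \<Delta> - (g / (Q n * Q (Suc n))) * x n"
    proof -
      have bb: "z = Q (Suc n) + of_real (b0 (Suc n)) + of_real ((a0 (Suc n))\<^sup>2) / Q n"
        using Q[of n] by simp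
      show ?thesis
        unfolding \<Delta>'_def \<Delta>_def x_def D PS g_def bb using P0[of n] Q0
        by (simp add: field_simps)
    qed
    have iQ: "1 / cmod (Q m) \<le> 1 / \<eta>" for m using \<eta> by (simp add: frac_le)
    have iQQ: "1 / (cmod (Q n) * cmod (Q (Suc n))) \<le> 1 / \<eta>\<^sup>2"
      unfolding power2_eq_square using \<eta> Q0 by (intro divide_left_mono mult_mono mult_pos_pos) auto
    have g: "cmod g \<le> ea * ec + A * (ea + ec)"
    proof -
      have "g = (a (Suc n) - of_real (a0 (Suc n))) * (c (Suc n) - of_real (a0 (Suc n)))
        + of_real (a0 (Suc n)) * (a (Suc n) - of_real (a0 (Suc n))) + of_real (a0 (Suc n)) * (c (Suc n) - of_real (a0 (Suc n)))"
        by (simp add: g_def algebra_simps power2_eq_square)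
      then have "cmod g \<le> ea * ec + \<bar>a0 (Suc n)\<bar> * ea + \<bar>a0 (Suc n)\<bar> * ec"
        by (smt (verit, best) ea_eb_ec_def norm_mult norm_of_real norm_triangle_ineq)
      also have "\<dots> \<le> ea * ec + A * ea + A * ec" using A e0 by (intro add_mono mult_right_mono) auto
      finally show ?thesis by (simp add: algebra_simps)
    qed
    have \<kappa>0: "\<kappa> m > 0" for m using \<kappa>(1)[of m] by linarith
    have Nx: "cmod (x (Suc n)) \<le> N n" using K1 \<kappa>0[of n] by (simp add: N_def)
    have "1 * cmod \<Delta> \<le> (K * \<kappa> n) * cmod \<Delta>"
      using K1 \<kappa>(1)[of n] mult_mono[of 1 K 1 "\<kappa> n"] by (intro mult_right_mono) auto
    moreover have "cmod (x n) \<le> cmod (x (Suc n)) + cmod \<Delta>"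
      unfolding \<Delta>_def by (metis norm_minus_commute norm_triangle_sub)
    ultimately have Nx': "cmod (x n) \<le> N n" by (simp add: N_def \<Delta>_def)
    have N0: "N n \<ge> 0" using Nx norm_ge_zero order_trans by blast
    define p where "p = 1/\<eta> * eb + 1/\<eta>\<^sup>2 * (ea * ec + A * (ea + ec))"
    have p0: "p \<ge> 0" using e0 A0 \<eta> by (simp add: p_def)
    have d: "cmod \<Delta>' \<le> (a0 (Suc n))\<^sup>2 / (cmod (Q n) * cmod (Q (Suc n))) * cmod \<Delta> + p * N n"
    proof -
      have "cmod \<Delta>' \<le> cmod ((of_real (b0 (Suc n)) - b (Suc n)) / Q (Suc n)) * cmod (x (Suc n))
        + cmod (of_real ((a0 (Suc n))\<^sup>2) / (Q n * Q (Suc n))) * cmod \<Delta> + cmod (g / (Q n * Q (Suc n))) * cmod (x n)"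
        unfolding D' norm_mult[symmetric] by (meson norm_triangle_ineq4 norm_triangle_ineq add_mono order_refl order_trans)
      moreover have "cmod ((of_real (b0 (Suc n)) - b (Suc n)) / Q (Suc n)) \<le> 1/\<eta> * eb"
        using mult_right_mono[OF iQ[of "Suc n"] e0(2)] by (simp add: norm_divide ea_eb_ec_def norm_minus_commute)
      moreover have "cmod (g / (Q n * Q (Suc n))) \<le> 1/\<eta>\<^sup>2 * (ea * ec + A * (ea + ec))"
        using mult_mono[OF iQQ g] by (simp add: norm_divide norm_mult)
      moreover have "cmod (of_real ((a0 (Suc n))\<^sup>2) / (Q n * Q (Suc n))) = (a0 (Suc n))\<^sup>2 / (cmod (Q n) * cmod (Q (Suc n)))"
        by (simp add: norm_divide norm_mult norm_power)
      ultimately have "cmod \<Delta>' \<le> 1/\<eta> * eb * N n + (a0 (Suc n))\<^sup>2 / (cmod (Q n) * cmod (Q (Suc n))) * cmod \<Delta>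
          + 1/\<eta>\<^sup>2 * (ea * ec + A * (ea + ec)) * N n"
        using Nx Nx' e0 A0 \<eta>(1)
        by (smt (verit) mult_mono norm_ge_zero mult_right_mono)
      then show ?thesis by (simp add: p_def algebra_simps)
    qed
    have "\<kappa> (Suc n) * cmod \<Delta>' \<le> q * \<kappa> n * cmod \<Delta> + X * (p * N n)"
    proof -
      have "\<kappa> (Suc n) * cmod \<Delta>' \<le> \<kappa> (Suc n) * ((a0 (Suc n))\<^sup>2 / (cmod (Q n) * cmod (Q (Suc n))) * cmod \<Delta> + p * N n)"
        using d \<kappa>0[of "Suc n"] by (intro mult_left_mono) auto
      also have "\<dots> = ((a0 (Suc n))\<^sup>2 / (cmod (Q n) * cmod (Q (Suc n))) * \<kappa> (Suc n)) * cmod \<Delta> + \<kappa> (Suc n) * (p * N n)"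
        by (simp add: algebra_simps)
      also have "\<dots> \<le> (q * \<kappa> n) * cmod \<Delta> + X * (p * N n)"
        using step[of n] \<kappa>(2)[of "Suc n"] p0 N0 by (intro add_mono mult_right_mono) auto
      finally show ?thesis .
    qed
    then have k1: "(1 + K) * (\<kappa> (Suc n) * cmod \<Delta>') \<le> (1 + K) * q * (\<kappa> n * cmod \<Delta>) + (1 + K) * X * p * N n"
      using mult_left_mono[of "\<kappa> (Suc n) * cmod \<Delta>'" "q * \<kappa> n * cmod \<Delta> + X * (p * N n)" "1 + K"] K1 by (simp add: algebra_simps)
    have k2: "(1 + K) * q * (\<kappa> n * cmod \<Delta>) \<le> K * (\<kappa> n * cmod \<Delta>)"
      using Kq \<kappa>0[of n] by (intro mult_right_mono) auto
    have k3: "cmod \<Delta>' \<le> \<kappa> (Suc n) * cmod \<Delta>'" using \<kappa>(1)[of "Suc n"] mult_right_mono[of 1 "\<kappa> (Suc n)" "cmod \<Delta>'"] by simp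
    have k4: "cmod (x (Suc (Suc n))) \<le> cmod (x (Suc n)) + cmod \<Delta>'"
      unfolding \<Delta>'_def by (metis norm_triangle_sub)
    have "N (Suc n) \<le> cmod (x (Suc n)) + (1 + K) * (\<kappa> (Suc n) * cmod \<Delta>')"
      using k3 k4 unfolding N_def \<Delta>'_def[symmetric] by (simp add: algebra_simps)
    also have "\<dots> \<le> N n + (1 + K) * X * p * N n" using k1 k2 unfolding N_def \<Delta>_def[symmetric] by (simp add: algebra_simps)
    also have "\<dots> = N n * (1 + (1 + K) * X * p)" by (simp add: algebra_simps)
    also have "\<dots> \<le> N n * ((1 + C * ea) * (1 + C * eb) * (1 + C * ec))"
    proof (rule mult_left_mono[OF _ N0])
      have "(1 + K) * X * p = (1 + K) * X * (1/\<eta> * eb) + (1 + K) * X * (1/\<eta>\<^sup>2 * (ea * ec)) + (1 + K) * X * (1/\<eta>\<^sup>2 * (A * (ea + ec)))"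
        by (simp only: p_def distrib_left add.assoc)
      also have "\<dots> \<le> C * eb + C * (ea * ec) + C * (ea + ec)"
        using e0 by (intro add_mono CX) auto
      finally have 1: "1 + (1 + K) * X * p \<le> 1 + C * (ea + eb + ec) + C * (ea * ec)" by (simp add: algebra_simps)
      have 2: "C * (ea * ec) \<le> C * C * (ea * ec)" using C1 e0 mult_right_mono[of 1 C "C * (ea * ec)"] by (simp add: algebra_simps)
      have 3: "(1 + C * ea) * (1 + C * eb) * (1 + C * ec) = 1 + C * (ea + eb + ec) + C * C * (ea * ec) + (C * C * ea * eb + C * C * eb * ec + C * C * C * ea * eb * ec)"
        by (simp add: algebra_simps)
      have 4: "C * C * ea * eb + C * C * eb * ec + C * C * C * ea * eb * ec \<ge> 0" using C1 e0 by simp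
      show "1 + (1 + K) * X * p \<le> (1 + C * ea) * (1 + C * eb) * (1 + C * ec)" using 1 2 3 4 by linarith
    qed
    also have "\<dots> \<le> N n * (exp (C * ea) * exp (C * eb) * exp (C * ec))"
      using C1 e0 N0 by (intro mult_left_mono mult_mono exp_ge_add_one_self mult_nonneg_nonneg) auto
    also have "\<dots> = N n * exp (C * e (Suc n))" by (simp add: e_def ea_eb_ec_def exp_add[symmetric] algebra_simps)
    finally show ?thesis .
  qed
  have Nn: "N n \<le> N 0 * exp (C * (\<Sum>j=1..n. e j))" for n
  proof (induction n)
    case (Suc n)
    have "N (Suc n) \<le> N n * exp (C * e (Suc n))" by (rule Nstep)
    also have "\<dots> \<le> N 0 * exp (C * (\<Sum>j=1..n. e j)) * exp (C * e (Suc n))" using Suc by (intro mult_right_mono) auto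
    also have "\<dots> = N 0 * exp (C * (\<Sum>j=1..Suc n. e j))" by (simp add: exp_add[symmetric] algebra_simps)
    finally show ?case .
  qed simp
  have "cmod (D (Suc n)) \<le> N 0 * (\<Prod>i<Suc n. cmod (Q i)) * exp (C * (\<Sum>j=1..n. e j))" for n
  proof -
    have "0 \<le> K * \<kappa> n * cmod (x (Suc n) - x n)" using K1 \<kappa>(1)[of n] by simp
    then have "cmod (x (Suc n)) \<le> N n" unfolding N_def by linarith
    also note Nn[of n]
    finally have 1: "cmod (x (Suc n)) \<le> N 0 * exp (C * (\<Sum>j=1..n. e j))" .
    have "cmod (D (Suc n)) = cmod (x (Suc n)) * (\<Prod>i<Suc n. cmod (Q i))"
      using P0[of "Suc n"] by (simp add: x_def norm_divide P_def prod_norm norm_mult)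
    also have "\<dots> \<le> (N 0 * exp (C * (\<Sum>j=1..n. e j))) * (\<Prod>i<Suc n. cmod (Q i))"
      using 1 by (intro mult_right_mono prod_nonneg) auto
    finally show ?thesis by (simp add: mult_ac)
  qed
  then show ?thesis unfolding e_def by blast
qed

text \<open>
  A bound that is locally uniform in \<open>z\<close>, including real \<open>z\<close>. It only serves to dominate the
  potentials when the limit is taken under an integral.
\<close>

lemma recurrence_crude_bound:
  fixes D a b c :: "nat \<Rightarrow> complex"
  assumes D: "\<And>n. D (Suc (Suc n)) = (z - b (Suc n)) * D (Suc n) - a (Suc n) * c (Suc n) * D n"
  shows "cmod (D (Suc n)) \<le> (cmod (D 1) + cmod (D 0)) * exp (real n * cmod z + (\<Sum>j=1..n. cmod (a j) + cmod (b j) + cmod (c j)))"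
proof -
  define M where "M n = cmod (D (Suc n)) + cmod (D n)" for n
  have "M n \<le> M 0 * exp (real n * cmod z + (\<Sum>j=1..n. cmod (a j) + cmod (b j) + cmod (c j)))" for n
  proof (induction n)
    case (Suc n)
    let ?a = "cmod (a (Suc n))" and ?b = "cmod (b (Suc n))" and ?c = "cmod (c (Suc n))"
    have "cmod (D (Suc (Suc n))) \<le> cmod ((z - b (Suc n)) * D (Suc n)) + cmod (a (Suc n) * c (Suc n) * D n)"
      unfolding D by (rule norm_triangle_ineq4)
    also have "\<dots> \<le> (cmod z + ?b) * cmod (D (Suc n)) + ?a * ?c * cmod (D n)"
      unfolding norm_mult by (intro add_mono mult_right_mono norm_triangle_ineq4) auto
    finally have "M (Suc n) \<le> (cmod z + ?b) * cmod (D (Suc n)) + ?a * ?c * cmod (D n) + cmod (D (Suc n))" by (simp add: M_def)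
    also have "\<dots> \<le> (cmod z + ?b) * M n + ?a * ?c * M n + M n"
      by (intro add_mono mult_left_mono) (auto simp: M_def)
    also have "\<dots> = M n * (1 + cmod z + ?b + ?a * ?c)" by (simp add: algebra_simps)
    also have "\<dots> \<le> M n * ((1 + cmod z) * (1 + ?b) * (1 + ?a) * (1 + ?c))"
    proof (intro mult_left_mono)
      have "(1 + cmod z) * (1 + ?b) * (1 + ?a) * (1 + ?c) = (1 + cmod z + ?b + ?a * ?c) + (cmod z * ?b + (cmod z + ?b + cmod z * ?b) * (?a * ?c) + (1 + cmod z) * (1 + ?b) * (?a + ?c))"
        by (simp add: algebra_simps)
      then show "1 + cmod z + ?b + ?a * ?c \<le> (1 + cmod z) * (1 + ?b) * (1 + ?a) * (1 + ?c)" by simp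
    qed (simp add: M_def)
    also have "\<dots> \<le> M n * (exp (cmod z) * exp ?b * exp ?a * exp ?c)"
      by (intro mult_left_mono mult_mono exp_ge_add_one_self mult_nonneg_nonneg) (auto simp: M_def)
    also have "\<dots> \<le> (M 0 * exp (real n * cmod z + (\<Sum>j=1..n. cmod (a j) + cmod (b j) + cmod (c j)))) * (exp (cmod z) * exp ?b * exp ?a * exp ?c)"
      using Suc by (intro mult_right_mono) auto
    also have "\<dots> = M 0 * exp (real (Suc n) * cmod z + (\<Sum>j=1..Suc n. cmod (a j) + cmod (b j) + cmod (c j)))"
      by (simp add: exp_add[symmetric] algebra_simps)
    finally show ?case .
  qed simp
  from this[of n] show ?thesis unfolding M_def
    by simp (smt (verit) norm_ge_zero)
qed

section \<open>Determinants of Jacobi matrices and of the generating function\<close>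

lemma poly_char_poly_eq_det:
  fixes A :: "complex mat"
  assumes "A \<in> carrier_mat n n"
  shows "poly (char_poly A) z = det (Matrix.mat n n (\<lambda>(i, j). (if i = j then z else 0) - A $$ (i, j)))"
  unfolding char_poly_matrix[OF assms]
  by (rule arg_cong[of _ _ det], rule eq_matI) (use assms in \<open>auto simp: char_matrix_def\<close>)

lemma leading_block_carrier [simp]: "leading_block J n \<in> carrier_mat n n"
  by (simp add: leading_block_def)

lemma poly_char_poly_jacobi:
  "poly (char_poly (leading_block (jacobi a b c) n)) z =
     det (Matrix.mat n n (\<lambda>(i, j). (if i = j then z else 0) - jacobi a b c i j))"
  unfolding poly_char_poly_eq_det[OF leading_block_carrier]
  by (rule arg_cong[of _ _ det], rule eq_matI) (auto simp: leading_block_def)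

text \<open>
  Laplace expansion along the last row, and then along the last column of the second minor.
\<close>

lemma char_poly_jacobi_recurrence:
  fixes a b c :: "nat \<Rightarrow> complex" and z :: complex
  defines "D \<equiv> \<lambda>n. poly (char_poly (leading_block (jacobi a b c) n)) z"
  shows "D 0 = 1" "D (Suc 0) = z - b 0"
    "D (Suc (Suc n)) = (z - b (Suc n)) * D (Suc n) - a (Suc n) * c (Suc n) * D n"
proof -
  define T where "T n = Matrix.mat n n (\<lambda>(i, j). (if i = j then z else 0) - jacobi a b c i j)" for n
  have D: "D n = det (T n)" for n
    unfolding D_def T_def by (rule poly_char_poly_jacobi)
  have T: "T n \<in> carrier_mat n n" for n by (simp add: T_def)
  show "D 0 = 1" unfolding D using T[of 0] by simp
  show "D (Suc 0) = z - b 0"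
    unfolding D using T[of 1] by (simp add: det_single T_def jacobi_def)
  let ?T = "T (Suc (Suc n))"
  define M where "M = mat_delete ?T (Suc n) n"
  have M: "M \<in> carrier_mat (Suc n) (Suc n)" by (simp add: M_def mat_delete_def T_def)
  have del1: "mat_delete ?T (Suc n) (Suc n) = T (Suc n)"
    by (rule eq_matI) (auto simp: mat_delete_def T_def)
  have del2: "mat_delete M n n = T n"
    by (rule eq_matI) (auto simp: mat_delete_def T_def M_def)
  have "det M = (\<Sum>i<Suc n. M $$ (i, n) * cofactor M i n)"
    by (rule laplace_expansion_column[OF M]) simp
  also have "\<dots> = (\<Sum>i\<in>{n}. M $$ (i, n) * cofactor M i n)"
    by (rule sum.mono_neutral_right) (auto simp: M_def mat_delete_def T_def jacobi_def)
  also have "\<dots> = - c (Suc n) * det (T n)"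
    by (simp add: cofactor_def del2) (simp add: M_def mat_delete_def T_def jacobi_def)
  finally have detM: "det M = - c (Suc n) * det (T n)" .
  have "det ?T = (\<Sum>j<Suc (Suc n). ?T $$ (Suc n, j) * cofactor ?T (Suc n) j)"
    by (rule laplace_expansion_row[OF T]) simp
  also have "\<dots> = (\<Sum>j\<in>{n, Suc n}. ?T $$ (Suc n, j) * cofactor ?T (Suc n) j)"
    by (rule sum.mono_neutral_right) (auto simp: T_def jacobi_def)
  also have "\<dots> = (z - b (Suc n)) * det (T (Suc n)) - a (Suc n) * c (Suc n) * det (T n)"
    by (simp add: cofactor_def del1 M_def[symmetric] detM) (simp add: T_def jacobi_def)
  finally show "D (Suc (Suc n)) = (z - b (Suc n)) * D (Suc n) - a (Suc n) * c (Suc n) * D n"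
    by (simp only: D)
qed

text \<open>
  Only two terms survive in the expansion along the first row; their minors are triangular. For
  \<open>k = 1\<close> the corner entry falls onto the diagonal, for which reason the entries are added up.
\<close>

lemma det_cyclic_bidiagonal:
  fixes d s :: "nat \<Rightarrow> complex"
  assumes k: "k \<ge> 1"
  shows "det (Matrix.mat k k (\<lambda>(i, j). (if i = j then d i else 0) + (if i = Suc j then s i else 0)
            + (if i = 0 \<and> Suc j = k then s 0 else 0)))
     = (\<Prod>i<k. d i) + (-1) ^ (k - 1) * (\<Prod>i<k. s i)" (is "det ?M = _")
proof (cases "k = 1")
  case True
  have "det ?M = ?M $$ (0, 0)" using True by (intro det_single) auto
  then show ?thesis using True by simp
next
  case False
  then obtain m where m: "k = Suc (Suc m)" using k
    by (metis One_nat_def Suc_pred' le_numeral_extra(3) less_Suc_eq_0_disj not0_implies_Suc not_one_le_zero)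
  have M: "?M \<in> carrier_mat k k" by simp
  have "det ?M = (\<Sum>j<k. ?M $$ (0, j) * cofactor ?M 0 j)"
    by (rule laplace_expansion_row[OF M]) (use k in simp)
  also have "\<dots> = (\<Sum>j\<in>{0, Suc m}. ?M $$ (0, j) * cofactor ?M 0 j)"
    by (rule sum.mono_neutral_right) (auto simp: m)
  also have "\<dots> = d 0 * det (mat_delete ?M 0 0) + s 0 * ((-1) ^ Suc m * det (mat_delete ?M 0 (Suc m)))"
    by (simp add: m cofactor_def)
  also have "det (mat_delete ?M 0 0) = (\<Prod>i<Suc m. d (Suc i))"
  proof -
    have "det (mat_delete ?M 0 0) = prod_list (diag_mat (mat_delete ?M 0 0))"
      by (rule det_lower_triangular[of "Suc m"]) (auto simp: mat_delete_def m)
    also have "\<dots> = (\<Prod>i<Suc m. d (Suc i))"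
      unfolding prod_list_diag_prod by (intro prod.cong) (auto simp: mat_delete_def m)
    finally show ?thesis .
  qed
  also have "det (mat_delete ?M 0 (Suc m)) = (\<Prod>i<Suc m. s (Suc i))"
  proof -
    have "det (mat_delete ?M 0 (Suc m)) = prod_list (diag_mat (mat_delete ?M 0 (Suc m)))"
      by (rule det_upper_triangular[of _ "Suc m"]) (auto simp: mat_delete_def m upper_triangular_def)
    also have "\<dots> = (\<Prod>i<Suc m. s (Suc i))"
      unfolding prod_list_diag_prod by (intro prod.cong) (auto simp: mat_delete_def m)
    finally show ?thesis .
  qed
  finally show ?thesis
    unfolding m by (simp only: prod.lessThan_Suc_shift[of d "Suc m"] prod.lessThan_Suc_shift[of s "Suc m"]) simp
qed

lemma generating_function_carrier [simp]: "generating_function k a b t \<in> carrier_mat k k"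
  by (simp add: generating_function_def leading_block_def matrix_unit_def)

lemma generating_function_entry:
  assumes "i < k" "j < k"
  shows "generating_function k a b t $$ (i, j) =
    (if i = j then of_real (b i) else 0) + (if i = Suc j then of_real (a i) else 0) + (if j = Suc i then of_real (a j) else 0)
    + (if i = 0 \<and> Suc j = k then of_real (a 0) * cis t else 0)
    + (if Suc i = k \<and> j = 0 then of_real (a 0) * cis (- t) else 0)"
  using assms by (auto simp: generating_function_def leading_block_def matrix_unit_def symmetric_jacobi_def jacobi_def cis_conv_exp)

text \<open>
  The recursion for \<open>Q\<close> says exactly that the periodic matrix \<open>z - \<theta>(t)\<close> factors as \<open>L * U\<close> with cyclic
  bidiagonal factors: \<open>L\<close> has unit diagonal and subdiagonal \<open>- a i / Q (i-1)\<close>, \<open>U\<close> has diagonal \<open>Q i\<close> and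
  superdiagonal \<open>- a i\<close>. The phases \<open>cis t\<close> and \<open>cis (-t)\<close> sit in the two corners, and the indices \<open>0\<close> and
  \<open>k - 1\<close> are neighbours.
\<close>

lemma char_poly_generating_function:
  fixes Q :: "nat \<Rightarrow> complex" and a b :: "nat \<Rightarrow> real"
  assumes k: "k \<ge> 1" and pa: "\<And>n. a (n + k) = a n" and pb: "\<And>n. b (n + k) = b n"
    and Qp: "\<And>n. Q (n + k) = Q n" and Q0: "\<And>n. Q n \<noteq> 0"
    and QS: "\<And>n. Q (Suc n) = z - of_real (b (Suc n)) - of_real ((a (Suc n))\<^sup>2) / Q n"
  defines "\<gamma> \<equiv> of_real (\<Prod>i<k. a i) / (\<Prod>i<k. Q i)"
  shows "poly (char_poly (generating_function k a b t)) z =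
    (\<Prod>i<k. Q i) * (1 - \<gamma> * cis t) * (1 - \<gamma> * cis (- t))"
proof -
  \<comment> \<open>the cyclic predecessor of a row index\<close>
  define p where "p i = (if i = 0 then k - 1 else i - 1)" for i :: nat
  define r where "r i = - (of_real (a i) / Q (p i))" for i
  define L where "L = Matrix.mat k k (\<lambda>(i, j). (if i = j then 1 else 0) + (if i = Suc j then r i else 0)
            + (if i = 0 \<and> Suc j = k then r 0 * cis t else 0))"
  define U where "U = Matrix.mat k k (\<lambda>(i, j). (if i = j then Q i else 0) + (if j = Suc i then - of_real (a j) else 0)
            + (if Suc i = k \<and> j = 0 then - of_real (a 0) * cis (- t) else 0))"
  have pk: "p i < k" if "i < k" for i using that by (auto simp: p_def)
  have Qp': "Q i + of_real ((a i)\<^sup>2) / Q (p i) = z - of_real (b i)" if "i < k" for i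
  proof (cases i)
    case 0
    have "Q k = Q 0" "a k = a 0" "b k = b 0" using Qp[of 0] pa[of 0] pb[of 0] by simp_all
    then show ?thesis using QS[of "k - 1"] k 0 by (simp add: p_def)
  next
    case (Suc i') then show ?thesis using QS[of i'] by (simp add: p_def)
  qed
  define \<rho> where "\<rho> i = (if i = 0 then r 0 * cis t else r i)" for i
  define u where "u i j = (if i = j then Q i else 0) + (if j = Suc i then - of_real (a j) else 0)
            + (if Suc i = k \<and> j = 0 then - of_real (a 0) * cis (- t) else 0)" for i j
  have Lc: "L \<in> carrier_mat k k" and Uc: "U \<in> carrier_mat k k" by (simp_all add: L_def U_def)
  have entry: "u i j + \<rho> i * u (p i) j = (if i = j then z else 0) - generating_function k a b t $$ (i, j)"
    if ij: "i < k" "j < k" for i j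
  proof (cases i)
    case 0
    have "cis t * cis (- t) = 1" by (simp add: cis_mult)
    then have c: "\<rho> 0 * (of_real (a 0) * cis (- t)) = - (of_real ((a 0)\<^sup>2) / Q (p 0))"
      by (simp add: \<rho>_def r_def power2_eq_square)
    have c2: "\<rho> 0 * Q (p 0) = - (of_real (a 0) * cis t)" using Q0 by (simp add: \<rho>_def r_def)
    have c3: "Q 0 = z - of_real (b 0) - of_real ((a 0)\<^sup>2) / Q (p 0)" using Qp'[of 0] k by (simp add: algebra_simps)
    have "u (p 0) j = (if Suc j = k then Q (p 0) else 0) - (if j = 0 then of_real (a 0) * cis (- t) else 0)"
      using ij k by (auto simp: u_def p_def)
    then have e1: "\<rho> 0 * u (p 0) j = (if Suc j = k then - (of_real (a 0) * cis t) else 0) + (if j = 0 then of_real ((a 0)\<^sup>2) / Q (p 0) else 0)"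
      using c c2 by (auto simp: right_diff_distrib)
    have k0: "0 < k" using k by simp
    show ?thesis
      unfolding 0 e1 generating_function_entry[OF k0 ij(2)] using ij k c3 by (auto simp: u_def)
  next
    case (Suc i')
    have pi: "p i = i'" by (simp add: p_def Suc)
    have c: "\<rho> i * Q i' = - of_real (a i)" "\<rho> i * of_real (a i) = - (of_real ((a i)\<^sup>2) / Q i')"
      using Q0[of i'] by (simp_all add: \<rho>_def r_def pi Suc power2_eq_square p_def)
    have c3: "Q i = z - of_real (b i) - of_real ((a i)\<^sup>2) / Q i'" using Qp'[of i] ij by (simp add: pi algebra_simps)
    have "u i' j = (if i' = j then Q i' else 0) - (if j = i then of_real (a i) else 0)"
      using ij by (auto simp: u_def Suc)
    then have e1: "\<rho> i * u (p i) j = (if i' = j then - of_real (a i) else 0) + (if j = i then of_real ((a i)\<^sup>2) / Q i' else 0)"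
      using c by (auto simp: right_diff_distrib pi)
    show ?thesis
      unfolding e1 generating_function_entry[OF ij] using ij k c3 by (auto simp: u_def Suc)
  qed
  have LU: "L * U = Matrix.mat k k (\<lambda>(i, j). (if i = j then z else 0) - generating_function k a b t $$ (i, j))"
  proof (rule eq_matI)
    fix i j assume "i < dim_row (Matrix.mat k k (\<lambda>(i, j). (if i = j then z else 0) - generating_function k a b t $$ (i, j)))"
      "j < dim_col (Matrix.mat k k (\<lambda>(i, j). (if i = j then z else 0) - generating_function k a b t $$ (i, j)))"
    then have ij: "i < k" "j < k" by auto
    have l: "L $$ (i, x) = (if x = i then 1 else 0) + (if x = p i then \<rho> i else 0)" if "x < k" for x
      using ij that by (auto simp: L_def p_def \<rho>_def)
    have "(L * U) $$ (i, j) = (\<Sum>x\<in>{0..<k}. L $$ (i, x) * U $$ (x, j))"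
      using Lc Uc ij by (simp add: scalar_prod_def)
    also have "\<dots> = (\<Sum>x\<in>{0..<k}. (if x = i then u x j else 0) + (if x = p i then \<rho> i * u x j else 0))"
      using ij by (intro sum.cong) (auto simp: l U_def u_def distrib_right)
    also have "\<dots> = u i j + \<rho> i * u (p i) j"
      using ij pk[of i] by (simp add: sum.distrib)
    finally show "(L * U) $$ (i, j) = Matrix.mat k k (\<lambda>(i, j). (if i = j then z else 0) - generating_function k a b t $$ (i, j)) $$ (i, j)"
      using entry[OF ij] ij by simp
  qed (use Lc Uc in auto)
  have "det L = 1 + (-1) ^ (k - 1) * (\<Prod>i<k. if i = 0 then r 0 * cis t else r i)"
  proof -
    have L': "L = Matrix.mat k k (\<lambda>(i, j). (if i = j then 1 else 0) + (if i = Suc j then (if i = 0 then r 0 * cis t else r i) else 0)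
            + (if i = 0 \<and> Suc j = k then (if (0::nat) = 0 then r 0 * cis t else r 0) else 0))"
      by (rule eq_matI) (auto simp: L_def)
    have "det L = (\<Prod>i<k. 1) + (-1) ^ (k - 1) * (\<Prod>i<k. if i = 0 then r 0 * cis t else r i)"
      unfolding L' by (rule det_cyclic_bidiagonal[OF k])
    then show ?thesis by simp
  qed
  moreover have "(\<Prod>i<k. if i = 0 then r 0 * cis t else r i) = (-1) ^ k * \<gamma> * cis t"
  proof -
    obtain m where m: "k = Suc m" using k by (cases k) auto
    have "(\<Prod>i<k. if i = 0 then r 0 * cis t else r i) = cis t * (\<Prod>i<k. r i)"
      unfolding m by (simp only: prod.lessThan_Suc_shift) simp
    also have "(\<Prod>i<k. r i) = (-1) ^ k * (of_real (\<Prod>i<k. a i) / (\<Prod>i<k. Q (p i)))"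
      by (simp add: r_def prod_uminus prod_dividef)
    also have "(\<Prod>i<k. Q (p i)) = (\<Prod>i<k. Q i)"
      unfolding m by (subst prod.lessThan_Suc_shift) (simp add: p_def m mult.commute)
    finally show ?thesis by (simp add: \<gamma>_def)
  qed
  moreover have "det U = (\<Prod>i<k. Q i) + (-1) ^ (k - 1) * (\<Prod>i<k. - (if i = 0 then of_real (a 0) * cis (- t) else of_real (a i)))"
  proof -
    have U': "transpose_mat U = Matrix.mat k k (\<lambda>(i, j). (if i = j then Q i else 0) + (if i = Suc j then - (if i = 0 then of_real (a 0) * cis (- t) else of_real (a i)) else 0)
            + (if i = 0 \<and> Suc j = k then - (if (0::nat) = 0 then of_real (a 0) * cis (- t) else of_real (a 0)) else 0))"
      by (rule eq_matI) (auto simp: U_def)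
    show ?thesis
      unfolding det_transpose[OF Uc, symmetric] U' by (rule det_cyclic_bidiagonal[OF k])
  qed
  moreover have "(\<Prod>i<k. - (if i = 0 then of_real (a 0) * cis (- t) else of_real (a i))) = (-1) ^ k * (of_real (\<Prod>i<k. a i) * cis (- t))"
  proof -
    obtain m where m: "k = Suc m" using k by (cases k) auto
    have "(\<Prod>i<k. if i = 0 then of_real (a 0) * cis (- t) else of_real (a i)) = of_real (\<Prod>i<k. a i) * cis (- t)"
      unfolding m by (simp only: prod.lessThan_Suc_shift) simp
    then show ?thesis by (simp add: prod_uminus)
  qed
  moreover have "(-1) ^ (k - 1) * (-1) ^ k = (-1 :: complex)"
  proof -
    obtain m where "k = Suc m" using k by (cases k) auto
    then show ?thesis by (simp add: power_mult_distrib[symmetric])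
  qed
  ultimately have "det L = 1 - \<gamma> * cis t" "det U = (\<Prod>i<k. Q i) - of_real (\<Prod>i<k. a i) * cis (- t)"
    by (simp_all add: mult.assoc[symmetric])
  moreover have "of_real (\<Prod>i<k. a i) = (\<Prod>i<k. Q i) * \<gamma>"
    using Q0 by (simp add: \<gamma>_def)
  ultimately have "det L = 1 - \<gamma> * cis t" "det U = (\<Prod>i<k. Q i) * (1 - \<gamma> * cis (- t))"
    by (simp_all add: right_diff_distrib mult.assoc)
  then have "det L * det U = (\<Prod>i<k. Q i) * (1 - \<gamma> * cis t) * (1 - \<gamma> * cis (- t))"
    by (simp add: mult_ac)
  moreover have "poly (char_poly (generating_function k a b t)) z = det L * det U"
    unfolding poly_char_poly_eq_det[OF generating_function_carrier] LU[symmetric] by (rule det_mult[OF Lc Uc])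
  ultimately show ?thesis by simp
qed

section \<open>Eigenvalues of the generating function\<close>

text \<open>
  Let \<open>\<gamma> = (\<Prod>a i) / (\<Prod>Q i)\<close>. As \<open>\<bar>\<gamma>\<bar> < 1\<close>, no factor of the determinant vanishes off the real axis. Multiplying the two factors
  out, only the cross term depends on \<open>t\<close>, and \<open>(\<Prod>Q i) * \<gamma> = \<Prod>a i\<close> does not depend on \<open>z\<close>.
\<close>

lemma nonreal_nonroot:
  fixes a b :: "nat \<Rightarrow> real"
  assumes k: "k \<ge> 1" and apos: "\<And>n. a n > 0" and pa: "\<And>n. a (n + k) = a n" and pb: "\<And>n. b (n + k) = b n"
    and z: "Im z \<noteq> 0"
  shows "poly (char_poly (generating_function k a b t)) z \<noteq> 0"
    and "poly (char_poly (generating_function k a b t)) z - poly (char_poly (generating_function k a b (pi/2))) z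
      = - of_real (2 * (\<Prod>i<k. a i) * cos t)"
proof -
  obtain Q \<eta> \<kappa> X q where Q: "\<And>n. Q (n + k) = Q n" "\<And>n. Q (Suc n) = z - of_real (b (Suc n)) - of_real ((a (Suc n))\<^sup>2) / Q n"
    "\<eta> > 0" "\<And>n. cmod (Q n) \<ge> \<eta>" "\<And>n. \<kappa> (n + k) = \<kappa> n" "\<And>n. 1 \<le> \<kappa> n" "\<And>n. \<kappa> n \<le> X" "0 \<le> q" "q < 1"
    "\<And>n. (a (Suc n))\<^sup>2 / (cmod (Q n) * cmod (Q (Suc n))) * \<kappa> (Suc n) \<le> q * \<kappa> n"
    by (rule periodic_continued_fraction[where a=a and b=b and z=z and k=k, OF k pa pb z]) (rule that)
  have Q0: "Q n \<noteq> 0" for n using Q(3) Q(4)[of n] by auto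
  define \<gamma> where "\<gamma> = of_real (\<Prod>i<k. a i) / (\<Prod>i<k. Q i)"
  have P: "poly (char_poly (generating_function k a b t)) z = (\<Prod>i<k. Q i) * (1 - \<gamma> * cis t) * (1 - \<gamma> * cis (- t))" for t
    unfolding \<gamma>_def by (rule char_poly_generating_function[where a=a and b=b, OF k pa pb Q(1) Q0 Q(2)])
  have "(\<Prod>i<k. a i) < cmod (\<Prod>i<k. Q i)"
    by (rule periodic_subdominant[where a=a and Q=Q and \<kappa>=\<kappa>, OF k pa Q(1,5,6) Q0 Q(8,9,10)])
  moreover have "(\<Prod>i<k. a i) > 0" using apos by (intro prod_pos) auto
  moreover from calculation have "0 < cmod (\<Prod>i<k. Q i)" by linarith
  ultimately have g: "cmod \<gamma> < 1" by (simp add: \<gamma>_def norm_divide del: of_real_prod)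
  have "1 - \<gamma> * cis s \<noteq> 0" for s
  proof
    assume "1 - \<gamma> * cis s = 0"
    then have "cmod (\<gamma> * cis s) = 1" by simp
    then show False using g by (simp add: norm_mult)
  qed
  then show "poly (char_poly (generating_function k a b t)) z \<noteq> 0" unfolding P using Q0 by simp
  have gQ: "(\<Prod>i<k. Q i) * \<gamma> = of_real (\<Prod>i<k. a i)" using Q0 by (simp add: \<gamma>_def)
  have cc: "cis s * cis (- s) = 1" "cis s + cis (- s) = of_real (2 * cos s)" for s
    by (simp_all add: cis_mult complex_eq_iff)
  have P2: "poly (char_poly (generating_function k a b s)) z = (\<Prod>i<k. Q i) * (1 + \<gamma>\<^sup>2) - of_real (2 * (\<Prod>i<k. a i) * cos s)" for s
  proof -
    have "poly (char_poly (generating_function k a b s)) z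
      = (\<Prod>i<k. Q i) * (1 + \<gamma>\<^sup>2 * (cis s * cis (- s))) - ((\<Prod>i<k. Q i) * \<gamma>) * (cis s + cis (- s))"
      unfolding P by (simp add: algebra_simps power2_eq_square)
    also have "\<dots> = (\<Prod>i<k. Q i) * (1 + \<gamma>\<^sup>2) - of_real (2 * (\<Prod>i<k. a i) * cos s)"
      unfolding gQ cc by simp
    finally show ?thesis .
  qed
  show "poly (char_poly (generating_function k a b t)) z - poly (char_poly (generating_function k a b (pi/2))) z
      = - of_real (2 * (\<Prod>i<k. a i) * cos t)"
    unfolding P2 by simp
qed

lemma char_poly_generating_function_cos:
  fixes a b :: "nat \<Rightarrow> real"
  assumes k: "k \<ge> 1" and apos: "\<And>n. a n > 0" and pa: "\<And>n. a (n + k) = a n" and pb: "\<And>n. b (n + k) = b n"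
  shows "char_poly (generating_function k a b t) =
    char_poly (generating_function k a b (pi/2)) - [: of_real (2 * (\<Prod>i<k. a i) * cos t) :]" (is "?p = ?q")
proof (rule ccontr)
  assume "?p \<noteq> ?q"
  then have "finite {z. poly (?p - ?q) z = 0}" by (intro poly_roots_finite) auto
  moreover have "{z. Im z \<noteq> 0} \<subseteq> {z. poly (?p - ?q) z = 0}"
    using nonreal_nonroot(2)[where a=a and b=b and t=t, OF k apos pa pb] by (auto simp: algebra_simps)
  moreover have "infinite {z. Im z \<noteq> 0}"
  proof -
    have "range (\<lambda>n. Complex 0 (real (Suc n))) \<subseteq> {z. Im z \<noteq> 0}" by auto
    moreover have "infinite (range (\<lambda>n. Complex 0 (real (Suc n))))"
      by (rule range_inj_infinite) (auto simp: inj_def)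
    ultimately show ?thesis using infinite_super by blast
  qed
  ultimately show False using finite_subset by blast
qed

text \<open>
  The eigenvalues are the solutions of \<open>p x = 2 * (\<Prod>a i) * cos t\<close> for one fixed polynomial \<open>p\<close> of positive degree.
\<close>

lemma eigenvalues_generating_function_bounded:
  fixes a b :: "nat \<Rightarrow> real"
  assumes k: "k \<ge> 1" and apos: "\<And>n. a n > 0" and pa: "\<And>n. a (n + k) = a n" and pb: "\<And>n. b (n + k) = b n"
  shows "\<exists>R>0. \<forall>t z. poly (char_poly (generating_function k a b t)) z = 0 \<longrightarrow> cmod z \<le> R"
proof -
  let ?p = "char_poly (generating_function k a b (pi/2))"
  define c where "c = 2 * (\<Prod>i<k. a i)"
  have c0: "c > 0" unfolding c_def using apos by (simp add: prod_pos)
  have deg: "degree ?p = k" using degree_monic_char_poly[OF generating_function_carrier] by blast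
  obtain c' q where p: "?p = pCons c' q" by (metis pCons_cases)
  have "q \<noteq> 0" using deg k p by auto
  then obtain r where r: "\<And>z. r \<le> cmod z \<Longrightarrow> c + 1 \<le> cmod (poly ?p z)"
    using poly_infinity[of q "c + 1" c'] p by auto
  have "cmod z \<le> max 1 r" if "poly (char_poly (generating_function k a b t)) z = 0" for t z
  proof (rule ccontr)
    assume "\<not> cmod z \<le> max 1 r"
    then have "c + 1 \<le> cmod (poly ?p z)" by (intro r) auto
    moreover have "poly ?p z = of_real (c * cos t)"
      using that unfolding char_poly_generating_function_cos[where t=t and a=a and b=b, OF k apos pa pb] by (simp add: c_def)
    moreover have "\<bar>c * cos t\<bar> \<le> c" using c0 by (simp add: abs_mult)
    ultimately show False by (metis add_le_same_cancel1 norm_of_real not_one_le_zero order_trans)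
  qed
  then show ?thesis by (intro exI[of _ "max 1 r"]) auto
qed

lemma pcompose_monom:
  "pcompose (monom a j) c = Polynomial.smult (a :: 'a::comm_ring_1) (c ^ j)"
  by (induction j) (simp_all add: monom_0 monom_Suc pcompose_pCons)

lemma coeff_pcompose_eq_sum:
  fixes p c :: "'a::comm_ring_1 poly"
  assumes "degree p \<le> k"
  shows "coeff (pcompose p c) i = (\<Sum>j\<le>k. coeff p j * coeff (c ^ j) i)"
proof -
  have "pcompose p c = pcompose (\<Sum>j\<le>k. monom (coeff p j) j) c"
    by (simp only: poly_as_sum_of_monoms'[OF assms])
  also have "\<dots> = (\<Sum>j\<le>k. Polynomial.smult (coeff p j) (c ^ j))"
    by (simp add: pcompose_sum pcompose_monom)
  finally show ?thesis by (simp add: coeff_sum)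
qed

lemma coeff_nonneg_prod_list:
  fixes xs :: "real list"
  assumes "\<And>y. y \<in> set xs \<Longrightarrow> y \<le> x"
  shows "coeff (\<Prod>y\<leftarrow>xs. [:x - y, 1:]) i \<ge> 0"
  using assms
proof (induction xs arbitrary: i)
  case (Cons y xs)
  have "coeff (pCons 0 (\<Prod>y\<leftarrow>xs. [:x - y, 1:])) i \<ge> 0" using Cons by (cases i) auto
  then show ?case using Cons by simp
qed (simp add: coeff_1)

text \<open>
  If all roots are at most \<open>x\<close>, the polynomial is a product of factors \<open>X + (x - y)\<close> with nonnegative
  coefficients after the shift by \<open>x\<close>; conversely, a nonzero polynomial with nonnegative coefficients
  has no positive root. This turns a condition on roots into countably many conditions on
  coefficients.
\<close>

lemma roots_le_iff_taylor_nonneg: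
  fixes xs :: "real list"
  defines "p \<equiv> (\<Prod>y\<leftarrow>xs. [:- y, 1:])"
  shows "(\<forall>y\<in>set xs. y \<le> x) \<longleftrightarrow> (\<forall>i. coeff (pcompose p [:x, 1:]) i \<ge> 0)"
proof
  have eq: "pcompose p [:x, 1:] = (\<Prod>y\<leftarrow>xs. [:x - y, 1:])"
    unfolding p_def
  proof (induction xs)
    case (Cons y xs)
    have "pcompose [:- y, 1:] [:x, 1:] = [:x - y, 1:]" by (simp add: pcompose_pCons)
    then show ?case using Cons by (simp only: list.map prod_list.Cons pcompose_mult)
  qed simp
  show "\<forall>i. coeff (pcompose p [:x, 1:]) i \<ge> 0" if "\<forall>y\<in>set xs. y \<le> x"
    unfolding eq using that coeff_nonneg_prod_list by blast
  assume nn: "\<forall>i. coeff (pcompose p [:x, 1:]) i \<ge> 0"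
  show "\<forall>y\<in>set xs. y \<le> x"
  proof (rule ballI, rule ccontr)
    fix y assume y: "y \<in> set xs" "\<not> y \<le> x"
    let ?s = "pcompose p [:x, 1:]"
    have "poly p y = 0" using y(1) unfolding p_def by (induction xs) auto
    then have "poly ?s (y - x) = 0" by (simp add: poly_pcompose)
    moreover have "lead_coeff ?s > 0"
    proof -
      have "lead_coeff p = 1" unfolding p_def
        by (induction xs) (simp_all only: list.map prod_list.Nil prod_list.Cons lead_coeff_mult, simp_all)
      then show ?thesis by (subst lead_coeff_comp) simp_all
    qed
    moreover have "poly ?s (y - x) \<ge> lead_coeff ?s * (y - x) ^ degree ?s"
      unfolding poly_altdef by (rule member_le_sum[of _ _ "\<lambda>i. coeff ?s i * (y - x) ^ i"]) (use nn y in auto)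
    ultimately show False using y(2) by (metis diff_gt_0_iff_gt linorder_not_le mult_pos_pos zero_less_power)
  qed
qed

text \<open>
  Deflation: the largest root is measurable by the criterion above, the coefficients of the quotient
  by the corresponding linear factor are then measurable as well, and one continues with the quotient.
\<close>

lemma measurable_real_roots:
  fixes p :: "'a \<Rightarrow> real poly"
  assumes "\<And>t. t \<in> space M \<Longrightarrow> \<exists>xs. length xs = k \<and> p t = (\<Prod>x\<leftarrow>xs. [:- x, 1:])"
    and "\<And>i. (\<lambda>t. coeff (p t) i) \<in> borel_measurable M"
  shows "\<exists>X. (\<forall>j<k. X j \<in> borel_measurable M) \<and> (\<forall>t\<in>space M. p t = (\<Prod>j<k. [:- X j t, 1:]))"
  using assms
proof (induction k arbitrary: p)
  case 0
  then show ?case by auto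
next
  case (Suc k)
  have "\<exists>xs. \<forall>t\<in>space M. length (xs t) = Suc k \<and> p t = (\<Prod>x\<leftarrow>xs t. [:- x, 1:])"
    using Suc.prems(1) by (intro bchoice ballI)
  then obtain xs where xs: "\<And>t. t \<in> space M \<Longrightarrow> length (xs t) = Suc k" "\<And>t. t \<in> space M \<Longrightarrow> p t = (\<Prod>x\<leftarrow>xs t. [:- x, 1:])"
    by blast
  define r where "r t = Max (set (xs t))" for t
  define ys where "ys t = remove1 (r t) (xs t)" for t
  define q where "q t = (\<Prod>x\<leftarrow>ys t. [:- x, 1:])" for t
  have deg: "degree (\<Prod>x\<leftarrow>zs. [:- x, 1:]) = length zs" for zs :: "real list"
  proof (induction zs)
    case (Cons z zs)
    have "(\<Prod>x\<leftarrow>zs. [:- x, 1:]) \<noteq> 0" by (auto simp: prod_list_zero_iff)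
    then show ?case using Cons by (simp add: degree_mult_eq del: mult_pCons_left)
  qed simp
  have r_in: "r t \<in> set (xs t)" if "t \<in> space M" for t
    unfolding r_def using xs(1)[OF that] by (intro Max_in) auto
  have pq: "p t = [:- r t, 1:] * q t" if "t \<in> space M" for t
  proof -
    have "(\<Prod>x\<leftarrow>zs. [:- x, 1:]) = [:- y, 1:] * (\<Prod>x\<leftarrow>remove1 y zs. [:- x, 1:])" if "y \<in> set zs" for y :: real and zs
      using that by (induction zs) (auto simp del: mult_pCons_left mult_pCons_right simp: mult.left_commute)
    then show ?thesis unfolding xs(2)[OF that] q_def ys_def using r_in[OF that] by blast
  qed
  have rm: "r \<in> borel_measurable M"
  proof (rule borel_measurable_iff_le[THEN iffD2], rule allI)
    fix x
    have "{t \<in> space M. r t \<le> x} = {t \<in> space M. \<forall>i. (\<Sum>j\<le>Suc k. coeff (p t) j * coeff ([:x, 1:] ^ j) i) \<ge> 0}"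
    proof (intro Collect_cong conj_cong refl)
      fix t assume t: "t \<in> space M"
      have "r t \<le> x \<longleftrightarrow> (\<forall>y\<in>set (xs t). y \<le> x)"
        unfolding r_def using xs(1)[OF t] by (subst Max_le_iff) auto
      also have "\<dots> \<longleftrightarrow> (\<forall>i. coeff (pcompose (p t) [:x, 1:]) i \<ge> 0)"
        unfolding xs(2)[OF t] by (rule roots_le_iff_taylor_nonneg)
      also have "\<dots> \<longleftrightarrow> (\<forall>i. (\<Sum>j\<le>Suc k. coeff (p t) j * coeff ([:x, 1:] ^ j) i) \<ge> 0)"
        by (subst coeff_pcompose_eq_sum[of _ "Suc k"]) (auto simp: xs t deg)
      finally show "r t \<le> x \<longleftrightarrow> (\<forall>i. (\<Sum>j\<le>Suc k. coeff (p t) j * coeff ([:x, 1:] ^ j) i) \<ge> 0)" .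
    qed
    also have "\<dots> \<in> sets M"
    proof (intro sets.sets_Collect_countable_All borel_measurable_le borel_measurable_const)
      show "(\<lambda>t. \<Sum>j\<le>Suc k. coeff (p t) j * coeff ([:x, 1:] ^ j) i) \<in> borel_measurable M" for i
        by (intro borel_measurable_sum borel_measurable_times Suc.prems(2) borel_measurable_const)
    qed
    finally show "{t \<in> space M. r t \<le> x} \<in> sets M" .
  qed
  have qm: "(\<lambda>t. coeff (q t) i) \<in> borel_measurable M" for i
  proof (cases "i \<le> Suc k")
    case True
    then show ?thesis
    proof (induction i rule: inc_induct)
      case base
      have "coeff (q t) (Suc k) = 0" if "t \<in> space M" for t
        by (rule coeff_eq_0) (use that r_in[OF that] xs(1)[OF that] in \<open>auto simp: q_def deg ys_def length_remove1\<close>)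
      then show ?case by (simp cong: measurable_cong)
    next
      case (step n)
      have "coeff (q t) n = coeff (p t) (Suc n) + r t * coeff (q t) (Suc n)" if "t \<in> space M" for t
        unfolding pq[OF that] by simp
      moreover have "(\<lambda>t. coeff (p t) (Suc n) + r t * coeff (q t) (Suc n)) \<in> borel_measurable M"
        using step.IH rm Suc.prems(2)[of "Suc n"] by (intro borel_measurable_add borel_measurable_times)
      ultimately show ?case by (simp cong: measurable_cong)
    qed
  next
    case False
    have "coeff (q t) i = 0" if "t \<in> space M" for t
      by (rule coeff_eq_0) (use False that r_in[OF that] xs(1)[OF that] in \<open>auto simp: q_def deg ys_def length_remove1\<close>)
    then show ?thesis by (simp cong: measurable_cong)
  qed
  have "\<exists>X. (\<forall>j<k. X j \<in> borel_measurable M) \<and> (\<forall>t\<in>space M. q t = (\<Prod>j<k. [:- X j t, 1:]))"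
  proof (rule Suc.IH)
    show "\<exists>zs. length zs = k \<and> q t = (\<Prod>x\<leftarrow>zs. [:- x, 1:])" if "t \<in> space M" for t
      using r_in[OF that] xs(1)[OF that] by (intro exI[of _ "ys t"]) (auto simp: q_def ys_def length_remove1)
  qed (rule qm)
  then obtain X where X: "\<And>j. j < k \<Longrightarrow> X j \<in> borel_measurable M" "\<And>t. t \<in> space M \<Longrightarrow> q t = (\<Prod>j<k. [:- X j t, 1:])"
    by blast
  have "p t = (\<Prod>j<Suc k. [:- (if j = k then r else X j) t, 1:])" if "t \<in> space M" for t
  proof -
    have "(\<Prod>j<Suc k. [:- (if j = k then r else X j) t, 1:]) = (\<Prod>j<k. [:- X j t, 1:]) * [:- r t, 1:]"
      by (simp only: prod.lessThan_Suc) simp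
    then show ?thesis unfolding pq[OF that] X(2)[OF that] by (simp only: mult.commute)
  qed
  then show ?case
    by (intro exI[of _ "\<lambda>j. if j = k then r else X j"]) (auto simp: X(1) rm)
qed

lemma map_poly_of_real_mult:
  "map_poly complex_of_real (p * q) = map_poly of_real p * map_poly of_real q"
  by (rule poly_eqI) (simp add: coeff_map_poly coeff_mult)

lemma measurable_eigenvalues_generating_function:
  fixes a b :: "nat \<Rightarrow> real"
  assumes k: "k \<ge> 1" and apos: "\<And>n. a n > 0" and pa: "\<And>n. a (n + k) = a n" and pb: "\<And>n. b (n + k) = b n"
    and M: "cos \<in> borel_measurable M"
  shows "\<exists>X :: nat \<Rightarrow> real \<Rightarrow> real. (\<forall>j<k. X j \<in> borel_measurable M) \<and>
     (\<forall>t\<in>space M. char_poly (generating_function k a b t) = (\<Prod>j<k. [:- of_real (X j t), 1:]))"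
proof -
  let ?\<theta> = "generating_function k a b"
  have "\<exists>xs :: real list. length xs = k \<and> char_poly (?\<theta> t) = map_poly of_real (\<Prod>x\<leftarrow>xs. [:- x, 1:])" for t
  proof -
    obtain zs where zs: "char_poly (?\<theta> t) = (\<Prod>z\<leftarrow>zs. [:- z, 1:])" "length zs = k"
      using char_poly_factorized[OF generating_function_carrier] by blast
    have "Im z = 0" if "z \<in> set zs" for z
    proof (rule ccontr)
      assume "Im z \<noteq> 0"
      then have "poly (char_poly (?\<theta> t)) z \<noteq> 0" by (rule nonreal_nonroot(1)[where a=a and b=b, OF k apos pa pb])
      moreover have "poly (char_poly (?\<theta> t)) z = 0" unfolding zs(1) using that by (induction zs) auto
      ultimately show False by simp
    qed
    then have "(\<Prod>z\<leftarrow>zs. [:- z, 1:]) = map_poly of_real (\<Prod>x\<leftarrow>map Re zs. [:- x, 1:])"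
    proof (induction zs)
      case (Cons z zs)
      have "[:- z, 1:] = map_poly of_real [:- Re z, 1:]" using Cons.prems[of z] by (simp add: map_poly_pCons complex_eq_iff)
      moreover have "(\<Prod>z\<leftarrow>zs. [:- z, 1:]) = map_poly of_real (\<Prod>x\<leftarrow>map Re zs. [:- x, 1:])" using Cons by auto
      ultimately show ?case by (simp add: map_poly_of_real_mult del: mult_pCons_left mult_pCons_right)
    qed (simp add: map_poly_1')
    then show ?thesis using zs by (intro exI[of _ "map Re zs"]) simp
  qed
  then have "\<exists>xs. \<forall>t. length (xs t) = k \<and> char_poly (?\<theta> t) = map_poly of_real (\<Prod>x\<leftarrow>xs t. [:- x :: real, 1:])"
    by (intro choice allI)
  then obtain xs where xs: "\<And>t. length (xs t) = k"
     "\<And>t. char_poly (?\<theta> t) = map_poly of_real (\<Prod>x\<leftarrow>xs t. [:- x :: real, 1:])" by blast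
  define p where "p t = (\<Prod>x\<leftarrow>xs t. [:- x, 1:])" for t
  note px = xs(1) p_def xs(2)[folded p_def]
  have co: "coeff (p t) i = Re (coeff (char_poly (?\<theta> t)) i)" for t i
    unfolding px(3) by (simp add: coeff_map_poly)
  have "\<exists>X. (\<forall>j<k. X j \<in> borel_measurable M) \<and> (\<forall>t\<in>space M. p t = (\<Prod>j<k. [:- X j t, 1:]))"
  proof (rule measurable_real_roots)
    show "\<exists>xs. length xs = k \<and> p t = (\<Prod>x\<leftarrow>xs. [:- x, 1:])" for t using px by blast
    fix i
    have "coeff (p t) i = Re (coeff (char_poly (?\<theta> (pi/2))) i) - (if i = 0 then 2 * (\<Prod>i<k. a i) * cos t else 0)" for t
      unfolding co char_poly_generating_function_cos[where t=t and a=a and b=b, OF k apos pa pb]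
      by (cases i) (simp_all del: of_real_mult of_real_prod)
    then show "(\<lambda>t. coeff (p t) i) \<in> borel_measurable M" using M by simp
  qed
  then obtain X where X: "\<And>j. j < k \<Longrightarrow> X j \<in> borel_measurable M" "\<And>t. t \<in> space M \<Longrightarrow> p t = (\<Prod>j<k. [:- X j t, 1:])"
    by blast
  have "map_poly of_real (\<Prod>j<k. [:- X j t, 1:]) = (\<Prod>j<k. [:- complex_of_real (X j t), 1:])" for t
    by (induction k) (simp_all add: map_poly_1' map_poly_of_real_mult map_poly_pCons del: mult_pCons_left mult_pCons_right)
  then have "char_poly (?\<theta> t) = (\<Prod>j<k. [:- complex_of_real (X j t), 1:])" if "t \<in> space M" for t
    unfolding px(3) X(2)[OF that] .
  then show ?thesis using X(1) by blast
qed

lemma eigs_eq_of_char_poly: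
  fixes k :: nat
  assumes "char_poly A = (\<Prod>j<k. [:- f j, 1:])"
  shows "eigs A = image_mset f (mset_set {..<k})"
proof -
  have "proots (\<Prod>j<k. [:- f j, 1:]) = image_mset f (mset_set {..<k})"
  proof (induction k)
    case (Suc k)
    have "proots (\<Prod>j<Suc k. [:- f j, 1:]) = proots ([:- f k, 1:]) + proots (\<Prod>j<k. [:- f j, 1:])"
      by (simp add: proots_mult mult.commute del: mult_pCons_left mult_pCons_right)
    then show ?case using Suc by (simp add: lessThan_Suc)
  qed simp
  then show ?thesis by (simp add: eigs_def assms)
qed

section \<open>Logarithmic integrals over the circle\<close>

abbreviation circ :: "real measure" where
  "circ \<equiv> lebesgue_on {-pi..pi}"

lemma finite_measure_circle: "finite_measure circ"
  by (intro finite_measure_lebesgue_on) auto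

lemma measure_circle: "measure circ (space circ) = 2 * pi"
  by (simp add: measure_restrict_space)

lemma integrable_circle:
  fixes f :: "real \<Rightarrow> 'a::euclidean_space"
  assumes "continuous_on {-pi..pi} f"
  shows "integrable circ f"
  using assms by (rule continuous_imp_integrable_real)

lemma integral_circle_cis:
  "(\<integral>t. cis (of_int l * t) \<partial>circ) = (if l = 0 then 2 * of_real pi else 0)"
proof (cases "l = 0")
  case True
  then show ?thesis using measure_circle by (simp add: scaleR_conv_of_real)
next
  case False
  have c: "continuous_on {-pi..pi} (\<lambda>t. cis (of_int l * t))"
    by (intro continuous_intros)
  have "(\<integral>t. cis (of_int l * t) \<partial>circ) = integral {-pi..pi} (\<lambda>t. cis (of_int l * t))"
    by (rule lebesgue_integral_eq_integral) (auto intro!: integrable_circle c)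
  also have "\<dots> = cis (of_int l * pi) / (\<i> * of_int l) - cis (of_int l * (-pi)) / (\<i> * of_int l)"
  proof (rule integral_unique, rule fundamental_theorem_of_calculus)
    fix t :: real
    have "((\<lambda>t. exp (\<i> * of_int l * of_real t) / (\<i> * of_int l)) has_vector_derivative exp (\<i> * of_int l * of_real t)) (at t within {-pi..pi})"
      by (rule has_vector_derivative_real_field, (rule derivative_eq_intros refl)+) (use False in \<open>auto simp: field_simps\<close>)
    then show "((\<lambda>t. cis (of_int l * t) / (\<i> * of_int l)) has_vector_derivative cis (of_int l * t)) (at t within {-pi..pi})"
      by (simp add: cis_conv_exp mult_ac)
  qed simp
  also have "cis (of_int l * pi) = cis (of_int l * (-pi))"
    using sin_int_times_real[of l] by (simp add: complex_eq_iff mult.commute sin_times_pi_eq_0)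
  finally show ?thesis using False by simp
qed

lemma ln_one_minus_cis_continuous:
  assumes "cmod \<alpha> \<noteq> 1"
  shows "continuous_on S (\<lambda>t. ln (cmod (1 - \<alpha> * cis (- t))))" "1 - \<alpha> * cis (- t) \<noteq> 0"
proof -
  have nz: "1 - \<alpha> * cis (- t) \<noteq> 0" for t
  proof
    assume "1 - \<alpha> * cis (- t) = 0"
    then have "cmod (\<alpha> * cis (- t)) = 1" by simp
    then show False using assms by (simp add: norm_mult)
  qed
  then show "1 - \<alpha> * cis (- t) \<noteq> 0" .
  show "continuous_on S (\<lambda>t. ln (cmod (1 - \<alpha> * cis (- t))))"
    by (intro continuous_intros) (use nz in auto)
qed

text \<open>
  Termwise integration of \<open>ln \<bar>1 - w\<bar> = - Re (\<Sum>n. w^n / n)\<close> with \<open>w = \<alpha> * cis (-t)\<close>.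
\<close>

lemma integral_ln_inside:
  assumes a: "cmod \<alpha> < 1"
  shows "(\<integral>t. of_real (ln (cmod (1 - \<alpha> * cis (- t)))) * cis (real m * t) \<partial>circ)
     = (if m = 0 then 0 else - (of_real pi / of_nat m) * \<alpha> ^ m)"
proof -
  define f where "f n t = (- 1 / (2 * of_nat n)) * (\<alpha> ^ n * cis (of_int (int m - int n) * t) + cnj \<alpha> ^ n * cis (of_int (int m + int n) * t))" for n t
  have fc: "continuous_on S (f n)" for n S
    unfolding f_def by (cases "n = 0") (auto intro!: continuous_intros)
  have fb: "cmod (f n t) \<le> cmod \<alpha> ^ n" for n t
  proof (cases "n = 0")
    case False
    have "cmod (\<alpha> ^ n * cis (of_int (int m - int n) * t) + cnj \<alpha> ^ n * cis (of_int (int m + int n) * t)) \<le> cmod \<alpha> ^ n + cmod \<alpha> ^ n"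
      by (rule order_trans[OF norm_triangle_ineq]) (simp add: norm_mult norm_power)
    then have "cmod (\<alpha> ^ n * cis (of_int (int m - int n) * t) + cnj \<alpha> ^ n * cis (of_int (int m + int n) * t)) / (2 * real n)
        \<le> (cmod \<alpha> ^ n + cmod \<alpha> ^ n) / (2 * real n)"
      by (rule divide_right_mono) simp
    moreover have "cmod (f n t) = cmod (\<alpha> ^ n * cis (of_int (int m - int n) * t) + cnj \<alpha> ^ n * cis (of_int (int m + int n) * t)) / (2 * real n)"
      unfolding f_def norm_mult by (simp add: norm_divide norm_mult)
    ultimately have "cmod (f n t) \<le> (cmod \<alpha> ^ n + cmod \<alpha> ^ n) / (2 * real n)" by simp
    also have "\<dots> = cmod \<alpha> ^ n / real n" by simp
    also have "\<dots> \<le> cmod \<alpha> ^ n / 1" using False by (intro divide_left_mono) auto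
    finally show ?thesis by simp
  qed (simp add: f_def)
  have sums: "(\<lambda>n. f n t) sums (of_real (ln (cmod (1 - \<alpha> * cis (- t)))) * cis (real m * t))" for t
  proof -
    define w where "w = \<alpha> * cis (- t)"
    have w: "cmod (- w) < 1" using a by (simp add: w_def norm_mult)
    have s: "(\<lambda>n. - (w ^ n) / of_nat n) sums Ln (1 - w)" using Ln_series'[OF w] by simp
    then have "(\<lambda>n. cnj (- (w ^ n) / of_nat n)) sums cnj (Ln (1 - w))" by (simp only: sums_cnj)
    from sums_mult2[OF sums_divide[OF sums_add[OF s this], of 2], of "cis (real m * t)"]
    have "(\<lambda>n. (- (w ^ n) / of_nat n + cnj (- (w ^ n) / of_nat n)) / 2 * cis (real m * t)) sums
       ((Ln (1 - w) + cnj (Ln (1 - w))) / 2 * cis (real m * t))" .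
    moreover have "(- (w ^ n) / of_nat n + cnj (- (w ^ n) / of_nat n)) / 2 * cis (real m * t) = f n t" for n
    proof -
      have 1: "w ^ n * cis (real m * t) = \<alpha> ^ n * cis (of_int (int m - int n) * t)"
        by (simp add: w_def power_mult_distrib Complex.DeMoivre cis_mult algebra_simps)
      have 2: "cnj w ^ n * cis (real m * t) = cnj \<alpha> ^ n * cis (of_int (int m + int n) * t)"
        by (simp add: w_def power_mult_distrib Complex.DeMoivre cis_mult cis_cnj algebra_simps)
      have "(- (w ^ n) / of_nat n + cnj (- (w ^ n) / of_nat n)) / 2 * cis (real m * t)
         = (- 1 / (2 * of_nat n)) * (w ^ n * cis (real m * t) + cnj w ^ n * cis (real m * t))"
        by (cases "n = 0") (simp_all add: field_simps)
      then show ?thesis unfolding 1 2 f_def .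
    qed
    moreover have "(Ln (1 - w) + cnj (Ln (1 - w))) / 2 = of_real (ln (cmod (1 - w)))"
    proof -
      have "1 - w \<noteq> 0" using w by auto
      then show ?thesis by (simp add: complex_add_cnj)
    qed
    ultimately show ?thesis by (simp add: w_def)
  qed
  have sa: "summable (\<lambda>n. cmod \<alpha> ^ n)" using a by (simp add: summable_geometric)
  have "(\<lambda>n. \<integral>t. f n t \<partial>circ) sums (\<integral>t. (\<Sum>n. f n t) \<partial>circ)"
  proof (rule sums_integral)
    show "integrable circ (f n)" for n by (rule integrable_circle) (rule fc)
    show "AE t in circ. summable (\<lambda>n. norm (f n t))"
      using fb by (intro AE_I2 summable_comparison_test'[OF sa]) auto
    show "summable (\<lambda>n. \<integral>t. norm (f n t) \<partial>circ)"
    proof (rule summable_comparison_test'[OF summable_mult[OF sa, of "2 * pi"]])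
      fix n
      have "(\<integral>t. norm (f n t) \<partial>circ) \<le> (\<integral>t. cmod \<alpha> ^ n \<partial>circ)"
        using fb by (intro integral_mono integrable_circle continuous_intros fc) auto
      then show "norm (\<integral>t. norm (f n t) \<partial>circ) \<le> 2 * pi * cmod \<alpha> ^ n"
        using measure_circle by (simp add: integral_nonneg_AE)
    qed
  qed
  moreover have "(\<Sum>n. f n t) = of_real (ln (cmod (1 - \<alpha> * cis (- t)))) * cis (real m * t)" for t
    using sums[of t] by (simp add: sums_iff)
  moreover have "(\<integral>t. f n t \<partial>circ) = (if n = m then (if m = 0 then 0 else - (of_real pi / of_nat m) * \<alpha> ^ m) else 0)" for n
  proof -
    have "(\<integral>t. f n t \<partial>circ) = (- 1 / (2 * of_nat n)) * (\<alpha> ^ n * (\<integral>t. cis (of_int (int m - int n) * t) \<partial>circ)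
        + cnj \<alpha> ^ n * (\<integral>t. cis (of_int (int m + int n) * t) \<partial>circ))"
    proof -
      have i: "integrable circ (\<lambda>t. c * cis (of_int l * t))" for l c
        by (intro integrable_circle continuous_intros)
      show ?thesis unfolding f_def integral_mult_right_zero
        by (subst Bochner_Integration.integral_add[OF i i]) simp
    qed
    then show ?thesis unfolding integral_circle_cis by (auto simp: field_simps)
  qed
  ultimately have "(\<lambda>n. if n = m then (if m = 0 then 0 else - (of_real pi / of_nat m) * \<alpha> ^ m) else 0) sums
     (\<integral>t. of_real (ln (cmod (1 - \<alpha> * cis (- t)))) * cis (real m * t) \<partial>circ)" by simp
  from sums_unique2[OF this sums_single[of m "\<lambda>_. (if m = 0 then 0 else - (of_real pi / of_nat m) * \<alpha> ^ m)"]]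
  show ?thesis .
qed

text \<open>
  \<open>\<bar>1 - \<alpha> * cis (-t)\<bar> = \<bar>\<alpha>\<bar> * \<bar>1 - cis (-t) / cnj \<alpha>\<bar>\<close> reduces this to the previous case. The positive mean
  \<open>ln \<bar>\<alpha>\<bar>\<close> is what makes Jensen's inequality work.
\<close>

lemma integral_ln_outside:
  assumes a: "cmod \<alpha> > 1"
  shows "(\<integral>t. of_real (ln (cmod (1 - \<alpha> * cis (- t)))) * cis (real m * t) \<partial>circ)
     = (if m = 0 then 2 * of_real pi * of_real (ln (cmod \<alpha>)) else - (of_real pi / of_nat m) * (1 / cnj \<alpha>) ^ m)"
proof -
  define \<beta> where "\<beta> = 1 / cnj \<alpha>"
  have b: "cmod \<beta> < 1" using a by (simp add: \<beta>_def norm_divide divide_less_eq)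
  have a0: "\<alpha> \<noteq> 0" using a by auto
  have eq: "ln (cmod (1 - \<alpha> * cis (- t))) = ln (cmod \<alpha>) + ln (cmod (1 - \<beta> * cis (- t)))" for t
  proof -
    have "cis t * cis (- t) = 1" by (simp add: cis_mult)
    then have "1 - \<alpha> * cis (- t) = - \<alpha> * cis (- t) * cnj (1 - \<beta> * cis (- t))"
      using a0 by (simp add: \<beta>_def algebra_simps cis_cnj)
    then have "cmod (1 - \<alpha> * cis (- t)) = cmod \<alpha> * cmod (1 - \<beta> * cis (- t))"
      by (simp only: norm_mult norm_minus_cancel norm_cis complex_mod_cnj mult_1_right)
    then show ?thesis using a0 ln_one_minus_cis_continuous(2)[of \<beta> t] b by (simp add: ln_mult)
  qed
  have "(\<integral>t. of_real (ln (cmod (1 - \<alpha> * cis (- t)))) * cis (real m * t) \<partial>circ)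
     = (\<integral>t. of_real (ln (cmod \<alpha>)) * cis (real m * t) + of_real (ln (cmod (1 - \<beta> * cis (- t)))) * cis (real m * t) \<partial>circ)"
    by (simp add: eq distrib_right)
  also have "\<dots> = of_real (ln (cmod \<alpha>)) * (\<integral>t. cis (of_int (int m) * t) \<partial>circ)
    + (\<integral>t. of_real (ln (cmod (1 - \<beta> * cis (- t)))) * cis (real m * t) \<partial>circ)"
    using b by (subst Bochner_Integration.integral_add)
      (auto intro!: integrable_circle continuous_intros ln_one_minus_cis_continuous(1))
  finally show ?thesis unfolding integral_circle_cis integral_ln_inside[OF b] by (simp add: \<beta>_def)
qed

section \<open>Joukowski coordinates\<close>

lemma joukowski_preimage:
  fixes l :: complex and \<rho> :: real
  assumes "\<rho> > 0"
  shows "\<exists>w. 1 \<le> cmod w \<and> l = of_real \<rho> * (w + 1 / w)"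
proof -
  define s where "s = l / of_real \<rho>"
  \<comment> \<open>one of the two roots of \<open>w + 1 / w = s\<close>; the other is its inverse\<close>
  define w where "w = (s + csqrt (s\<^sup>2 - 4)) / 2"
  have w: "w * w - s * w + 1 = 0"
  proof -
    define c where "c = csqrt (s\<^sup>2 - 4)"
    have c: "c * c = s * s - 4" unfolding c_def by (simp flip: power2_eq_square)
    have w2: "2 * w = s + c" unfolding w_def c_def by simp
    have "4 * (w * w - s * w + 1) = (2 * w) * (2 * w) - 2 * s * (2 * w) + 4" by (simp add: algebra_simps)
    also have "\<dots> = c * c - s * s + 4" unfolding w2 by (simp add: algebra_simps)
    finally have "4 * (w * w - s * w + 1) = 0" unfolding c by simp
    then show ?thesis by (simp only: mult_eq_0_iff zero_neq_numeral[symmetric] simp_thms)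
  qed
  have w0: "w \<noteq> 0" using w by auto
  have s: "s = w + 1 / w"
  proof -
    have "s * w = w * w + 1 - (w * w - s * w + 1)" by simp
    then have "s * w = w * w + 1" unfolding w by simp
    then have "s = (w * w + 1) / w" using w0 by (simp add: eq_divide_eq)
    then show ?thesis using w0 by (simp add: add_divide_distrib)
  qed
  have l: "l = of_real \<rho> * s" using assms by (simp add: s_def)
  show ?thesis
  proof (cases "1 \<le> cmod w")
    case True then show ?thesis using l s by blast
  next
    case False
    then have "1 \<le> cmod (1 / w)" using w0 by (simp add: norm_divide le_divide_eq)
    moreover have "l = of_real \<rho> * (1 / w + 1 / (1 / w))" using l s by (simp add: add.commute)
    ultimately show ?thesis by blast
  qed
qed

lemma joukowski_real:
  assumes w: "1 \<le> cmod w" and x: "of_real x = of_real \<rho> * (w + 1 / w)" and \<rho>: "\<rho> > 0" and b: "\<bar>x\<bar> \<le> 2 * \<rho>"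
  shows "cmod w = 1"
proof (rule ccontr)
  assume ne: "cmod w \<noteq> 1"
  then have w1: "1 < cmod w" using w by simp
  have w0: "w \<noteq> 0" using w by auto
  have e: "w + 1 / w = of_real (x / \<rho>)" using x \<rho> by simp
  have "Im (1 / w) = - Im w / (cmod w)\<^sup>2" by (simp add: Im_divide cmod_power2)
  then have "Im w * (1 - 1 / (cmod w)\<^sup>2) = 0" using arg_cong[OF e, of Im] by (simp add: algebra_simps)
  moreover have "1 < (cmod w)\<^sup>2" using w1 by (intro one_less_power) auto
  then have "1 - 1 / (cmod w)\<^sup>2 \<noteq> 0" by auto
  ultimately have im: "Im w = 0" by (simp only: mult_eq_0_iff) blast
  define r where "r = Re w"
  have r: "w = of_real r" using im by (simp add: r_def complex_eq_iff)
  have r1: "\<bar>r\<bar> > 1" using w1 r by simp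
  have "r + 1 / r = x / \<rho>" 
  proof -
    have "complex_of_real (r + 1 / r) = of_real (x / \<rho>)" using e unfolding r by simp
    then show ?thesis by (simp only: of_real_eq_iff)
  qed
  then have "\<bar>r + 1 / r\<bar> \<le> 2" using b \<rho> by (simp add: abs_divide divide_le_eq)
  moreover have "r + 1 / r = (r * r + 1) / r" using r1 by (simp add: field_simps)
  ultimately have "\<bar>r * r + 1\<bar> / \<bar>r\<bar> \<le> 2" by (simp only: abs_divide)
  then have "r * r + 1 \<le> 2 * \<bar>r\<bar>" using r1 by (simp add: divide_le_eq)
  moreover have "(\<bar>r\<bar> - 1)\<^sup>2 = r * r + 1 - 2 * \<bar>r\<bar>" by (simp add: power2_eq_square algebra_simps)
  moreover have "(\<bar>r\<bar> - 1)\<^sup>2 > 0" using r1 by simp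
  ultimately show False by linarith
qed

text \<open>
  The factorisation that separates the variables: with \<open>\<bar>w\<bar> = r\<close> fixed, \<open>ln \<bar>z - l\<bar>\<close> becomes a constant plus two
  functions of the kind integrated above.
\<close>

lemma joukowski_difference:
  fixes v w :: complex
  assumes "w \<noteq> 0" "v \<noteq> 0"
  shows "of_real \<rho> * (w + 1 / w) - of_real \<rho> * (v + 1 / v) = of_real \<rho> * w * (1 - v / w) * (1 - 1 / (v * w))"
proof -
  have "w * (1 - v / w) = w - v" using assms by (simp add: right_diff_distrib)
  moreover have "(w - v) * (1 - 1 / (v * w)) = (w + 1 / w) - (v + 1 / v)"
    using assms by (simp add: right_diff_distrib) (simp add: diff_divide_distrib)
  moreover have "of_real \<rho> * w * (1 - v / w) * (1 - 1 / (v * w)) = of_real \<rho> * ((w * (1 - v / w)) * (1 - 1 / (v * w)))"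
    by (simp only: mult.assoc)
  ultimately show ?thesis by (simp only: right_diff_distrib[symmetric])
qed

section \<open>From one-sided potential bounds to weak convergence\<close>

text \<open>
  The abstract setting. The \<open>n\<close>-th configuration consists of the complex points \<open>lam n j\<close>, \<open>j < n\<close>; the limit
  candidate is the distribution of the real random quantities \<open>X j\<close>, averaged over \<open>j < k\<close> and over the
  measure \<open>M\<close>. Off the real axis the logarithmic potentials of the configurations are asymptotically
  bounded from above by the potential of the candidate; that this one-sided information determines
  the limit is shown in lemma \<open>weak_convergence\<close>.
\<close>

locale potential_bound =
  fixes M :: "'a measure" and k :: nat and X :: "nat \<Rightarrow> 'a \<Rightarrow> real" and \<rho> :: real
    and lam :: "nat \<Rightarrow> nat \<Rightarrow> complex"
  assumes finite_M: "finite_measure M" and M_pos: "measure M (space M) > 0" and k: "k \<ge> 1"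
    and X_meas: "\<And>j. j < k \<Longrightarrow> X j \<in> borel_measurable M"
    and rho: "\<rho> > 0" and X_bound: "\<And>j t. j < k \<Longrightarrow> t \<in> space M \<Longrightarrow> \<bar>X j t\<bar> \<le> 2 * \<rho>"
    and upper: "\<And>z e. Im z \<noteq> 0 \<Longrightarrow> e > 0 \<Longrightarrow> \<forall>\<^sub>F n in sequentially. (\<Prod>j<n. cmod (z - lam n j)) \<le>
        exp (real n * ((\<Sum>j<k. \<integral>t. ln (cmod (z - of_real (X j t))) \<partial>M) / (real k * measure M (space M)) + e))"
    and crude: "\<And>R. \<exists>C. \<forall>n z. cmod z \<le> R \<longrightarrow> (\<Prod>j<n. cmod (z - lam n j)) \<le> exp (C * real n)"
begin

definition avg :: "(real \<Rightarrow> 'b::{banach, second_countable_topology}) \<Rightarrow> 'b" where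
  "avg f = (1 / (real k * measure M (space M))) *\<^sub>R (\<Sum>j<k. \<integral>t. f (X j t) \<partial>M)"

lemma integrable_X:
  fixes f :: "real \<Rightarrow> 'b::{banach, second_countable_topology}"
  assumes "j < k" "f \<in> borel_measurable borel" "\<And>x. \<bar>x\<bar> \<le> 2 * \<rho> \<Longrightarrow> norm (f x) \<le> B"
  shows "integrable M (\<lambda>t. f (X j t))"
proof (rule finite_measure.integrable_const_bound[OF finite_M])
  show "AE t in M. norm (f (X j t)) \<le> B" using assms X_bound by (intro AE_I2) auto
  show "(\<lambda>t. f (X j t)) \<in> borel_measurable M" using X_meas[OF assms(1)] assms(2) by measurable
qed

lemma integrable_X_continuous:
  fixes f :: "real \<Rightarrow> 'b::{banach, second_countable_topology}"
  assumes "j < k" "continuous_on UNIV f"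
  shows "integrable M (\<lambda>t. f (X j t))"
proof -
  have "compact (f ` {-2*\<rho>..2*\<rho>})"
    by (intro compact_continuous_image continuous_on_subset[OF assms(2)]) auto
  then obtain B where "\<And>x. x \<in> {-2*\<rho>..2*\<rho>} \<Longrightarrow> norm (f x) \<le> B"
    using compact_imp_bounded bounded_iff by (metis imageI)
  then have "\<bar>x\<bar> \<le> 2 * \<rho> \<Longrightarrow> norm (f x) \<le> B" for x by (simp add: abs_le_iff)
  then show ?thesis using assms by (intro integrable_X[of j f B] borel_measurable_continuous_onI) auto
qed

lemma avg_const: "avg (\<lambda>_. c) = c"
proof -
  have "(\<Sum>j<k. \<integral>t. c \<partial>M) = (real k * measure M (space M)) *\<^sub>R c"
    by (simp add: sum_constant_scaleR)
  then have "avg (\<lambda>_. c) = (1 / (real k * measure M (space M)) * (real k * measure M (space M))) *\<^sub>R c"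
    unfolding avg_def by (simp only: scaleR_scaleR)
  also have "1 / (real k * measure M (space M)) * (real k * measure M (space M)) = 1" using k M_pos by simp
  finally show ?thesis by simp
qed

lemma avg_add:
  assumes "continuous_on UNIV f" "continuous_on UNIV g"
  shows "avg (\<lambda>x. f x + g x) = avg f + avg g"
proof -
  have "(\<Sum>j<k. \<integral>t. f (X j t) + g (X j t) \<partial>M) = (\<Sum>j<k. (\<integral>t. f (X j t) \<partial>M) + (\<integral>t. g (X j t) \<partial>M))"
    by (intro sum.cong Bochner_Integration.integral_add integrable_X_continuous assms) auto
  then show ?thesis by (simp add: avg_def sum.distrib scaleR_add_right)
qed

lemma avg_cmult: "avg (\<lambda>x. c * f x) = c * avg f" for c :: complex
proof -
  have "(\<Sum>j<k. \<integral>t. c * f (X j t) \<partial>M) = c * (\<Sum>j<k. \<integral>t. f (X j t) \<partial>M)"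
    by (simp only: integral_mult_right_zero sum_distrib_left)
  then show ?thesis unfolding avg_def by (simp only: mult_scaleR_right)
qed

lemma avg_cong:
  assumes "\<And>x. \<bar>x\<bar> \<le> 2 * \<rho> \<Longrightarrow> f x = g x"
  shows "avg f = avg g"
proof -
  have "(\<Sum>j<k. \<integral>t. f (X j t) \<partial>M) = (\<Sum>j<k. \<integral>t. g (X j t) \<partial>M)"
    by (rule sum.cong[OF refl], rule Bochner_Integration.integral_cong[OF refl], rule assms, rule X_bound) auto
  then show ?thesis by (simp only: avg_def)
qed

lemma norm_avg_le:
  fixes f :: "real \<Rightarrow> complex"
  assumes "continuous_on UNIV f" "\<And>x. \<bar>x\<bar> \<le> 2 * \<rho> \<Longrightarrow> norm (f x) \<le> B"
  shows "norm (avg f) \<le> B"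
proof -
  have "norm (\<integral>t. f (X j t) \<partial>M) \<le> B * measure M (space M)" if "j < k" for j
  proof -
    have "norm (\<integral>t. f (X j t) \<partial>M) \<le> (\<integral>t. norm (f (X j t)) \<partial>M)" by (rule integral_norm_bound)
    also have "\<dots> \<le> (\<integral>t. B \<partial>M)"
      using integrable_X_continuous[OF that assms(1)] that assms(2) X_bound
      by (intro integral_mono integrable_norm finite_measure.integrable_const[OF finite_M]) auto
    finally show ?thesis by (simp add: mult.commute)
  qed
  then have "norm (\<Sum>j<k. \<integral>t. f (X j t) \<partial>M) \<le> (\<Sum>j<k. B * measure M (space M))"
    by (intro order_trans[OF norm_sum] sum_mono) auto
  then have "norm (avg f) \<le> (1 / (real k * measure M (space M))) * (\<Sum>j<k. B * measure M (space M))"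
    unfolding avg_def norm_scaleR using k M_pos by (intro mult_mono) auto
  also have "\<dots> = B" using k M_pos by simp
  finally show ?thesis .
qed

definition wj :: "complex \<Rightarrow> complex" where
  "wj l = (SOME w. 1 \<le> cmod w \<and> l = of_real \<rho> * (w + 1 / w))"

lemma wj: "1 \<le> cmod (wj l)" "of_real \<rho> * (wj l + 1 / wj l) = l"
proof -
  have "1 \<le> cmod (wj l) \<and> l = of_real \<rho> * (wj l + 1 / wj l)"
    unfolding wj_def using joukowski_preimage[OF rho, of l] by (rule someI_ex)
  then show "1 \<le> cmod (wj l)" "of_real \<rho> * (wj l + 1 / wj l) = l" by simp_all
qed

lemma wj_nonzero: "wj l \<noteq> 0"
  using wj(1)[of l] by auto

lemma wj_real: "\<bar>x\<bar> \<le> 2 * \<rho> \<Longrightarrow> cmod (wj (of_real x)) = 1"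
  by (rule joukowski_real[OF wj(1) wj(2)[symmetric] rho])

text \<open>
  Twice the Chebyshev polynomials, rescaled to the interval \<open>[-2\<rho>, 2\<rho>]\<close>.
\<close>

fun cheb :: "nat \<Rightarrow> complex \<Rightarrow> complex" where
  "cheb 0 l = 2"
| "cheb (Suc 0) l = l / of_real \<rho>"
| "cheb (Suc (Suc m)) l = l / of_real \<rho> * cheb (Suc m) l - cheb m l"

lemma cheb_wj: "cheb m l = wj l ^ m + (1 / wj l) ^ m"
proof (induction m l rule: cheb.induct)
  case (2 l)
  show ?case using wj(2)[of l] rho by (simp add: field_simps)
next
  case (3 m l)
  have e: "l / of_real \<rho> = wj l + 1 / wj l" using wj(2)[of l] rho by (simp add: field_simps)
  have "(w + v) * (w ^ Suc m + v ^ Suc m) - (w ^ m + v ^ m) = w ^ Suc (Suc m) + v ^ Suc (Suc m)"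
    if wv: "w * v = 1" for w v :: complex
  proof -
    have "(w + v) * (w ^ Suc m + v ^ Suc m) = w ^ Suc (Suc m) + v ^ Suc (Suc m) + (w * v) * (w ^ m + v ^ m)"
      by (simp add: algebra_simps)
    then show ?thesis unfolding wv by simp
  qed
  moreover have "wj l * (1 / wj l) = 1" using wj_nonzero[of l] by simp
  ultimately show ?case unfolding cheb.simps(3) e 3 by blast
qed simp

lemma continuous_cheb: "continuous_on S (cheb m)"
proof -
  have "continuous_on S (\<lambda>l. cheb m l)"
  proof (induction m rule: less_induct)
    case (less m)
    consider "m = 0" | "m = 1" | m' where "m = Suc (Suc m')" by (metis One_nat_def not0_implies_Suc)
    then show ?case
    proof cases
      case 3
      then show ?thesis using less rho by (auto intro!: continuous_intros)
    qed (use rho in \<open>auto intro!: continuous_intros\<close>)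
  qed
  then show ?thesis by simp
qed

lemma mult_cheb:
  "l * cheb 0 l = 2 * of_real \<rho> * cheb 1 l"
  "l * cheb (Suc m) l = of_real \<rho> * (cheb (Suc (Suc m)) l + cheb m l)"
proof -
  have r: "complex_of_real \<rho> \<noteq> 0" using rho by simp
  show "l * cheb 0 l = 2 * of_real \<rho> * cheb 1 l" using r by simp
  have "of_real \<rho> * (l / of_real \<rho> * x - y + y) = l * x" for x y :: complex using r by simp
  then show "l * cheb (Suc m) l = of_real \<rho> * (cheb (Suc (Suc m)) l + cheb m l)" unfolding cheb.simps(3) by (rule sym)
qed

text \<open>
  The ellipse with parameter \<open>r\<close> avoids all points \<open>lam n j\<close>, so that all potentials are continuous on it.
  Only countably many \<open>r\<close> are excluded.
\<close>

definition generic :: "real \<Rightarrow> bool" where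
  "generic r \<longleftrightarrow> 1 < r \<and> (\<forall>n. \<forall>j<n. cmod (wj (lam n j)) \<noteq> r)"

lemma ex_generic:
  assumes "1 \<le> a" "a < b"
  shows "\<exists>r. generic r \<and> a < r \<and> r < b"
proof -
  have "countable (\<Union>n. (\<lambda>j. cmod (wj (lam n j))) ` {..<n})" by (intro countable_UN) auto
  then have "\<not> {a<..<b} \<subseteq> (\<Union>n. (\<lambda>j. cmod (wj (lam n j))) ` {..<n})"
    using uncountable_open_interval[of a b] assms(2) countable_subset by blast
  then obtain r where "r \<in> {a<..<b}" "r \<notin> (\<Union>n. (\<lambda>j. cmod (wj (lam n j))) ` {..<n})" by blast
  then show ?thesis using assms by (intro exI[of _ r]) (auto simp: generic_def)
qed

definition zcurve :: "real \<Rightarrow> real \<Rightarrow> complex" where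
  "zcurve r u = of_real \<rho> * (of_real r * cis u + 1 / (of_real r * cis u))"

text \<open>
  The potential of a unit mass at \<open>l\<close> along the ellipse, normalised so that its mean is zero for \<open>l\<close> inside.
\<close>

definition h :: "real \<Rightarrow> complex \<Rightarrow> real \<Rightarrow> real" where
  "h r l u = ln (cmod (zcurve r u - l)) - ln (\<rho> * r)"

lemma h_split:
  assumes s: "1 < r" and w: "cmod (wj l) \<noteq> r"
  shows "h r l u = ln (cmod (1 - (wj l / of_real r) * cis (- u))) + ln (cmod (1 - (1 / (of_real r * wj l)) * cis (- u)))"
    and "zcurve r u \<noteq> l" and "cmod (wj l / of_real r) \<noteq> 1" and "cmod (1 / (of_real r * wj l)) < 1"
proof -
  show c1: "cmod (wj l / of_real r) \<noteq> 1" using s w by (simp add: norm_divide)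
  have "1 < r * cmod (wj l)" using s wj(1)[of l] less_le_trans[of 1 r "r * cmod (wj l)"] by simp
  then show c2: "cmod (1 / (of_real r * wj l)) < 1" using s by (simp add: norm_divide norm_mult divide_less_eq)
  have n1: "1 - (wj l / of_real r) * cis (- u) \<noteq> 0" by (rule ln_one_minus_cis_continuous(2)[OF c1])
  have n2: "1 - (1 / (of_real r * wj l)) * cis (- u) \<noteq> 0" by (rule ln_one_minus_cis_continuous(2)) (use c2 in simp)
  have nz: "of_real r * cis u \<noteq> 0" using s by simp
  have q: "wj l / (of_real r * cis u) = (wj l / of_real r) * cis (- u)"
    "1 / (wj l * (of_real r * cis u)) = (1 / (of_real r * wj l)) * cis (- u)"
  proof -
    have ci: "cis (- u) = 1 / cis u" by (metis cis_inverse inverse_eq_divide)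
    show "wj l / (of_real r * cis u) = (wj l / of_real r) * cis (- u)"
      unfolding ci times_divide_eq_right divide_divide_eq_left by simp
    show "1 / (wj l * (of_real r * cis u)) = (1 / (of_real r * wj l)) * cis (- u)"
      unfolding ci times_divide_eq_right divide_divide_eq_left mult_1_right by (simp only: mult_ac)
  qed
  have e: "zcurve r u - l = of_real \<rho> * (of_real r * cis u) * (1 - (wj l / of_real r) * cis (- u)) * (1 - (1 / (of_real r * wj l)) * cis (- u))"
    using joukowski_difference[OF nz wj_nonzero[of l], of \<rho>] unfolding wj(2) zcurve_def q by simp
  define A B where "A = 1 - (wj l / of_real r) * cis (- u)" and "B = 1 - (1 / (of_real r * wj l)) * cis (- u)"
  have e': "cmod (zcurve r u - l) = (\<rho> * r) * (cmod A * cmod B)"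
    unfolding e A_def[symmetric] B_def[symmetric] using rho s by (simp add: norm_mult)
  have pos: "cmod A > 0" "cmod B > 0" "\<rho> * r > 0" using n1 n2 rho s by (simp_all add: A_def B_def)
  have "cmod (zcurve r u - l) > 0" unfolding e' by (rule mult_pos_pos[OF pos(3) mult_pos_pos[OF pos(1,2)]])
  then show "zcurve r u \<noteq> l" by auto
  have "h r l u = ln (cmod A) + ln (cmod B)"
    unfolding h_def e' ln_mult_pos[OF pos(3) mult_pos_pos[OF pos(1,2)]] ln_mult_pos[OF pos(1,2)] by linarith
  then show "h r l u = ln (cmod (1 - (wj l / of_real r) * cis (- u))) + ln (cmod (1 - (1 / (of_real r * wj l)) * cis (- u)))"
    by (simp only: A_def B_def)
qed

lemma continuous_h:
  assumes "1 < r" "cmod (wj l) \<noteq> r"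
  shows "continuous_on S (h r l)"
proof -
  have "continuous_on S (\<lambda>u. ln (cmod (1 - (wj l / of_real r) * cis (- u))) + ln (cmod (1 - (1 / (of_real r * wj l)) * cis (- u))))"
    using h_split(3,4)[OF assms] by (intro continuous_on_add ln_one_minus_cis_continuous(1)) auto
  then show ?thesis by (simp add: h_split(1)[OF assms, abs_def] cong: continuous_on_cong)
qed

definition coef :: "real \<Rightarrow> nat \<Rightarrow> complex \<Rightarrow> complex" where
  "coef r m l = (\<integral>u. of_real (h r l u) * cis (real m * u) \<partial>circ)"

lemma coef_split:
  assumes "1 < r" "cmod (wj l) \<noteq> r"
  shows "coef r m l = (\<integral>u. of_real (ln (cmod (1 - (wj l / of_real r) * cis (- u)))) * cis (real m * u) \<partial>circ)
    + (\<integral>u. of_real (ln (cmod (1 - (1 / (of_real r * wj l)) * cis (- u)))) * cis (real m * u) \<partial>circ)"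
proof -
  have i: "integrable circ (\<lambda>u. complex_of_real (ln (cmod (1 - \<alpha> * cis (- u)))) * cis (real m * u))"
    if "cmod \<alpha> \<noteq> 1" for \<alpha>
    by (intro integrable_circle continuous_on_mult continuous_on_of_real ln_one_minus_cis_continuous(1)[OF that] continuous_on_cis continuous_on_mult_left continuous_on_id)
  have "cmod (1 / (of_real r * wj l)) \<noteq> 1" by (rule less_imp_neq[OF h_split(4)[OF assms]])
  from Bochner_Integration.integral_add[OF i[OF h_split(3)[OF assms]] i[OF this]]
  show ?thesis unfolding coef_def h_split(1)[OF assms] of_real_add distrib_right .
qed

lemma coef_inside:
  assumes s: "1 < r" and w: "cmod (wj l) < r"
  shows "coef r 0 l = 0"
    and "m > 0 \<Longrightarrow> coef r m l = - (of_real pi / (of_nat m * of_real r ^ m)) * cheb m l"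
proof -
  have c: "cmod (wj l / of_real r) < 1" using s w by (simp add: norm_divide)
  have c2: "cmod (1 / (of_real r * wj l)) < 1" by (rule h_split(4)[OF s]) (use w in simp)
  note eq = coef_split[OF s less_imp_neq[OF w], unfolded integral_ln_inside[OF c] integral_ln_inside[OF c2]]
  show "coef r 0 l = 0" unfolding eq by simp
  show "coef r m l = - (of_real pi / (of_nat m * of_real r ^ m)) * cheb m l" if "m > 0"
  proof -
    have p: "(wj l / of_real r) ^ m = wj l ^ m / of_real r ^ m" "(1 / (of_real r * wj l)) ^ m = (1 / wj l) ^ m / of_real r ^ m"
      by (simp_all add: power_divide power_mult_distrib)
    have alg: "- (x / y) * (a / c) + - (x / y) * (b / c) = - (x / (y * c)) * (a + b)" for x y a b c :: complex
      by (simp add: distrib_left add_divide_distrib)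
    have "m \<noteq> 0" using that by simp
    from eq[of m, unfolded if_not_P[OF this] p alg] show ?thesis unfolding cheb_wj .
  qed
qed

lemma coef_outside:
  assumes s: "1 < r" and w: "r < cmod (wj l)"
  shows "coef r 0 l = of_real (2 * pi * ln (cmod (wj l) / r))"
    and "m > 0 \<Longrightarrow> cmod (coef r m l) \<le> 2 * pi"
proof -
  have c: "cmod (wj l / of_real r) > 1" using s w by (simp add: norm_divide)
  have c2: "cmod (1 / (of_real r * wj l)) < 1" by (rule h_split(4)[OF s]) (use w in simp)
  note eq = coef_split[OF s less_imp_neq[OF w, symmetric], unfolded integral_ln_outside[OF c] integral_ln_inside[OF c2]]
  show "coef r 0 l = of_real (2 * pi * ln (cmod (wj l) / r))" unfolding eq using s by (simp add: norm_divide)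
  assume m: "m > 0"
  have b: "cmod (- (of_real pi / of_nat m) * x ^ m) \<le> pi" if "cmod x \<le> 1" for x
  proof -
    have "cmod (- (of_real pi / of_nat m) * x ^ m) = (pi / real m) * cmod x ^ m" by (simp add: norm_mult norm_divide norm_power)
    also have "\<dots> \<le> (pi / 1) * 1" using m that by (intro mult_mono divide_left_mono power_le_one) auto
    finally show ?thesis by simp
  qed
  have "cmod (1 / cnj y) \<le> 1" if "cmod y > 1" for y using that by (simp add: norm_divide divide_le_eq)
  from this[OF c] have b1: "cmod (- (of_real pi / of_nat m) * (1 / cnj (wj l / of_real r)) ^ m) \<le> pi" by (rule b)
  have b2: "cmod (- (of_real pi / of_nat m) * (1 / (of_real r * wj l)) ^ m) \<le> pi" by (rule b[OF less_imp_le[OF c2]])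
  have "m \<noteq> 0" using m by simp
  from eq[of m, unfolded if_not_P[OF this]]
  have "cmod (coef r m l) \<le> pi + pi" by (rule ssubst) (rule norm_triangle_mono[OF b1 b2])
  also have "pi + pi = 2 * pi" by simp
  finally show "cmod (coef r m l) \<le> 2 * pi" .
qed

definition hbound :: "real \<Rightarrow> real" where
  "hbound r = 2 * (ln 2 + \<bar>ln (1 - 1 / r)\<bar>)"

lemma h_bound:
  assumes s: "1 < r" and x: "\<bar>x\<bar> \<le> 2 * \<rho>"
  shows "\<bar>h r (of_real x) u\<bar> \<le> hbound r"
proof -
  have w: "cmod (wj (of_real x)) = 1" by (rule wj_real[OF x])
  have ne: "cmod (wj (of_real x)) \<noteq> r" using s w by simp
  have b: "\<bar>ln (cmod (1 - \<alpha> * cis (- u)))\<bar> \<le> ln 2 + \<bar>ln (1 - 1 / r)\<bar>" if a: "cmod \<alpha> = 1 / r" for \<alpha>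
  proof -
    have s1: "1 / r < 1" using s by simp
    have 1: "cmod (\<alpha> * cis (- u)) = 1 / r" using a by (simp add: norm_mult)
    have u: "cmod (1 - \<alpha> * cis (- u)) \<le> 2" using norm_triangle_ineq4[of 1 "\<alpha> * cis (- u)"] s1 unfolding 1 by simp
    have l: "1 - 1 / r \<le> cmod (1 - \<alpha> * cis (- u))" using norm_triangle_ineq2[of 1 "\<alpha> * cis (- u)"] unfolding 1 by simp
    have "ln (1 - 1 / r) \<le> ln (cmod (1 - \<alpha> * cis (- u)))" using l s1 by (intro ln_mono) auto
    moreover have "ln (cmod (1 - \<alpha> * cis (- u))) \<le> ln 2" using u l s1 by (intro ln_mono) auto
    moreover have "ln 2 \<ge> (0::real)" by simp
    ultimately show ?thesis by linarith
  qed
  have "cmod (wj (of_real x) / of_real r) = 1 / r" "cmod (1 / (of_real r * wj (of_real x))) = 1 / r"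
    using s w by (simp_all add: norm_divide norm_mult)
  from add_mono[OF b[OF this(1)] b[OF this(2)]] show ?thesis
    unfolding h_split(1)[OF s ne] hbound_def mult_2 by (rule order_trans[OF abs_triangle_ineq])
qed

lemma continuous_zcurve: "0 < r \<Longrightarrow> continuous_on S (zcurve r)"
proof -
  assume s: "0 < r"
  then have "continuous_on S (\<lambda>u. of_real \<rho> * (of_real r * cis u + 1 / (of_real r * cis u)))"
    by (intro continuous_on_mult continuous_on_add continuous_on_divide continuous_on_const continuous_on_cis continuous_on_id) simp
  then show "continuous_on S (zcurve r)" by (simp only: zcurve_def[abs_def])
qed

lemma zcurve_measurable: "0 < r \<Longrightarrow> zcurve r \<in> borel_measurable circ"
  using integrable_circle[OF continuous_zcurve] by (rule borel_measurable_integrable)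

lemma h_pair_measurable:
  assumes s: "1 < r" and j: "j < k"
  shows "(\<lambda>(u, t). h r (of_real (X j t)) u) \<in> borel_measurable (circ \<Otimes>\<^sub>M M)"
proof -
  have [measurable]: "zcurve r \<in> borel_measurable circ" using s by (intro zcurve_measurable) simp
  have [measurable]: "X j \<in> borel_measurable M" by (rule X_meas[OF j])
  show ?thesis unfolding h_def by measurable
qed

definition pot :: "real \<Rightarrow> real \<Rightarrow> real" where
  "pot r u = avg (\<lambda>x. h r (of_real x) u)"

lemma h_slice_integrable:
  assumes "1 < r" "j < k"
  shows "integrable M (\<lambda>t. h r (of_real (X j t)) u)"
proof (rule integrable_X[OF assms(2)])
  show "(\<lambda>x. h r (of_real x) u) \<in> borel_measurable borel" unfolding h_def by measurable
  show "norm (h r (of_real x) u) \<le> hbound r" if "\<bar>x\<bar> \<le> 2 * \<rho>" for x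
    using h_bound[OF assms(1) that] by simp
qed

lemma pot_eq:
  assumes s: "1 < r"
  shows "pot r u = (\<Sum>j<k. \<integral>t. ln (cmod (zcurve r u - of_real (X j t))) \<partial>M) / (real k * measure M (space M)) - ln (\<rho> * r)"
proof -
  interpret finite_measure M by (rule finite_M)
  have "(\<integral>t. ln (cmod (zcurve r u - of_real (X j t))) \<partial>M) = (\<integral>t. h r (of_real (X j t)) u \<partial>M) + measure M (space M) * ln (\<rho> * r)"
    if j: "j < k" for j
  proof -
    have "(\<integral>t. ln (cmod (zcurve r u - of_real (X j t))) \<partial>M) = (\<integral>t. h r (of_real (X j t)) u + ln (\<rho> * r) \<partial>M)"
      by (simp add: h_def)
    also have "\<dots> = (\<integral>t. h r (of_real (X j t)) u \<partial>M) + (\<integral>t. ln (\<rho> * r) \<partial>M)"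
      by (intro Bochner_Integration.integral_add h_slice_integrable[OF s j] integrable_const)
    finally show ?thesis by simp
  qed
  then have eq: "(\<Sum>j<k. \<integral>t. ln (cmod (zcurve r u - of_real (X j t))) \<partial>M)
     = (\<Sum>j<k. \<integral>t. h r (of_real (X j t)) u \<partial>M) + real k * measure M (space M) * ln (\<rho> * r)"
    by (simp add: sum.distrib)
  have p: "real k * measure M (space M) > 0" using k M_pos by simp
  have "(x + y * l) / y = x / y + l" if "y > 0" for x y l :: real using that by (simp add: add_divide_distrib)
  note q = this[OF p]
  have "pot r u = (\<Sum>j<k. \<integral>t. h r (of_real (X j t)) u \<partial>M) / (real k * measure M (space M))"
    unfolding pot_def avg_def real_scaleR_def times_divide_eq_left mult_1_left ..
  then show ?thesis unfolding eq q by linarith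
qed

lemma pot_measurable: "1 < r \<Longrightarrow> pot r \<in> borel_measurable circ"
proof -
  assume s: "1 < r"
  interpret finite_measure M by (rule finite_M)
  have "(\<lambda>u. \<integral>t. h r (of_real (X j t)) u \<partial>M) \<in> borel_measurable circ" if "j < k" for j
    using borel_measurable_lebesgue_integral[OF h_pair_measurable[OF s that]] .
  then show ?thesis unfolding pot_def[abs_def] avg_def
    by (intro borel_measurable_scaleR borel_measurable_const borel_measurable_sum) auto
qed

lemma pot_bound: "1 < r \<Longrightarrow> \<bar>pot r u\<bar> \<le> hbound r"
proof -
  assume s: "1 < r"
  interpret finite_measure M by (rule finite_M)
  have "\<bar>\<integral>t. h r (of_real (X j t)) u \<partial>M\<bar> \<le> hbound r * measure M (space M)" if j: "j < k" for j
  proof -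
    have "\<bar>\<integral>t. h r (of_real (X j t)) u \<partial>M\<bar> \<le> (\<integral>t. \<bar>h r (of_real (X j t)) u\<bar> \<partial>M)" by (rule integral_abs_bound)
    also have "\<dots> \<le> (\<integral>t. hbound r \<partial>M)"
      using h_bound[OF s] X_bound[OF j] by (intro integral_mono integrable_abs h_slice_integrable s j integrable_const) auto
    finally show ?thesis by (simp add: mult.commute)
  qed
  then have "\<bar>\<Sum>j<k. \<integral>t. h r (of_real (X j t)) u \<partial>M\<bar> \<le> (\<Sum>j<k. hbound r * measure M (space M))"
    by (intro order_trans[OF sum_abs] sum_mono) auto
  then have "\<bar>\<Sum>j<k. \<integral>t. h r (of_real (X j t)) u \<partial>M\<bar> \<le> hbound r * (real k * measure M (space M))"
    by (simp add: mult_ac)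
  moreover have p: "real k * measure M (space M) > 0" using k M_pos by simp
  ultimately show ?thesis
    unfolding pot_def avg_def real_scaleR_def times_divide_eq_left mult_1_left abs_divide
    by (simp only: abs_of_pos[OF p] pos_divide_le_eq[OF p])
qed

lemma pot_integrable: "1 < r \<Longrightarrow> integrable circ (pot r)"
proof (rule finite_measure.integrable_const_bound[OF finite_measure_circle])
  assume s: "1 < r"
  show "AE u in circ. norm (pot r u) \<le> hbound r" using pot_bound[OF s] by (intro AE_I2) simp
  show "pot r \<in> borel_measurable circ" by (rule pot_measurable[OF s])
qed

text \<open>Fubini: the Fourier coefficients of the averaged potential.\<close>

text \<open>
  Fubini: Fourier coefficients commute with the average over \<open>j\<close> and \<open>M\<close>.
\<close>

lemma pot_coef:
  assumes s: "1 < r"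
  shows "(\<integral>u. of_real (pot r u) * cis (real m * u) \<partial>circ) = avg (\<lambda>x. coef r m (of_real x))"
proof -
  interpret M: finite_measure M by (rule finite_M)
  interpret C: finite_measure circ by (rule finite_measure_circle)
  interpret P: pair_sigma_finite circ M by unfold_locales
  interpret CM: finite_measure "circ \<Otimes>\<^sub>M M" by (rule finite_measure_pair_measure) unfold_locales
  define f where "f j = (\<lambda>u t. complex_of_real (h r (of_real (X j t)) u) * cis (real m * u))" for j
  have fi: "integrable (circ \<Otimes>\<^sub>M M) (\<lambda>(u, t). f j u t)" if j: "j < k" for j
  proof (rule CM.integrable_const_bound)
    show "AE p in circ \<Otimes>\<^sub>M M. norm (case p of (u, t) \<Rightarrow> f j u t) \<le> hbound r"
      using h_bound[OF s] X_bound[OF j] by (intro AE_I2) (auto simp: f_def norm_mult space_pair_measure)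
    have [measurable]: "(\<lambda>u. cis (real m * u)) \<in> borel_measurable circ"
      by (rule borel_measurable_integrable[OF integrable_circle]) (intro continuous_intros)
    note [measurable] = h_pair_measurable[OF s j]
    have "(\<lambda>p. complex_of_real ((\<lambda>(u, t). h r (of_real (X j t)) u) p) * (\<lambda>u. cis (real m * u)) (fst p)) \<in> borel_measurable (circ \<Otimes>\<^sub>M M)"
      by measurable
    then show "(\<lambda>(u, t). f j u t) \<in> borel_measurable (circ \<Otimes>\<^sub>M M)"
      by (simp add: f_def case_prod_beta')
  qed
  let ?c = "1 / (real k * measure M (space M))"
  have in1: "(\<integral>t. f j u t \<partial>M) = of_real (\<integral>t. h r (of_real (X j t)) u \<partial>M) * cis (real m * u)" for j u
    unfolding f_def by simp
  have "of_real (pot r u) * cis (real m * u) = ?c *\<^sub>R (\<Sum>j<k. \<integral>t. f j u t \<partial>M)" for u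
    unfolding in1 pot_def avg_def by (simp add: scaleR_conv_of_real sum_distrib_right)
  then have "(\<integral>u. of_real (pot r u) * cis (real m * u) \<partial>circ) = (\<integral>u. ?c *\<^sub>R (\<Sum>j<k. \<integral>t. f j u t \<partial>M) \<partial>circ)"
    by simp
  also have "\<dots> = ?c *\<^sub>R (\<Sum>j<k. \<integral>u. \<integral>t. f j u t \<partial>M \<partial>circ)"
    unfolding integral_scaleR_right
    by (subst Bochner_Integration.integral_sum) (auto intro: P.integrable_fst[OF fi])
  also have "(\<Sum>j<k. \<integral>u. \<integral>t. f j u t \<partial>M \<partial>circ) = (\<Sum>j<k. \<integral>t. \<integral>u. f j u t \<partial>circ \<partial>M)"
    using P.Fubini_integral[OF fi] by simp
  finally show ?thesis unfolding avg_def coef_def f_def .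
qed

definition emp :: "real \<Rightarrow> nat \<Rightarrow> real \<Rightarrow> real" where
  "emp r n u = (\<Sum>j<n. h r (lam n j) u) / real n"

lemma continuous_emp:
  assumes "generic r"
  shows "continuous_on S (emp r n)"
proof -
  have "continuous_on S (h r (lam n j))" if "j < n" for j
    using assms that by (intro continuous_h) (auto simp: generic_def)
  then have "continuous_on S (\<lambda>u. \<Sum>j<n. h r (lam n j) u)"
    by (intro continuous_on_sum) (auto simp: eta_contract_eq)
  from continuous_on_mult[OF this continuous_on_const[of _ "1 / real n"]]
  show ?thesis unfolding emp_def[abs_def] by simp
qed

lemma emp_coef:
  assumes "generic r"
  shows "(\<integral>u. of_real (emp r n u) * cis (real m * u) \<partial>circ) = (\<Sum>j<n. coef r m (lam n j)) / of_nat n"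
proof -
  have i: "integrable circ (\<lambda>u. complex_of_real (h r (lam n j) u) * cis (real m * u))" if "j < n" for j
    using assms that by (intro integrable_circle continuous_on_mult continuous_on_of_real continuous_h continuous_on_cis continuous_on_mult_left continuous_on_id) (auto simp: generic_def)
  have "of_real (emp r n u) * cis (real m * u) = (\<Sum>j<n. of_real (h r (lam n j) u) * cis (real m * u)) / of_nat n" for u
    by (simp add: emp_def sum_distrib_right)
  then have "(\<integral>u. of_real (emp r n u) * cis (real m * u) \<partial>circ)
     = (\<integral>u. (\<Sum>j<n. of_real (h r (lam n j) u) * cis (real m * u)) \<partial>circ) / of_nat n"
    by (simp only: integral_divide_zero)
  also have "(\<integral>u. (\<Sum>j<n. of_real (h r (lam n j) u) * cis (real m * u)) \<partial>circ)
     = (\<Sum>j<n. \<integral>u. of_real (h r (lam n j) u) * cis (real m * u) \<partial>circ)"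
    using i by (intro Bochner_Integration.integral_sum) auto
  finally show ?thesis unfolding coef_def .
qed

lemma emp_eq:
  assumes g: "generic r" and n: "n > 0"
  shows "emp r n u = ln (\<Prod>j<n. cmod (zcurve r u - lam n j)) / real n - ln (\<rho> * r)"
    and "0 < (\<Prod>j<n. cmod (zcurve r u - lam n j))"
proof -
  have nz: "cmod (zcurve r u - lam n j) > 0" if "j < n" for j
    using h_split(2)[of r "lam n j" u] g that by (auto simp: generic_def)
  then show "0 < (\<Prod>j<n. cmod (zcurve r u - lam n j))" by (intro prod_pos) auto
  have "ln (\<Prod>j<n. cmod (zcurve r u - lam n j)) = (\<Sum>j<n. ln (cmod (zcurve r u - lam n j)))"
    using nz by (intro ln_prod) auto
  then show "emp r n u = ln (\<Prod>j<n. cmod (zcurve r u - lam n j)) / real n - ln (\<rho> * r)"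
    using n unfolding emp_def h_def by (simp add: sum_subtractf diff_divide_distrib)
qed

lemma emp_bounded_above:
  assumes g: "generic r"
  shows "\<exists>C. \<forall>n>0. \<forall>u. emp r n u \<le> C"
proof -
  have s: "1 < r" using g by (simp add: generic_def)
  have b: "cmod (zcurve r u) \<le> \<rho> * (r + 1)" for u
  proof -
    have "cmod (of_real r * cis u + 1 / (of_real r * cis u)) \<le> r + 1 / r"
      by (rule order_trans[OF norm_triangle_ineq]) (use s in \<open>simp add: norm_mult norm_divide\<close>)
    also have "\<dots> \<le> r + 1" using s by simp
    finally show ?thesis unfolding zcurve_def norm_mult using rho by simp
  qed
  obtain C where C: "\<And>n z. cmod z \<le> \<rho> * (r + 1) \<Longrightarrow> (\<Prod>j<n. cmod (z - lam n j)) \<le> exp (C * real n)"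
    using crude by blast
  have "emp r n u \<le> C - ln (\<rho> * r)" if n: "n > 0" for n u
  proof -
    have "ln (\<Prod>j<n. cmod (zcurve r u - lam n j)) \<le> ln (exp (C * real n))"
      using emp_eq(2)[OF g n, of u] C[OF b[of u], of n] by (intro ln_mono) auto
    then have "ln (\<Prod>j<n. cmod (zcurve r u - lam n j)) / real n \<le> C" using n by (simp add: divide_le_eq)
    then show ?thesis unfolding emp_eq(1)[OF g n] by simp
  qed
  then show ?thesis by blast
qed

lemma emp_upper:
  assumes g: "generic r" and u: "sin u \<noteq> 0" and e: "e > 0"
  shows "\<forall>\<^sub>F n in sequentially. emp r n u \<le> pot r u + e"
proof -
  have s: "1 < r" using g by (simp add: generic_def)
  have "zcurve r u = of_real \<rho> * (of_real r * cis u + of_real (1 / r) * cis (- u))"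
  proof -
    have ci: "cis (- u) = 1 / cis u" by (metis cis_inverse inverse_eq_divide)
    show ?thesis unfolding zcurve_def ci by simp
  qed
  then have "Im (zcurve r u) = \<rho> * ((r - 1 / r) * sin u)" by (simp add: left_diff_distrib)
  moreover have "r - 1 / r > 0" using s less_trans[of "1/r" 1 r] by simp
  ultimately have "Im (zcurve r u) \<noteq> 0" using rho u by simp
  from upper[OF this e] eventually_gt_at_top[of 0] show ?thesis
  proof eventually_elim
    case (elim n)
    have p: "0 < (\<Prod>j<n. cmod (zcurve r u - lam n j))" by (rule emp_eq(2)[OF g elim(2)])
    have "pot r u + ln (\<rho> * r) = (\<Sum>j<k. \<integral>t. ln (cmod (zcurve r u - of_real (X j t))) \<partial>M) / (real k * measure M (space M))"
      unfolding pot_eq[OF s] by simp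
    from elim(1)[folded this] p
    have "ln (\<Prod>j<n. cmod (zcurve r u - lam n j)) \<le> ln (exp (real n * (pot r u + ln (\<rho> * r) + e)))"
      by (intro ln_mono) auto
    then have "ln (\<Prod>j<n. cmod (zcurve r u - lam n j)) \<le> real n * (pot r u + ln (\<rho> * r) + e)" by simp
    then have "ln (\<Prod>j<n. cmod (zcurve r u - lam n j)) / real n \<le> pot r u + ln (\<rho> * r) + e"
      using elim(2) by (simp add: divide_le_eq mult.commute)
    then show ?case unfolding emp_eq(1)[OF g elim(2)] by simp
  qed
qed

definition excess :: "real \<Rightarrow> nat \<Rightarrow> real \<Rightarrow> real" where
  "excess r n u = max 0 (emp r n u - pot r u)"

lemma AE_circle_sin: "AE u in circ. sin u \<noteq> 0"
proof (rule AE_I')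
  show "{-pi, 0, pi} \<in> null_sets circ"
    by (subst null_sets_restrict_space) (auto intro!: finite_imp_null_set_lborel null_sets_completionI)
  show "{u \<in> space circ. \<not> sin u \<noteq> 0} \<subseteq> {-pi, 0, pi}"
  proof
    fix u assume "u \<in> {u \<in> space circ. \<not> sin u \<noteq> 0}"
    then have p: "-pi \<le> u" "u \<le> pi" "sin u = 0" by auto
    then obtain i :: int where i: "u = of_int i * pi" using sin_zero_iff_int2 by auto
    have "of_int i * pi \<le> 1 * pi" "(-1) * pi \<le> of_int i * pi" using p i by simp_all
    then have "of_int i \<le> (1::real)" "(-1::real) \<le> of_int i" using mult_le_cancel_right_pos[OF pi_gt_zero] by blast+
    then have "i = -1 \<or> i = 0 \<or> i = 1" by linarith
    then show "u \<in> {-pi, 0, pi}" using i by auto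
  qed
qed

lemma excess_integrable:
  assumes g: "generic r"
  shows "integrable circ (excess r n)"
proof -
  have s: "1 < r" using g by (simp add: generic_def)
  have "integrable circ (\<lambda>u. max 0 (emp r n u - pot r u))"
    by (intro integrable_max integrable_zero Bochner_Integration.integrable_diff integrable_circle continuous_emp[OF g] pot_integrable[OF s])
  then show ?thesis by (simp only: excess_def[abs_def])
qed

text \<open>
  Dominated convergence. The pointwise upper bound is available outside the two real points of the
  ellipse, a null set; the crude bound supplies the majorant.
\<close>

lemma excess_tendsto:
  assumes g: "generic r"
  shows "(\<lambda>n. \<integral>u. excess r n u \<partial>circ) \<longlonglongrightarrow> 0"
proof -
  have s: "1 < r" using g by (simp add: generic_def)
  obtain C where C: "\<And>n u. n > 0 \<Longrightarrow> emp r n u \<le> C" using emp_bounded_above[OF g] by blast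
  \<comment> \<open>for \<open>n = 0\<close> the mean \<open>emp\<close> is \<open>0 / 0 = 0\<close>\<close>
  have C': "emp r n u \<le> max 0 C" for n u
    using C[of n u] by (cases "n = 0") (auto simp: emp_def)
  have ex: "norm (excess r n u) \<le> max 0 C + hbound r" for n u
    using C'[of n u] pot_bound[OF s, of u] unfolding excess_def by auto
  have "(\<lambda>n. \<integral>u. excess r n u \<partial>circ) \<longlonglongrightarrow> (\<integral>u. 0 \<partial>circ)"
  proof (rule integral_dominated_convergence[where w="\<lambda>_. max 0 C + hbound r"])
    show "excess r n \<in> borel_measurable circ" for n
      by (rule borel_measurable_integrable[OF excess_integrable[OF g]])
    show "integrable circ (\<lambda>_. max 0 C + hbound r)"
      by (rule finite_measure.integrable_const[OF finite_measure_circle])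
    show "AE u in circ. (\<lambda>n. excess r n u) \<longlonglongrightarrow> 0"
      using AE_circle_sin
    proof eventually_elim
      case (elim u)
      show ?case
      proof (rule tendstoI)
        fix e :: real assume e: "e > 0"
        then have "e / 2 > 0" by simp
        from emp_upper[OF g elim this] show "\<forall>\<^sub>F n in sequentially. dist (excess r n u) 0 < e"
          by eventually_elim (use e in \<open>auto simp: excess_def dist_real_def\<close>)
      qed
    qed
  qed (use ex in auto)
  then show ?thesis by simp
qed

definition log_excess :: "real \<Rightarrow> complex \<Rightarrow> real" where
  "log_excess r l = max 0 (ln (cmod (wj l) / r))"

lemma coef_0:
  assumes s: "1 < r" and ne: "cmod (wj l) \<noteq> r"
  shows "coef r 0 l = of_real (2 * pi * log_excess r l)"
proof (cases "cmod (wj l) < r")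
  case True
  have "ln (cmod (wj l) / r) \<le> 0" using True s wj_nonzero[of l] by (subst ln_le_zero_iff) auto
  then show ?thesis using coef_inside(1)[OF s True] by (simp add: log_excess_def)
next
  case False
  then have o: "r < cmod (wj l)" using ne by simp
  then have "ln (cmod (wj l) / r) \<ge> 0" using s by (intro ln_ge_zero) simp
  then show ?thesis using coef_outside(1)[OF s o] by (simp add: log_excess_def)
qed

text \<open>
  The heart of the argument. The function \<open>pot - emp + excess\<close> is nonnegative by the definition of the excess.
  The mean of \<open>pot\<close> is zero and the mean of \<open>emp\<close> is nonnegative, because each point contributes zero if it
  lies inside the ellipse and \<open>ln (\<bar>w\<bar> / r)\<close> otherwise. So the mean of this nonnegative function is at
  most that of the excess: the one-sided bound has become a bound in \<open>L\<^sup>1\<close>, which controls all Fourier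
  coefficients.
\<close>

lemma jensen:
  assumes g: "generic r"
  defines "\<delta> \<equiv> \<lambda>n. \<integral>u. excess r n u \<partial>circ"
  shows "2 * pi * (\<Sum>j<n. log_excess r (lam n j)) / real n \<le> \<delta> n"
    and "cmod ((\<Sum>j<n. coef r m (lam n j)) / of_nat n - avg (\<lambda>x. coef r m (of_real x))) \<le> 2 * \<delta> n"
proof -
  have s: "1 < r" using g by (simp add: generic_def)
  note ip = pot_integrable[OF s] and ie = integrable_circle[OF continuous_emp[OF g, of _ n]] and ix = excess_integrable[OF g, of n]
  have p0: "(\<integral>u. pot r u \<partial>circ) = 0"
  proof -
    have "avg (\<lambda>x. coef r 0 (of_real x)) = avg (\<lambda>x. 0 :: complex)"
      using s by (intro avg_cong coef_inside(1)) (auto simp: wj_real)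
    then have "complex_of_real (\<integral>u. pot r u \<partial>circ) = 0"
      using pot_coef[OF s, of 0] by (simp add: avg_const)
    then show ?thesis by simp
  qed
  have e0: "(\<integral>u. emp r n u \<partial>circ) = 2 * pi * (\<Sum>j<n. log_excess r (lam n j)) / real n"
  proof -
    have "complex_of_real (\<integral>u. emp r n u \<partial>circ) = (\<Sum>j<n. coef r 0 (lam n j)) / of_nat n"
      using emp_coef[OF g, of n 0] by simp
    also have "(\<Sum>j<n. coef r 0 (lam n j)) = (\<Sum>j<n. of_real (2 * pi * log_excess r (lam n j)))"
      using g by (intro sum.cong coef_0) (auto simp: generic_def)
    also have "\<dots> / of_nat n = complex_of_real (2 * pi * (\<Sum>j<n. log_excess r (lam n j)) / real n)"
      by (simp add: sum_distrib_left)
    finally show ?thesis by (simp only: of_real_eq_iff)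
  qed
  have "(\<integral>u. emp r n u \<partial>circ) \<le> (\<integral>u. pot r u + excess r n u \<partial>circ)"
    by (intro integral_mono Bochner_Integration.integrable_add ip ie ix) (auto simp: excess_def)
  also have "\<dots> = \<delta> n" unfolding \<delta>_def by (simp add: Bochner_Integration.integral_add[OF ip ix] p0)
  finally show "2 * pi * (\<Sum>j<n. log_excess r (lam n j)) / real n \<le> \<delta> n" unfolding e0 .
  have e_nonneg: "(\<integral>u. emp r n u \<partial>circ) \<ge> 0"
    unfolding e0 by (intro divide_nonneg_nonneg mult_nonneg_nonneg sum_nonneg) (auto simp: log_excess_def)
  \<comment> \<open>nonnegative, with mean at most \<open>\<delta> n\<close>\<close>
  let ?d = "\<lambda>u. pot r u - emp r n u + excess r n u"
  have id: "integrable circ ?d"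
    by (intro Bochner_Integration.integrable_add Bochner_Integration.integrable_diff ip ie ix)
  have d: "(\<integral>u. ?d u \<partial>circ) \<le> \<delta> n"
  proof -
    have "(\<integral>u. ?d u \<partial>circ) = (\<integral>u. pot r u \<partial>circ) - (\<integral>u. emp r n u \<partial>circ) + \<delta> n"
      unfolding \<delta>_def by (simp only: Bochner_Integration.integral_add[OF Bochner_Integration.integrable_diff[OF ip ie] ix] Bochner_Integration.integral_diff[OF ip ie])
    then show ?thesis using p0 e_nonneg by linarith
  qed
  have cm: "(\<lambda>u. cis (real m * u)) \<in> borel_measurable circ"
    by (rule borel_measurable_integrable[OF integrable_circle]) (intro continuous_intros)
  have ci: "integrable circ (\<lambda>u. complex_of_real (f u) * cis (real m * u))" if "integrable circ f" for f :: "real \<Rightarrow> real"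
  proof (rule Bochner_Integration.integrable_bound[OF that])
    have [measurable]: "f \<in> borel_measurable circ" by (rule borel_measurable_integrable[OF that])
    note [measurable] = cm
    show "(\<lambda>u. complex_of_real (f u) * cis (real m * u)) \<in> borel_measurable circ" by measurable
  qed (simp add: norm_mult)
  have nb: "cmod (\<integral>u. complex_of_real (f u) * cis (real m * u) \<partial>circ) \<le> (\<integral>u. f u \<partial>circ)"
    if "\<And>u. 0 \<le> f u" for f :: "real \<Rightarrow> real"
  proof -
    have "cmod (\<integral>u. complex_of_real (f u) * cis (real m * u) \<partial>circ) \<le> (\<integral>u. cmod (complex_of_real (f u) * cis (real m * u)) \<partial>circ)"
      by (rule integral_norm_bound)
    also have "\<dots> = (\<integral>u. f u \<partial>circ)" using that by (simp add: norm_mult)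
    finally show ?thesis .
  qed
  have split: "(\<integral>u. of_real (?d u) * cis (real m * u) \<partial>circ)
      = (\<integral>u. of_real (pot r u) * cis (real m * u) \<partial>circ) - (\<integral>u. of_real (emp r n u) * cis (real m * u) \<partial>circ)
        + (\<integral>u. of_real (excess r n u) * cis (real m * u) \<partial>circ)"
    unfolding of_real_add of_real_diff distrib_right left_diff_distrib
    by (simp only: Bochner_Integration.integral_add[OF Bochner_Integration.integrable_diff[OF ci[OF ip] ci[OF ie]] ci[OF ix]]
        Bochner_Integration.integral_diff[OF ci[OF ip] ci[OF ie]])
  have eq: "(\<Sum>j<n. coef r m (lam n j)) / of_nat n - avg (\<lambda>x. coef r m (of_real x))
     = (\<integral>u. of_real (excess r n u) * cis (real m * u) \<partial>circ) - (\<integral>u. of_real (?d u) * cis (real m * u) \<partial>circ)"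
    unfolding emp_coef[OF g, symmetric] pot_coef[OF s, symmetric] split by simp
  have n1: "cmod (\<integral>u. of_real (excess r n u) * cis (real m * u) \<partial>circ) \<le> \<delta> n"
    unfolding \<delta>_def by (rule nb) (simp add: excess_def)
  have n2: "cmod (\<integral>u. of_real (?d u) * cis (real m * u) \<partial>circ) \<le> \<delta> n"
    by (rule order_trans[OF nb d]) (simp add: excess_def)
  show "cmod ((\<Sum>j<n. coef r m (lam n j)) / of_nat n - avg (\<lambda>x. coef r m (of_real x))) \<le> 2 * \<delta> n"
    unfolding eq mult_2 by (rule order_trans[OF norm_triangle_ineq4 add_mono[OF n1 n2]])
qed

definition out :: "real \<Rightarrow> nat \<Rightarrow> real" where
  "out r n = (\<Sum>j<n. if r \<le> cmod (wj (lam n j)) then 1 else 0) / real n"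

lemma out_nonneg: "out r n \<ge> 0"
  unfolding out_def by (intro divide_nonneg_nonneg sum_nonneg) auto

text \<open>
  Points outside the ellipse \<open>r\<close> have a logarithmic excess bounded away from zero with respect to
  a smaller generic ellipse.
\<close>

lemma out_tendsto:
  assumes s: "1 < r"
  shows "out r \<longlonglongrightarrow> 0"
proof -
  obtain \<tau> where t: "generic \<tau>" "1 < \<tau>" "\<tau> < r" using ex_generic[of 1 r] s by auto
  define c where "c = 2 * pi * ln (r / \<tau>)"
  have l0: "ln (r / \<tau>) > 0" using t by (intro ln_gt_zero) simp
  then have c: "c > 0" by (simp add: c_def)
  define \<delta> where "\<delta> n = (\<integral>u. excess \<tau> n u \<partial>circ)" for n
  have b: "c * out r n \<le> \<delta> n" for n
  proof -
    have "(if r \<le> cmod (wj l) then 1 else 0) * ln (r / \<tau>) \<le> log_excess \<tau> l" for l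
    proof (cases "r \<le> cmod (wj l)")
      case True
      then have "ln (r / \<tau>) \<le> ln (cmod (wj l) / \<tau>)" using t s by (intro ln_mono divide_right_mono) auto
      then show ?thesis using True by (simp add: log_excess_def)
    qed (simp add: log_excess_def)
    then have "(\<Sum>j<n. (if r \<le> cmod (wj (lam n j)) then 1 else 0) * ln (r / \<tau>)) \<le> (\<Sum>j<n. log_excess \<tau> (lam n j))"
      by (intro sum_mono) auto
    then have "2 * pi * ((\<Sum>j<n. (if r \<le> cmod (wj (lam n j)) then 1 else 0)) * ln (r / \<tau>)) / real n \<le> 2 * pi * (\<Sum>j<n. log_excess \<tau> (lam n j)) / real n"
      unfolding sum_distrib_right by (intro divide_right_mono mult_left_mono) auto
    also have "\<dots> \<le> \<delta> n" unfolding \<delta>_def by (rule jensen(1)[OF t(1)])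
    finally show ?thesis by (simp add: c_def out_def mult_ac)
  qed
  show ?thesis
  proof (rule tendsto_sandwich)
    show "\<forall>\<^sub>F n in sequentially. 0 \<le> out r n" using out_nonneg by simp
    show "\<forall>\<^sub>F n in sequentially. out r n \<le> \<delta> n / c" using b c by (simp add: le_divide_eq mult.commute)
    show "(\<lambda>n. \<delta> n / c) \<longlonglongrightarrow> 0" using tendsto_divide[OF excess_tendsto[OF t(1)] tendsto_const[of c]] c by (simp add: \<delta>_def)
  qed auto
qed

text \<open>
  The mean over the points inside the ellipse, still normalised by the total number \<open>n\<close>.
\<close>

definition inav :: "real \<Rightarrow> (complex \<Rightarrow> complex) \<Rightarrow> nat \<Rightarrow> complex" where
  "inav r f n = (\<Sum>j<n. if cmod (wj (lam n j)) < r then f (lam n j) else 0) / of_nat n"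

lemma inav_add: "inav r (\<lambda>l. f l + g l) n = inav r f n + inav r g n"
  unfolding inav_def add_divide_distrib[symmetric] sum.distrib[symmetric]
  by (intro arg_cong2[of _ _ _ _ "(/)"] sum.cong) auto

lemma inav_cmult: "inav r (\<lambda>l. c * f l) n = c * inav r f n"
  unfolding inav_def times_divide_eq_right sum_distrib_left
  by (intro arg_cong2[of _ _ _ _ "(/)"] sum.cong) auto

lemma inav_const:
  assumes s: "1 < r"
  shows "inav r (\<lambda>_. c) \<longlonglongrightarrow> c"
proof -
  have "(\<lambda>n. c * (1 - of_real (out r n))) \<longlonglongrightarrow> c * (1 - of_real 0)"
    by (intro tendsto_intros out_tendsto s)
  moreover have "\<forall>\<^sub>F n in sequentially. c * (1 - of_real (out r n)) = inav r (\<lambda>_. c) n"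
    using eventually_gt_at_top[of 0]
  proof eventually_elim
    case (elim n)
    have "(\<Sum>j<n. if cmod (wj (lam n j)) < r then c else 0) = (\<Sum>j<n. c - c * of_real (if r \<le> cmod (wj (lam n j)) then 1 else 0))"
      by (intro sum.cong) auto
    also have "\<dots> = of_nat n * c - c * of_real (\<Sum>j<n. if r \<le> cmod (wj (lam n j)) then 1 else 0)"
      by (simp only: sum_subtractf sum_constant card_lessThan of_real_sum sum_distrib_left)
    also have "\<dots> / of_nat n = c * (1 - of_real (out r n))"
      using elim by (simp add: out_def diff_divide_distrib right_diff_distrib)
    finally show ?case by (simp only: inav_def)
  qed
  ultimately show ?thesis by (simp add: tendsto_cong)
qed

text \<open>
  The Fourier coefficients of the potential of an inner point are multiples of its Chebyshev moments,
  and the few outer points contribute a bounded amount each.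
\<close>

lemma inav_cheb:
  assumes g: "generic r"
  shows "inav r (cheb m) \<longlonglongrightarrow> avg (\<lambda>x. cheb m (of_real x))"
proof (cases "m = 0")
  case True
  have "1 < r" using g by (simp add: generic_def)
  moreover have "cheb 0 = (\<lambda>_. 2)" by (rule ext) simp
  ultimately show ?thesis using inav_const[of r 2] True by (simp add: avg_const)
next
  case False
  then have m: "m > 0" by simp
  have s: "1 < r" using g by (simp add: generic_def)
  define K where "K = - (of_real pi / (of_nat m * complex_of_real r ^ m))"
  have K: "K \<noteq> 0" using m s by (simp add: K_def)
  define E where "E n = (\<Sum>j<n. if cmod (wj (lam n j)) < r then 0 else coef r m (lam n j)) / of_nat n" for n
  have split: "(\<Sum>j<n. coef r m (lam n j)) / of_nat n = K * inav r (cheb m) n + E n" for n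
  proof -
    have "(\<Sum>j<n. coef r m (lam n j)) = (\<Sum>j<n. K * (if cmod (wj (lam n j)) < r then cheb m (lam n j) else 0) + (if cmod (wj (lam n j)) < r then 0 else coef r m (lam n j)))"
      using coef_inside(2)[OF s _ m] by (intro sum.cong) (auto simp: K_def)
    then show ?thesis unfolding inav_def E_def by (simp only: sum.distrib sum_distrib_left[symmetric] add_divide_distrib times_divide_eq_right)
  qed
  have Eb: "norm (E n) \<le> 2 * pi * out r n" for n
  proof -
    have "norm (\<Sum>j<n. if cmod (wj (lam n j)) < r then 0 else coef r m (lam n j)) \<le> (\<Sum>j<n. 2 * pi * (if r \<le> cmod (wj (lam n j)) then 1 else 0))"
    proof (intro order_trans[OF norm_sum] sum_mono)
      fix j assume "j \<in> {..<n}"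
      then have "cmod (wj (lam n j)) \<noteq> r" using g by (auto simp: generic_def)
      then show "norm (if cmod (wj (lam n j)) < r then 0 else coef r m (lam n j)) \<le> 2 * pi * (if r \<le> cmod (wj (lam n j)) then 1 else 0)"
        using coef_outside(2)[OF s _ m, of "lam n j"] by auto
    qed
    then show ?thesis unfolding E_def out_def norm_divide norm_of_nat sum_distrib_left[symmetric] times_divide_eq_right
      by (rule divide_right_mono) simp
  qed
  have E0: "E \<longlonglongrightarrow> 0"
  proof (rule Lim_null_comparison)
    show "\<forall>\<^sub>F n in sequentially. norm (E n) \<le> 2 * pi * out r n" using Eb by simp
    show "(\<lambda>n. 2 * pi * out r n) \<longlonglongrightarrow> 0" using tendsto_mult_left[OF out_tendsto[OF s], of "2 * pi"] by simp
  qed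
  have av: "avg (\<lambda>x. coef r m (of_real x)) = K * avg (\<lambda>x. cheb m (of_real x))"
    unfolding avg_cmult[symmetric] K_def using s m by (intro avg_cong coef_inside(2)) (auto simp: wj_real)
  have "(\<lambda>n. (\<Sum>j<n. coef r m (lam n j)) / of_nat n - avg (\<lambda>x. coef r m (of_real x))) \<longlonglongrightarrow> 0"
  proof (rule Lim_null_comparison)
    show "\<forall>\<^sub>F n in sequentially. norm ((\<Sum>j<n. coef r m (lam n j)) / of_nat n - avg (\<lambda>x. coef r m (of_real x)))
       \<le> 2 * (\<integral>u. excess r n u \<partial>circ)" using jensen(2)[OF g] by (intro always_eventually allI)
    show "(\<lambda>n. 2 * (\<integral>u. excess r n u \<partial>circ)) \<longlonglongrightarrow> 0"
      using tendsto_mult_left[OF excess_tendsto[OF g], of 2] by simp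
  qed
  from tendsto_diff[OF this E0] have "(\<lambda>n. K * inav r (cheb m) n - K * avg (\<lambda>x. cheb m (of_real x))) \<longlonglongrightarrow> 0"
    unfolding split av by (simp add: algebra_simps)
  from tendsto_mult_left[OF this, of "1 / K"] have "(\<lambda>n. inav r (cheb m) n - avg (\<lambda>x. cheb m (of_real x))) \<longlonglongrightarrow> 0"
    using K by (simp add: right_diff_distrib)
  then show ?thesis by (rule LIM_zero_cancel)
qed

text \<open>
  Multiplication by \<open>l\<close> raises and lowers the Chebyshev index, so induction on \<open>i\<close> reaches all polynomials.
\<close>

lemma inav_power_cheb:
  assumes g: "generic r"
  shows "inav r (\<lambda>l. l ^ i * cheb m l) \<longlonglongrightarrow> avg (\<lambda>x. of_real x ^ i * cheb m (of_real x))"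
proof (induction i arbitrary: m)
  case 0
  show ?case using inav_cheb[OF g, of m] by simp
next
  case (Suc i)
  have cc: "continuous_on UNIV (\<lambda>x. complex_of_real x ^ i * cheb m (complex_of_real x))" for m
  proof -
    have "continuous_on UNIV (\<lambda>x. cheb m (complex_of_real x))"
      by (rule continuous_on_compose2[OF continuous_cheb[of UNIV]]) (auto intro: continuous_intros)
    then show ?thesis by (intro continuous_intros)
  qed
  show ?case
  proof (cases m)
    case 0
    have e: "l ^ Suc i * cheb m l = (2 * of_real \<rho>) * (l ^ i * cheb 1 l)" for l
      unfolding 0 using mult_cheb(1)[of l] by (simp add: algebra_simps del: cheb.simps)
    show ?thesis unfolding e avg_cmult inav_cmult by (intro tendsto_mult_left Suc)
  next
    case (Suc m')
    have e: "l ^ Suc i * cheb m l = of_real \<rho> * (l ^ i * cheb (Suc m) l + l ^ i * cheb m' l)" for l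
    proof -
      have "l ^ Suc i * cheb m l = l ^ i * (l * cheb (Suc m') l)" unfolding Suc by (simp only: power_Suc mult_ac)
      then show ?thesis unfolding mult_cheb(2) Suc by (simp only: distrib_left mult_ac)
    qed
    show ?thesis unfolding e avg_cmult inav_cmult inav_add avg_add[OF cc cc]
      by (intro tendsto_mult_left tendsto_add Suc.IH)
  qed
qed

lemma inav_polynomial:
  assumes g: "generic r"
  shows "inav r (\<lambda>l. \<Sum>i\<in>I. c i * l ^ i) \<longlonglongrightarrow> avg (\<lambda>x. \<Sum>i\<in>I. c i * of_real x ^ i)"
proof (induction I rule: infinite_finite_induct)
  case (infinite I)
  have "1 < r" using g by (simp add: generic_def)
  from inav_const[OF this, of 0] show ?case using infinite by (simp add: avg_const)
next
  case empty
  have "1 < r" using g by (simp add: generic_def)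
  from inav_const[OF this, of 0] show ?case by (simp add: avg_const)
next
  case (insert i I)
  have e: "(\<Sum>i\<in>insert i I. c i * l ^ i) = (c i / 2) * (l ^ i * cheb 0 l) + (\<Sum>i\<in>I. c i * l ^ i)" for l
    using insert by simp
  have c1: "continuous_on UNIV (\<lambda>x. (c i / 2) * (complex_of_real x ^ i * cheb 0 (complex_of_real x)))"
    "continuous_on UNIV (\<lambda>x. \<Sum>i\<in>I. c i * complex_of_real x ^ i)"
    by (auto intro!: continuous_intros)
  show ?case unfolding e inav_add avg_add[OF c1] inav_cmult avg_cmult
    by (intro tendsto_add tendsto_mult_left inav_power_cheb[OF g] insert.IH)
qed

text \<open>
  Thin ellipses lie close to the segment \<open>[-2\<rho>, 2\<rho>]\<close>, uniformly: compare \<open>w\<close> with \<open>w / \<bar>w\<bar>\<close>, whose Joukowski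
  image is real.
\<close>

lemma small_near_segment:
  fixes H :: "complex \<Rightarrow> complex"
  assumes c: "continuous_on UNIV H" and e: "e > 0" and b: "\<And>x. \<bar>x\<bar> \<le> 2 * \<rho> \<Longrightarrow> cmod (H (of_real x)) < e"
  shows "\<exists>r>1. \<forall>l. cmod (wj l) < r \<longrightarrow> cmod (H l) < 2 * e"
proof -
  define K where "K = cball (0::complex) 2 - ball 0 1"
  define J where "J w = of_real \<rho> * (w + 1 / w)" for w :: complex
  have K: "compact K" unfolding K_def by (rule compact_diff) auto
  have w0: "w \<noteq> 0" if "w \<in> K" for w using that by (auto simp: K_def)
  have cJ: "continuous_on K J" unfolding J_def using w0 by (intro continuous_intros) auto
  have "continuous_on K (\<lambda>w. H (J w))" by (rule continuous_on_compose2[OF c cJ]) auto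
  then have "uniformly_continuous_on K (\<lambda>w. H (J w))" using K by (rule compact_uniformly_continuous)
  then obtain d where d: "d > 0" "\<And>w w'. w \<in> K \<Longrightarrow> w' \<in> K \<Longrightarrow> dist w' w < d \<Longrightarrow> dist (H (J w')) (H (J w)) < e"
    unfolding uniformly_continuous_on_def using e by meson
  have "cmod (H l) < 2 * e" if l: "cmod (wj l) < 1 + min 1 d" for l
  proof -
    define w where "w = wj l"
    define v where "v = w / of_real (cmod w)"
    have w1: "1 \<le> cmod w" unfolding w_def by (rule wj)
    have wn: "w \<noteq> 0" unfolding w_def by (rule wj_nonzero)
    have v1: "cmod v = 1" using wn by (simp add: v_def norm_divide)
    have wK: "w \<in> K" and vK: "v \<in> K" using w1 l v1 by (auto simp: K_def w_def)
    have "w - v = v * of_real (cmod w - 1)" using wn by (simp add: v_def right_diff_distrib)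
    then have "dist w v = cmod w - 1" using v1 w1 by (simp only: dist_norm norm_mult norm_of_real) simp
    then have dv: "dist w v < d" using l by (simp add: w_def)
    have iv: "1 / v = cnj v"
    proof -
      have "v * cnj v = 1" using v1 by (simp add: complex_norm_square[symmetric])
      then show ?thesis using v1 by (metis nonzero_mult_div_cancel_left norm_zero zero_neq_one)
    qed
    have "J v = of_real (2 * \<rho> * Re v)" unfolding J_def iv complex_add_cnj by simp
    moreover have "\<bar>2 * \<rho> * Re v\<bar> \<le> 2 * \<rho>"
      using abs_Re_le_cmod[of v] v1 rho by (simp add: abs_mult)
    then have "cmod (H (of_real (2 * \<rho> * Re v))) < e" by (rule b)
    ultimately have "cmod (H (J v)) < e" by (simp only:)
    moreover have "dist (H (J w)) (H (J v)) < e" by (rule d(2)[OF vK wK dv])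
    moreover have "J w = l" unfolding J_def w_def by (rule wj)
    ultimately show ?thesis using norm_triangle_ineq2[of "H l" "H (J v)"] by (simp add: dist_norm)
  qed
  then show ?thesis using d(1) by (intro exI[of _ "1 + min 1 d"]) auto
qed

lemma polynomial_approximation:
  fixes F :: "complex \<Rightarrow> complex"
  assumes c: "continuous_on UNIV F" and e: "e > 0"
  shows "\<exists>p. continuous_on UNIV p \<and> (\<forall>r. generic r \<longrightarrow> inav r p \<longlonglongrightarrow> avg (\<lambda>x. p (of_real x))) \<and>
     (\<forall>x. \<bar>x\<bar> \<le> 2 * \<rho> \<longrightarrow> cmod (F (of_real x) - p (of_real x)) < e)"
proof -
  have "continuous_on {-2*\<rho>..2*\<rho>} (\<lambda>x. F (complex_of_real x))"
    by (rule continuous_on_compose2[OF c]) (auto intro: continuous_intros)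
  then obtain g where g: "polynomial_function g" "\<And>x. x \<in> {-2*\<rho>..2*\<rho>} \<Longrightarrow> norm (F (of_real x) - g x) < e"
    using Stone_Weierstrass_polynomial_function[of "{-2*\<rho>..2*\<rho>}" "\<lambda>x. F (complex_of_real x)" e] e by auto
  have "real_polynomial_function (Re \<circ> g)" "real_polynomial_function (Im \<circ> g)"
    using g(1) bounded_linear_Re bounded_linear_Im unfolding polynomial_function_def by auto
  then obtain a n b m where ab: "Re \<circ> g = (\<lambda>x. \<Sum>i\<le>n. a i * x ^ i)" "Im \<circ> g = (\<lambda>x. \<Sum>i\<le>m. b i * x ^ i)"
    unfolding real_polynomial_function_iff_sum by blast
  define p1 p2 where "p1 l = (\<Sum>i\<le>(n::nat). complex_of_real (a i) * l ^ i)" and "p2 l = (\<Sum>i\<le>(m::nat). complex_of_real (b i) * l ^ i)" for l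
  define p where "p l = p1 l + \<i> * p2 l" for l
  have cp: "continuous_on UNIV p1" "continuous_on UNIV p2" unfolding p1_def p2_def by (auto intro!: continuous_intros)
  then have "continuous_on UNIV p" unfolding p_def by (intro continuous_intros)
  moreover have "inav r p \<longlonglongrightarrow> avg (\<lambda>x. p (of_real x))" if "generic r" for r
  proof -
    have c1: "continuous_on UNIV (\<lambda>x. p1 (complex_of_real x))" "continuous_on UNIV (\<lambda>x. \<i> * p2 (complex_of_real x))"
      unfolding p1_def p2_def by (auto intro!: continuous_intros)
    have "inav r p1 \<longlonglongrightarrow> avg (\<lambda>x. p1 (of_real x))" "inav r p2 \<longlonglongrightarrow> avg (\<lambda>x. p2 (of_real x))"
      unfolding p1_def p2_def by (rule inav_polynomial[OF that])+
    then show ?thesis unfolding p_def inav_add inav_cmult avg_add[OF c1] avg_cmult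
      by (intro tendsto_add tendsto_mult_left)
  qed
  moreover have "cmod (F (of_real x) - p (of_real x)) < e" if "\<bar>x\<bar> \<le> 2 * \<rho>" for x
  proof -
    have "p (of_real x) = of_real ((Re \<circ> g) x) + \<i> * of_real ((Im \<circ> g) x)" unfolding ab p_def p1_def p2_def by simp
    also have "\<dots> = g x" by (simp add: complex_eq_iff)
    finally show ?thesis using g(2)[of x] that by (simp add: abs_le_iff)
  qed
  ultimately show ?thesis by blast
qed

text \<open>
  Replace \<open>F\<close> by a polynomial that is close to it on the segment, hence also on a sufficiently thin
  ellipse; the points outside that ellipse are negligible since \<open>F\<close> is bounded.
\<close>

lemma weak_convergence:
  fixes F :: "complex \<Rightarrow> complex"
  assumes c: "continuous_on UNIV F" and B: "\<And>z. cmod (F z) \<le> B"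
  shows "(\<lambda>n. (\<Sum>j<n. F (lam n j)) / of_nat n) \<longlonglongrightarrow> avg (\<lambda>x. F (of_real x))"
proof (rule tendstoI)
  fix e0 :: real assume e0: "e0 > 0"
  \<comment> \<open>one part each for the outer points, the polynomial moments and the average of \<open>H\<close>, two for \<open>H\<close> at the inner points\<close>
  define e where "e = e0 / 5"
  have e: "e > 0" using e0 by (simp add: e_def)
  obtain p where p: "continuous_on UNIV p" "\<And>r. generic r \<Longrightarrow> inav r p \<longlonglongrightarrow> avg (\<lambda>x. p (of_real x))"
     "\<And>x. \<bar>x\<bar> \<le> 2 * \<rho> \<Longrightarrow> cmod (F (of_real x) - p (of_real x)) < e"
    using polynomial_approximation[OF c e] by blast
  define H where "H l = F l - p l" for l
  have cH: "continuous_on UNIV H" unfolding H_def by (intro continuous_intros c p(1))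
  have H: "cmod (H (of_real x)) < e" if "\<bar>x\<bar> \<le> 2 * \<rho>" for x using p(3)[OF that] by (simp add: H_def)
  obtain r0 where s0: "r0 > 1" "\<And>l. cmod (wj l) < r0 \<Longrightarrow> cmod (H l) < 2 * e"
    using small_near_segment[OF cH e H] by blast
  obtain r where g: "generic r" "1 < r" "r < r0" using ex_generic[of 1 r0] s0 by auto
  have B0: "B \<ge> 0" using B[of 0] norm_ge_zero order_trans by blast
  have eO: "\<forall>\<^sub>F n in sequentially. B * out r n < e"
    using order_tendstoD(2)[OF tendsto_mult_left[OF out_tendsto[OF g(2)], of B], of e] e by simp
  have eP: "\<forall>\<^sub>F n in sequentially. dist (inav r p n) (avg (\<lambda>x. p (of_real x))) < e"
    by (rule tendstoD[OF p(2)[OF g(1)] e])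
  have cr: "continuous_on UNIV (\<lambda>x. f (complex_of_real x))" if "continuous_on UNIV f" for f :: "complex \<Rightarrow> complex"
    by (rule continuous_on_compose2[OF that]) (auto intro: continuous_intros)
  have avF: "avg (\<lambda>x. F (of_real x)) = avg (\<lambda>x. p (of_real x)) + avg (\<lambda>x. H (of_real x))"
    using avg_add[OF cr[OF p(1)] cr[OF cH]] by (simp add: H_def)
  have avH: "cmod (avg (\<lambda>x. H (of_real x))) \<le> e" by (rule norm_avg_le[OF cr[OF cH]]) (use H in force)
  have inF: "inav r F n = inav r p n + inav r H n" for n
    unfolding inav_add[symmetric] by (simp add: H_def)
  have inH: "cmod (inav r H n) \<le> 2 * e" for n
  proof (cases "n = 0")
    case False
    have "cmod (\<Sum>j<n. if cmod (wj (lam n j)) < r then H (lam n j) else 0) \<le> (\<Sum>j<n. 2 * e)"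
    proof (intro order_trans[OF norm_sum] sum_mono)
      fix j
      show "cmod (if cmod (wj (lam n j)) < r then H (lam n j) else 0) \<le> 2 * e"
        using s0(2)[of "lam n j"] g(3) e by (cases "cmod (wj (lam n j)) < r") (simp_all add: less_imp_le)
    qed
    then show ?thesis using False unfolding inav_def by (simp add: norm_divide divide_le_eq mult.commute)
  qed (use e in \<open>simp add: inav_def\<close>)
  have outF: "cmod ((\<Sum>j<n. F (lam n j)) / of_nat n - inav r F n) \<le> B * out r n" for n
  proof -
    have "(\<Sum>j<n. F (lam n j)) - (\<Sum>j<n. if cmod (wj (lam n j)) < r then F (lam n j) else 0)
      = (\<Sum>j<n. if cmod (wj (lam n j)) < r then 0 else F (lam n j))"
      unfolding sum_subtractf[symmetric] by (intro sum.cong) auto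
    moreover have "cmod (\<Sum>j<n. if cmod (wj (lam n j)) < r then 0 else F (lam n j)) \<le> (\<Sum>j<n. B * (if r \<le> cmod (wj (lam n j)) then 1 else 0))"
      using B B0 by (intro order_trans[OF norm_sum] sum_mono) auto
    ultimately show ?thesis
      unfolding inav_def out_def diff_divide_distrib[symmetric] norm_divide norm_of_nat times_divide_eq_right sum_distrib_left
      by (intro divide_right_mono) simp_all
  qed
  show "\<forall>\<^sub>F n in sequentially. dist ((\<Sum>j<n. F (lam n j)) / of_nat n) (avg (\<lambda>x. F (of_real x))) < e0"
    using eO eP
  proof eventually_elim
    case (elim n)
    define x where "x = (\<Sum>j<n. F (lam n j)) / of_nat n"
    define ap ah where "ap = avg (\<lambda>x. p (of_real x))" and "ah = avg (\<lambda>x. H (of_real x))"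
    have "x - (ap + ah) = (x - inav r F n) + (inav r p n - ap) + inav r H n - ah" using inF[of n] by simp
    moreover have "cmod (w1 + w2 + w3 - w4) \<le> cmod w1 + cmod w2 + cmod w3 + cmod w4" for w1 w2 w3 w4
      using norm_triangle_ineq4[of "w1 + w2 + w3" w4] norm_triangle_ineq[of "w1 + w2" w3] norm_triangle_ineq[of w1 w2] by linarith
    ultimately have "cmod (x - (ap + ah)) \<le> cmod (x - inav r F n) + cmod (inav r p n - ap) + cmod (inav r H n) + cmod ah"
      by (simp only:)
    also have "\<dots> < e + e + 2 * e + e"
      using outF[of n, folded x_def] elim(1) elim(2)[folded ap_def] inH[of n] avH[folded ah_def] by (simp add: dist_norm)
    also have "\<dots> = e0" by (simp add: e_def)
    finally show ?case unfolding avF dist_norm x_def ap_def ah_def .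
  qed
qed

end

section \<open>Essential range, clustering and attraction\<close>

lemma level_set_measurable:
  assumes "G \<in> sets lebesgue" "f \<in> borel_measurable (lebesgue_on G)" "open U"
  shows "{t \<in> G. f t \<in> U} \<in> sets lebesgue"
proof -
  have "f -` U \<inter> space (lebesgue_on G) \<in> sets (lebesgue_on G)"
    using assms(2,3) by (intro measurable_sets[OF assms(2)]) auto
  moreover have "f -` U \<inter> space (lebesgue_on G) = {t \<in> G. f t \<in> U}" by auto
  ultimately show ?thesis using assms(1) by (simp add: sets_restrict_space_iff)
qed

lemma essential_range_ball:
  "s \<in> essential_range G f \<longleftrightarrow> (\<forall>e>0. emeasure lebesgue {t \<in> G. f t \<in> ball s e} > 0)"
  by (simp add: essential_range_def ball_def dist_norm norm_minus_commute)

lemma closed_essential_range: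
  assumes G: "G \<in> sets lebesgue" and f: "f \<in> borel_measurable (lebesgue_on G)"
  shows "closed (essential_range G f)"
proof -
  have "x \<in> essential_range G f" if x: "x \<in> closure (essential_range G f)" for x
    unfolding essential_range_ball
  proof (intro allI impI)
    fix e :: real assume e: "0 < e"
    then have e2: "0 < e / 2" by simp
    then obtain y where y: "y \<in> essential_range G f" "dist y x < e / 2"
      using x unfolding closure_approachable by blast
    have "emeasure lebesgue {t \<in> G. f t \<in> ball y (e / 2)} > 0" using y(1) e2 unfolding essential_range_ball by blast
    also have "emeasure lebesgue {t \<in> G. f t \<in> ball y (e / 2)} \<le> emeasure lebesgue {t \<in> G. f t \<in> ball x e}"
    proof (rule emeasure_mono)
      show "{t \<in> G. f t \<in> ball x e} \<in> sets lebesgue" by (rule level_set_measurable[OF G f]) auto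
      show "{t \<in> G. f t \<in> ball y (e / 2)} \<subseteq> {t \<in> G. f t \<in> ball x e}"
      proof
        fix t assume t: "t \<in> {t \<in> G. f t \<in> ball y (e / 2)}"
        then have "dist y (f t) < e / 2" by (simp only: mem_Collect_eq mem_ball)
        then have "dist x (f t) < e" using y(2) dist_triangle[of x "f t" y] dist_commute[of x y] by linarith
        then show "t \<in> {t \<in> G. f t \<in> ball x e}" using t by simp
      qed
    qed
    finally show "0 < emeasure lebesgue {t \<in> G. f t \<in> ball x e}" .
  qed
  then show ?thesis using closure_subset_eq by blast
qed

text \<open>
  The complement of the essential range is covered by balls with null preimage, and by Lindeloef
  countably many of them suffice.
\<close>

lemma AE_essential_range:
  assumes G: "G \<in> sets lebesgue" and f: "f \<in> borel_measurable (lebesgue_on G)"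
  shows "AE t in lebesgue_on G. f t \<in> essential_range G f"
proof -
  define B where "B = {U. \<exists>s e. U = ball s e \<and> emeasure lebesgue {t \<in> G. f t \<in> U} = 0}"
  have op: "open U" if "U \<in> B" for U using that unfolding B_def by auto
  obtain C where C: "C \<subseteq> B" "countable C" "\<Union>C = \<Union>B"
    by (rule Lindelof[of B, OF op]) (assumption, rule that)
  have n: "(\<Union>U\<in>C. {t \<in> G. f t \<in> U}) \<in> null_sets lebesgue"
  proof (rule null_sets_UN'[OF C(2)])
    fix U assume "U \<in> C"
    then have "U \<in> B" using C(1) by blast
    then obtain s e where "U = ball s e" "emeasure lebesgue {t \<in> G. f t \<in> U} = 0" unfolding B_def by blast
    then show "{t \<in> G. f t \<in> U} \<in> null_sets lebesgue" using level_set_measurable[OF G f, of U] by auto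
  qed
  show ?thesis
  proof (rule AE_I')
    show "(\<Union>U\<in>C. {t \<in> G. f t \<in> U}) \<in> null_sets (lebesgue_on G)"
      using n G by (subst null_sets_restrict_space) auto
    show "{t \<in> space (lebesgue_on G). f t \<notin> essential_range G f} \<subseteq> (\<Union>U\<in>C. {t \<in> G. f t \<in> U})"
    proof
      fix t assume t: "t \<in> {t \<in> space (lebesgue_on G). f t \<notin> essential_range G f}"
      then obtain e where e: "e > 0" "emeasure lebesgue {u \<in> G. f u \<in> ball (f t) e} = 0"
        unfolding essential_range_ball by auto
      then have "ball (f t) e \<in> B" unfolding B_def by blast
      then have "f t \<in> \<Union>B" using e(1) by (intro UnionI[of "ball (f t) e"]) auto
      then show "t \<in> (\<Union>U\<in>C. {t \<in> G. f t \<in> U})" using t unfolding C(3)[symmetric] by auto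
    qed
  qed
qed

lemma size_filter_le_sum_mset:
  fixes f :: "'a \<Rightarrow> real"
  assumes "\<And>z. 0 \<le> f z" "\<And>z. P z \<Longrightarrow> 1 \<le> f z"
  shows "real (size (filter_mset P N)) \<le> (\<Sum>z\<in>#N. f z)"
proof (induction N)
  case (add x N)
  then show ?case using assms(1)[of x] assms(2)[of x] by (cases "P x") auto
qed simp

lemma sum_mset_le_size_filter:
  fixes f :: "'a \<Rightarrow> real"
  assumes "\<And>z. f z \<le> 1" "\<And>z. \<not> P z \<Longrightarrow> f z \<le> 0"
  shows "(\<Sum>z\<in>#N. f z) \<le> real (size (filter_mset P N))"
proof (induction N)
  case (add x N)
  then show ?case using assms(1)[of x] assms(2)[of x] by (cases "P x") auto
qed simp

lemma sum_mset_of_real: "(\<Sum>z\<in>#N. complex_of_real (f z)) = of_real (\<Sum>z\<in>#N. f z)"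
  by (induction N) auto

lemma sum_mset_one_minus:
  fixes f :: "'a \<Rightarrow> real"
  shows "(\<Sum>z\<in>#N. 1 - f z) = real (size N) - (\<Sum>z\<in>#N. f z)"
  by (induction N) auto

text \<open>
  The limit relation of \<^const>\<open>eigenvalue_distributed\<close> for a given labelling, so that the labelling is at hand
  when the essential ranges are considered.
\<close>

definition distributed_with ::
  "(nat \<Rightarrow> complex mat) \<Rightarrow> nat \<Rightarrow> 'a::euclidean_space set \<Rightarrow> (nat \<Rightarrow> 'a \<Rightarrow> complex) \<Rightarrow> bool" where
  "distributed_with A k G l \<longleftrightarrow>
     (\<forall>F::complex \<Rightarrow> complex. continuous_on UNIV F \<longrightarrow> bounded {z. F z \<noteq> 0} \<longrightarrow>
           (\<lambda>n. (1 / of_nat n) * (\<Sum>z\<in>#eigs (A n). F z)) \<longlonglongrightarrow>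
             (1 / (of_nat k * complex_of_real (measure lebesgue G)))
               * (\<Sum>j<k. \<integral>t. F (l j t) \<partial>lebesgue_on G))"

lemma distributed_withD_real:
  fixes f :: "complex \<Rightarrow> real"
  assumes d: "distributed_with A k G l" and c: "continuous_on UNIV f" and b: "bounded {z. f z \<noteq> 0}"
  shows "(\<lambda>n. (\<Sum>z\<in>#eigs (A n). f z) / real n) \<longlonglongrightarrow> (\<Sum>j<k. \<integral>t. f (l j t) \<partial>lebesgue_on G) / (real k * measure lebesgue G)"
proof -
  have "(\<lambda>n. (1 / of_nat n) * (\<Sum>z\<in>#eigs (A n). complex_of_real (f z))) \<longlonglongrightarrow>
     (1 / (of_nat k * complex_of_real (measure lebesgue G))) * (\<Sum>j<k. \<integral>t. complex_of_real (f (l j t)) \<partial>lebesgue_on G)"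
    using d c b unfolding distributed_with_def by (auto intro!: continuous_intros)
  moreover have "(1 / of_nat n) * (\<Sum>z\<in>#eigs (A n). complex_of_real (f z)) = of_real ((\<Sum>z\<in>#eigs (A n). f z) / real n)" for n
    by (simp only: sum_mset_of_real of_real_divide of_real_of_nat_eq times_divide_eq_left mult_1_left)
  moreover have "(1 / (of_nat k * complex_of_real (measure lebesgue G))) * (\<Sum>j<k. \<integral>t. complex_of_real (f (l j t)) \<partial>lebesgue_on G)
      = of_real ((\<Sum>j<k. \<integral>t. f (l j t) \<partial>lebesgue_on G) / (real k * measure lebesgue G))"
    by simp
  ultimately have "(\<lambda>n. complex_of_real ((\<Sum>z\<in>#eigs (A n). f z) / real n)) \<longlonglongrightarrow> of_real ((\<Sum>j<k. \<integral>t. f (l j t) \<partial>lebesgue_on G) / (real k * measure lebesgue G))"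
    by (simp only:)
  then show ?thesis by (rule tendsto_of_real_iff[THEN iffD1])
qed

text \<open>
  Test with \<open>max 0 (1 - infdist z S / \<epsilon>)\<close>. Its average over the limit distribution is 1, because the
  eigenvalue functions take values in \<open>S\<close> almost everywhere; hence few eigenvalues lie where it vanishes.
  The test function has bounded support because \<open>S\<close> is bounded.
\<close>

lemma distributed_weakly_clustered:
  fixes G :: "'a::euclidean_space set"
  assumes A: "matrix_sequence A" and k: "k \<ge> 1" and G: "G \<in> lmeasurable" "0 < measure lebesgue G"
    and l: "\<And>j. j < k \<Longrightarrow> l j \<in> borel_measurable (lebesgue_on G)"
    and d: "distributed_with A k G l"
    and bd: "bounded (\<Union>j<k. essential_range G (l j))"
  shows "weakly_clustered A (\<Union>j<k. essential_range G (l j))"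
proof -
  define S where "S = (\<Union>j<k. essential_range G (l j))"
  have Gs: "G \<in> sets lebesgue" using G(1) by (rule fmeasurableD)
  have ae: "AE t in lebesgue_on G. l j t \<in> S" if "j < k" for j
    using AE_essential_range[OF Gs l[OF that]] by eventually_elim (use that in \<open>auto simp: S_def\<close>)
  have mG: "measure (lebesgue_on G) (space (lebesgue_on G)) = measure lebesgue G"
    using Gs by (simp add: measure_restrict_space)
  have cl: "closed S" unfolding S_def by (intro closed_UN ballI closed_essential_range[OF Gs] l) auto
  have ne: "S \<noteq> {}"
  proof
    assume "S = {}"
    then have "AE t in lebesgue_on G. False" using ae[of 0] k by auto
    then obtain N where N: "N \<in> null_sets (lebesgue_on G)" "space (lebesgue_on G) \<subseteq> N"
      unfolding eventually_ae_filter by auto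
    have "space (lebesgue_on G) \<in> null_sets (lebesgue_on G)" by (rule null_sets_subset[OF N(1) sets.top N(2)])
    then show False using G(2) mG by (simp add: measure_def null_setsD1)
  qed
  have "(\<lambda>n. real (size {#z \<in># eigs (A n). z \<notin> (\<Union>s\<in>S. ball s \<epsilon>)#})) \<in> o(\<lambda>n. real n)" if e: "\<epsilon> > 0" for \<epsilon>
  proof -
    define f where "f z = max 0 (1 - infdist z S / \<epsilon>)" for z
    have f1: "0 \<le> f z" "f z \<le> 1" for z using infdist_nonneg[of z S] e by (auto simp: f_def)
    have fS: "f z = 1" if "z \<in> S" for z using that by (simp add: f_def)
    have near: "\<exists>s\<in>S. dist s z < \<epsilon>" if "f z \<noteq> 0" for z
    proof -
      have "infdist z S < \<epsilon>" using that e by (auto simp: f_def max_def divide_less_eq split: if_splits)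
      moreover obtain s where "s \<in> S" "infdist z S = dist z s" using infdist_attains_inf[OF cl ne] by blast
      ultimately show ?thesis by (auto simp: dist_commute)
    qed
    have fc: "continuous_on UNIV f" unfolding f_def by (intro continuous_intros) (use e in auto)
    have fb: "bounded {z. f z \<noteq> 0}"
    proof -
      obtain R where R: "\<And>s. s \<in> S \<Longrightarrow> norm s \<le> R" using bd unfolding S_def[symmetric] bounded_iff by blast
      have "norm z \<le> R + \<epsilon>" if z: "f z \<noteq> 0" for z
      proof -
        obtain s where s: "s \<in> S" "dist s z < \<epsilon>" using near[OF z] by blast
        have "norm z \<le> norm s + norm (z - s)" by (rule norm_triangle_sub)
        then show ?thesis using R[OF s(1)] s(2) by (simp add: dist_norm norm_minus_commute)
      qed
      then show ?thesis unfolding bounded_iff by blast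
    qed
    have "(\<integral>t. f (l j t) \<partial>lebesgue_on G) = measure lebesgue G" if j: "j < k" for j
    proof -
      have "(\<integral>t. f (l j t) \<partial>lebesgue_on G) = (\<integral>t. 1 \<partial>lebesgue_on G)"
      proof (rule integral_cong_AE)
        show "(\<lambda>t. f (l j t)) \<in> borel_measurable (lebesgue_on G)"
          by (rule measurable_compose[OF l[OF j] borel_measurable_continuous_onI[OF fc]])
        show "AE t in lebesgue_on G. f (l j t) = 1" using ae[OF j] by eventually_elim (rule fS)
      qed simp
      then show ?thesis using mG by simp
    qed
    then have lim: "(\<lambda>n. (\<Sum>z\<in>#eigs (A n). f z) / real n) \<longlonglongrightarrow> 1"
      using distributed_withD_real[OF d fc fb] k G(2) by simp
    have "(\<lambda>n. 1 - (\<Sum>z\<in>#eigs (A n). f z) / real n) \<longlonglongrightarrow> 1 - 1" by (intro tendsto_diff tendsto_const lim)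
    then have lim0: "(\<lambda>n. 1 - (\<Sum>z\<in>#eigs (A n). f z) / real n) \<longlonglongrightarrow> 0" by simp
    have cnt: "real (size {#z \<in># eigs (A n). z \<notin> (\<Union>s\<in>S. ball s \<epsilon>)#}) \<le> real n - (\<Sum>z\<in>#eigs (A n). f z)" for n
    proof -
      have "real (size {#z \<in># eigs (A n). z \<notin> (\<Union>s\<in>S. ball s \<epsilon>)#}) \<le> (\<Sum>z\<in>#eigs (A n). 1 - f z)"
      proof (rule size_filter_le_sum_mset)
        show "0 \<le> 1 - f z" for z using f1(2)[of z] by simp
        show "1 \<le> 1 - f z" if "z \<notin> (\<Union>s\<in>S. ball s \<epsilon>)" for z using near[of z] that f1(1)[of z] by auto
      qed
      also have "\<dots> = real n - (\<Sum>z\<in>#eigs (A n). f z)"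
        using A size_eigs[of "A n" n] by (simp add: sum_mset_one_minus matrix_sequence_def)
      finally show ?thesis .
    qed
    have "(\<lambda>n. real (size {#z \<in># eigs (A n). z \<notin> (\<Union>s\<in>S. ball s \<epsilon>)#}) / real n) \<longlonglongrightarrow> 0"
    proof (rule tendsto_sandwich[OF _ _ tendsto_const lim0])
      show "\<forall>\<^sub>F n in sequentially. real (size {#z \<in># eigs (A n). z \<notin> (\<Union>s\<in>S. ball s \<epsilon>)#}) / real n
          \<le> 1 - (\<Sum>z\<in>#eigs (A n). f z) / real n"
        using eventually_gt_at_top[of 0]
      proof eventually_elim
        case (elim n)
        have "real (size {#z \<in># eigs (A n). z \<notin> (\<Union>s\<in>S. ball s \<epsilon>)#}) / real n \<le> (real n - (\<Sum>z\<in>#eigs (A n). f z)) / real n"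
          by (rule divide_right_mono[OF cnt]) simp
        also have "\<dots> = 1 - (\<Sum>z\<in>#eigs (A n). f z) / real n" using elim by (simp add: diff_divide_distrib)
        finally show ?case .
      qed
    qed simp
    then show ?thesis by (rule smalloI_tendsto) (use eventually_gt_at_top[of 0] in \<open>auto elim: eventually_mono\<close>)
  qed
  then show ?thesis unfolding weakly_clustered_def S_def[symmetric] using A ne cl by blast
qed

lemma sorted_nth_less:
  fixes g :: "'a \<Rightarrow> real"
  assumes s: "sorted (map g xs)" and c: "j < size (filter_mset (\<lambda>z. g z < \<epsilon>) (mset xs))"
  shows "g (xs ! j) < \<epsilon>"
proof (rule ccontr)
  assume n: "\<not> g (xs ! j) < \<epsilon>"
  have "size (filter_mset (\<lambda>z. g z < \<epsilon>) (mset xs)) = card {i. i < length xs \<and> g (xs ! i) < \<epsilon>}"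
    by (simp add: mset_filter[symmetric] length_filter_conv_card del: mset_filter)
  also have "\<dots> \<le> card {..<j}"
  proof (rule card_mono)
    show "{i. i < length xs \<and> g (xs ! i) < \<epsilon>} \<subseteq> {..<j}"
    proof clarsimp
      fix i assume i: "i < length xs" "g (xs ! i) < \<epsilon>"
      show "i < j"
      proof (rule ccontr)
        assume "\<not> i < j"
        then have "g (xs ! j) \<le> g (xs ! i)" using sorted_nth_mono[OF s, of j i] i(1) by simp
        then show False using n i(2) by simp
      qed
    qed
  qed simp
  finally show False using c by simp
qed

text \<open>
  Test with a bump function around \<open>s\<close>. Its average over the limit distribution is positive since \<open>s\<close> lies in an
  essential range, so the number of eigenvalues near \<open>s\<close> grows linearly in \<open>n\<close> and eventually exceeds any \<open>j\<close>.
\<close>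

lemma distributed_strongly_attracts:
  fixes G :: "'a::euclidean_space set"
  assumes A: "matrix_sequence A" and G: "G \<in> lmeasurable" "0 < measure lebesgue G"
    and l: "\<And>j. j < k \<Longrightarrow> l j \<in> borel_measurable (lebesgue_on G)"
    and d: "distributed_with A k G l"
    and i: "i < k" and s: "s \<in> essential_range G (l i)"
  shows "strongly_attracts_infinite_order s A"
proof -
  have Gs: "G \<in> sets lebesgue" using G(1) by (rule fmeasurableD)
  have fin: "finite_measure (lebesgue_on G)" using G(1) by (rule finite_measure_lebesgue_on)
  have many: "\<forall>\<^sub>F n in sequentially. j < size {#z \<in># eigs (A n). cmod (z - s) < \<epsilon>#}" if e: "\<epsilon> > 0" for \<epsilon> j
  proof -
    define f where "f z = max 0 (1 - dist z s / \<epsilon>)" for z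
    have f1: "0 \<le> f z" "f z \<le> 1" for z using e by (auto simp: f_def)
    have near: "dist z s < \<epsilon>" if "f z \<noteq> 0" for z
      using that e by (auto simp: f_def max_def divide_less_eq split: if_splits)
    have fc: "continuous_on UNIV f" unfolding f_def by (intro continuous_intros) (use e in auto)
    have fb: "bounded {z. f z \<noteq> 0}"
      by (rule bounded_subset[OF bounded_ball[of s \<epsilon>]]) (use near in \<open>auto simp: dist_commute\<close>)
    have fi: "integrable (lebesgue_on G) (\<lambda>t. f (l j t))" if "j < k" for j
    proof (rule finite_measure.integrable_const_bound[OF fin])
      show "AE t in lebesgue_on G. norm (f (l j t)) \<le> 1" using f1 by simp
      show "(\<lambda>t. f (l j t)) \<in> borel_measurable (lebesgue_on G)"
        by (rule measurable_compose[OF l[OF that] borel_measurable_continuous_onI[OF fc]])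
    qed
    define U where "U = {t \<in> G. l i t \<in> ball s (\<epsilon> / 2)}"
    have Us: "U \<in> sets lebesgue" unfolding U_def by (rule level_set_measurable[OF Gs l[OF i]]) simp
    have UG: "U \<subseteq> G" by (auto simp: U_def)
    have Um: "U \<in> sets (lebesgue_on G)" using Us UG Gs by (simp add: sets_restrict_space_iff)
    have "emeasure lebesgue U > 0" using s e unfolding essential_range_ball U_def by (meson half_gt_zero)
    moreover have "U \<in> lmeasurable" using G(1) UG Us by (rule fmeasurableI2)
    ultimately have mU: "measure lebesgue U > 0" using emeasure_eq_measure2[of U lebesgue] by simp
    have "(\<integral>t. (1/2) * indicator U t \<partial>lebesgue_on G) \<le> (\<integral>t. f (l i t) \<partial>lebesgue_on G)"
    proof (rule integral_mono)
      show "integrable (lebesgue_on G) (\<lambda>t. (1/2) * indicator U t :: real)"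
        using Um fin by (intro integrable_mult_right integrable_real_indicator) (auto simp: finite_measure.emeasure_finite less_top[symmetric])
      show "integrable (lebesgue_on G) (\<lambda>t. f (l i t))" by (rule fi[OF i])
      fix t
      show "(1/2) * indicator U t \<le> f (l i t)"
      proof (cases "t \<in> U")
        case True
        then have "dist (l i t) s / \<epsilon> \<le> 1 / 2" using e by (simp add: U_def dist_commute divide_le_eq)
        moreover have "1 - dist (l i t) s / \<epsilon> \<le> f (l i t)" unfolding f_def by (rule max.cobounded2)
        ultimately show ?thesis using True by simp
      qed (use f1 in simp)
    qed
    moreover have "(\<integral>t. (1/2) * indicator U t \<partial>lebesgue_on G) = (1/2) * measure lebesgue U"
      using UG Um Us Gs by (simp add: measure_restrict_space Int_absorb2)
    ultimately have ipos: "(\<integral>t. f (l i t) \<partial>lebesgue_on G) > 0" using mU by linarith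
    define c where "c = (\<Sum>j<k. \<integral>t. f (l j t) \<partial>lebesgue_on G) / (real k * measure lebesgue G)"
    have "(\<Sum>j<k. \<integral>t. f (l j t) \<partial>lebesgue_on G) > 0"
      using i ipos f1 by (intro sum_pos2[of _ i]) (auto intro!: integral_nonneg_AE)
    then have c: "c > 0" unfolding c_def using i G(2) by simp
    have "\<forall>\<^sub>F n in sequentially. c / 2 < (\<Sum>z\<in>#eigs (A n). f z) / real n"
      using order_tendstoD(1)[OF distributed_withD_real[OF d fc fb], of "c / 2"] c unfolding c_def[symmetric] by simp
    moreover have "\<forall>\<^sub>F n in sequentially. real j / (c / 2) < real n"
      by (rule eventually_compose_filterlim[OF eventually_gt_at_top filterlim_real_sequentially])
    ultimately show ?thesis
      using eventually_gt_at_top[of 0]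
    proof eventually_elim
      case (elim n)
      have "real j < c / 2 * real n" using elim(2) c by (simp add: divide_less_eq mult.commute)
      also have "\<dots> < (\<Sum>z\<in>#eigs (A n). f z)" using elim(1,3) by (simp add: less_divide_eq)
      also have "\<dots> \<le> real (size {#z \<in># eigs (A n). cmod (z - s) < \<epsilon>#})"
      proof (rule sum_mset_le_size_filter)
        show "f z \<le> 0" if "\<not> cmod (z - s) < \<epsilon>" for z
          using near[of z] that by (cases "f z = 0") (simp_all add: dist_norm)
      qed (rule f1)
      finally show ?case by simp
    qed
  qed
  have "(\<lambda>n. cmod (L n ! j - s)) \<longlonglongrightarrow> 0" if L: "\<forall>n. ordered_eigenvalues s (A n) (L n)" for L j
  proof (rule tendstoI)
    fix e :: real assume "e > 0"
    from many[OF this, of j] show "\<forall>\<^sub>F n in sequentially. dist (cmod (L n ! j - s)) 0 < e"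
    proof eventually_elim
      case (elim n)
      have "mset (L n) = eigs (A n)" "sorted (map (\<lambda>z. cmod (z - s)) (L n))"
        using L by (auto simp: ordered_eigenvalues_def)
      with elim have "cmod (L n ! j - s) < e" by (intro sorted_nth_less) simp_all
      then show ?case by simp
    qed
  qed
  then show ?thesis unfolding strongly_attracts_infinite_order_def using A by blast
qed

section \<open>Potentials of perturbed periodic Jacobi matrices\<close>

lemma integral_ln_one_minus_cis:
  assumes "cmod \<gamma> < 1"
  shows "(\<integral>t. ln (cmod (1 - \<gamma> * cis (- t))) \<partial>circ) = 0"
    and "(\<integral>t. ln (cmod (1 - \<gamma> * cis t)) \<partial>circ) = 0"
proof -
  have 1: "(\<integral>t. ln (cmod (1 - \<alpha> * cis (- t))) \<partial>circ) = 0" if "cmod \<alpha> < 1" for \<alpha>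
  proof -
    have "complex_of_real (\<integral>t. ln (cmod (1 - \<alpha> * cis (- t))) \<partial>circ) = 0"
      using integral_ln_inside[OF that, of 0] by simp
    then show ?thesis by simp
  qed
  show "(\<integral>t. ln (cmod (1 - \<gamma> * cis (- t))) \<partial>circ) = 0" by (rule 1[OF assms])
  have "cmod (1 - \<gamma> * cis t) = cmod (1 - cnj \<gamma> * cis (- t))" for t
    by (metis cis_cnj complex_cnj_diff complex_cnj_mult complex_cnj_one complex_mod_cnj)
  then show "(\<integral>t. ln (cmod (1 - \<gamma> * cis t)) \<partial>circ) = 0" using 1[of "cnj \<gamma>"] assms by simp
qed

text \<open>
  Integrate the logarithm of the factorised determinant: the two factors with \<open>\<bar>\<gamma>\<bar> < 1\<close> have
  logarithmic mean zero, so only \<open>\<Prod>Q i\<close> remains.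
\<close>

lemma potential_generating_function:
  fixes a b :: "nat \<Rightarrow> real" and Q :: "nat \<Rightarrow> complex" and X :: "nat \<Rightarrow> real \<Rightarrow> real"
  assumes k: "k \<ge> 1" and apos: "\<And>n. a n > 0" and pa: "\<And>n. a (n + k) = a n" and pb: "\<And>n. b (n + k) = b n"
    and z: "Im z \<noteq> 0"
    and Qp: "\<And>n. Q (n + k) = Q n" and Q0: "\<And>n. Q n \<noteq> 0"
    and QS: "\<And>n. Q (Suc n) = z - of_real (b (Suc n)) - of_real ((a (Suc n))\<^sup>2) / Q n"
    and sub: "(\<Prod>i<k. a i) < cmod (\<Prod>i<k. Q i)"
    and Xm: "\<And>j. j < k \<Longrightarrow> X j \<in> borel_measurable circ"
    and Xb: "\<And>j t. j < k \<Longrightarrow> t \<in> {-pi..pi} \<Longrightarrow> \<bar>X j t\<bar> \<le> R"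
    and X: "\<And>t. t \<in> {-pi..pi} \<Longrightarrow> char_poly (generating_function k a b t) = (\<Prod>j<k. [:- of_real (X j t), 1:])"
  shows "(\<Sum>j<k. \<integral>t. ln (cmod (z - of_real (X j t))) \<partial>circ) = 2 * pi * (\<Sum>i<k. ln (cmod (Q i)))"
proof -
  define \<gamma> where "\<gamma> = of_real (\<Prod>i<k. a i) / (\<Prod>i<k. Q i)"
  have "(\<Prod>i<k. a i) > 0" using apos by (intro prod_pos) auto
  then have g: "cmod \<gamma> < 1"
  proof -
    assume p: "(\<Prod>i<k. a i) > 0"
    have "cmod \<gamma> = (\<Prod>i<k. a i) / cmod (\<Prod>i<k. Q i)" using p by (simp add: \<gamma>_def norm_divide del: of_real_prod)
    also have "\<dots> < 1" using p sub order.strict_trans[OF p sub] by (simp only: divide_less_eq_1_pos)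
    finally show ?thesis .
  qed
  have nz: "1 - \<gamma> * cis s \<noteq> 0" for s using ln_one_minus_cis_continuous(2)[of \<gamma> "- s"] g by simp
  have zx: "z - of_real x \<noteq> 0" for x using z by (metis Im_complex_of_real eq_iff_diff_eq_0)
  have pt: "(\<Sum>j<k. ln (cmod (z - of_real (X j t)))) = (\<Sum>i<k. ln (cmod (Q i))) + ln (cmod (1 - \<gamma> * cis t)) + ln (cmod (1 - \<gamma> * cis (- t)))"
    if t: "t \<in> {-pi..pi}" for t
  proof -
    have "(\<Prod>j<k. z - of_real (X j t)) = poly (char_poly (generating_function k a b t)) z"
      unfolding X[OF t] by (simp add: poly_prod)
    also have "\<dots> = (\<Prod>i<k. Q i) * (1 - \<gamma> * cis t) * (1 - \<gamma> * cis (- t))"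
      unfolding \<gamma>_def by (rule char_poly_generating_function[where a=a and b=b, OF k pa pb Qp Q0 QS])
    finally have "cmod (\<Prod>j<k. z - of_real (X j t)) = cmod ((\<Prod>i<k. Q i) * (1 - \<gamma> * cis t) * (1 - \<gamma> * cis (- t)))" by simp
    then have e: "(\<Prod>j<k. cmod (z - of_real (X j t))) = (\<Prod>i<k. cmod (Q i)) * cmod (1 - \<gamma> * cis t) * cmod (1 - \<gamma> * cis (- t))"
      by (simp only: prod_norm[symmetric] norm_mult)
    have p: "(\<Prod>i<k. cmod (Q i)) > 0" "cmod (1 - \<gamma> * cis t) > 0" "cmod (1 - \<gamma> * cis (- t)) > 0"
      using Q0 nz by (auto intro!: prod_pos)
    have "(\<Sum>j<k. ln (cmod (z - of_real (X j t)))) = ln (\<Prod>j<k. cmod (z - of_real (X j t)))"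
      by (rule ln_prod[symmetric]) (use zx in auto)
    also have "\<dots> = ln (\<Prod>i<k. cmod (Q i)) + ln (cmod (1 - \<gamma> * cis t)) + ln (cmod (1 - \<gamma> * cis (- t)))"
      unfolding e ln_mult_pos[OF mult_pos_pos[OF p(1,2)] p(3)] ln_mult_pos[OF p(1,2)] ..
    also have "ln (\<Prod>i<k. cmod (Q i)) = (\<Sum>i<k. ln (cmod (Q i)))" by (rule ln_prod) (use Q0 in auto)
    finally show ?thesis .
  qed
  have int: "integrable circ (\<lambda>t. ln (cmod (z - of_real (X j t))))" if j: "j < k" for j
  proof (rule finite_measure.integrable_const_bound[OF finite_measure_circle])
    have [measurable]: "X j \<in> borel_measurable circ" by (rule Xm[OF j])
    show "(\<lambda>t. ln (cmod (z - of_real (X j t)))) \<in> borel_measurable circ" by measurable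
    show "AE t in circ. norm (ln (cmod (z - of_real (X j t)))) \<le> \<bar>ln \<bar>Im z\<bar>\<bar> + \<bar>ln (cmod z + R)\<bar>"
    proof (rule AE_I2)
      fix t assume "t \<in> space circ"
      then have b: "\<bar>X j t\<bar> \<le> R" using Xb[OF j, of t] by simp
      have l: "\<bar>Im z\<bar> \<le> cmod (z - of_real (X j t))" using abs_Im_le_cmod[of "z - of_real (X j t)"] by simp
      have u: "cmod (z - of_real (X j t)) \<le> cmod z + R" using norm_triangle_ineq4[of z "of_real (X j t)"] b by simp
      have "ln \<bar>Im z\<bar> \<le> ln (cmod (z - of_real (X j t)))" using l z by (intro ln_mono) auto
      moreover have "ln (cmod (z - of_real (X j t))) \<le> ln (cmod z + R)" using u l z by (intro ln_mono) auto
      ultimately show "norm (ln (cmod (z - of_real (X j t)))) \<le> \<bar>ln \<bar>Im z\<bar>\<bar> + \<bar>ln (cmod z + R)\<bar>" by simp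
    qed
  qed
  have "(\<Sum>j<k. \<integral>t. ln (cmod (z - of_real (X j t))) \<partial>circ) = (\<integral>t. (\<Sum>j<k. ln (cmod (z - of_real (X j t)))) \<partial>circ)"
    using int by (intro Bochner_Integration.integral_sum[symmetric]) auto
  also have "\<dots> = (\<integral>t. (\<Sum>i<k. ln (cmod (Q i))) + ln (cmod (1 - \<gamma> * cis t)) + ln (cmod (1 - \<gamma> * cis (- t))) \<partial>circ)"
    by (rule Bochner_Integration.integral_cong[OF refl pt]) simp
  also have "\<dots> = 2 * pi * (\<Sum>i<k. ln (cmod (Q i)))"
  proof -
    have i1: "integrable circ (\<lambda>t. ln (cmod (1 - \<gamma> * cis t)))"
      by (rule integrable_circle) (use nz in \<open>auto intro!: continuous_intros\<close>)
    have i2: "integrable circ (\<lambda>t. ln (cmod (1 - \<gamma> * cis (- t))))"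
      by (rule integrable_circle[OF ln_one_minus_cis_continuous(1)]) (use g in simp)
    have i0: "integrable circ (\<lambda>t. (\<Sum>i<k. ln (cmod (Q i))))"
      by (rule finite_measure.integrable_const[OF finite_measure_circle])
    have "(\<integral>t. (\<Sum>i<k. ln (cmod (Q i))) \<partial>circ) = 2 * pi * (\<Sum>i<k. ln (cmod (Q i)))"
      using measure_circle by simp
    then show ?thesis
      unfolding Bochner_Integration.integral_add[OF Bochner_Integration.integrable_add[OF i0 i1] i2] Bochner_Integration.integral_add[OF i0 i1]
        integral_ln_one_minus_cis[OF g] by simp
  qed
  finally show ?thesis .
qed

text \<open>
  By comparison \<open>ln \<bar>D n\<bar> / n\<close> is at most the mean of \<open>ln \<bar>Q i\<bar>\<close> over \<open>i < n\<close>, up to a term of order \<open>1 / n\<close> and a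
  multiple of the Cesaro mean of the perturbations; by periodicity the former mean converges to the potential.
\<close>

lemma jacobi_potential_upper_bound:
  fixes a0 b0 :: "nat \<Rightarrow> real" and a b c :: "nat \<Rightarrow> complex" and X :: "nat \<Rightarrow> real \<Rightarrow> real"
  assumes k: "k \<ge> 1" and apos: "\<And>n. a0 n > 0" and pa: "\<And>n. a0 (n + k) = a0 n" and pb: "\<And>n. b0 (n + k) = b0 n"
    and lim: "(\<lambda>n. (1 / real n) * (\<Sum>j=1..n. cmod (a j - complex_of_real (a0 j))
             + cmod (b j - complex_of_real (b0 j)) + cmod (c j - complex_of_real (a0 j)))) \<longlonglongrightarrow> 0"
    and z: "Im z \<noteq> 0" and e: "e > 0"
    and Xm: "\<And>j. j < k \<Longrightarrow> X j \<in> borel_measurable circ"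
    and Xb: "\<And>j t. j < k \<Longrightarrow> t \<in> {-pi..pi} \<Longrightarrow> \<bar>X j t\<bar> \<le> R"
    and X: "\<And>t. t \<in> {-pi..pi} \<Longrightarrow> char_poly (generating_function k a0 b0 t) = (\<Prod>j<k. [:- of_real (X j t), 1:])"
  shows "\<forall>\<^sub>F n in sequentially. cmod (poly (char_poly (leading_block (jacobi a b c) n)) z)
     \<le> exp (real n * ((\<Sum>j<k. \<integral>t. ln (cmod (z - of_real (X j t))) \<partial>circ) / (real k * (2 * pi)) + e))"
proof -
  obtain Q \<eta> \<kappa> Y q where Q: "\<And>n. Q (n + k) = Q n" "\<And>n. Q (Suc n) = z - of_real (b0 (Suc n)) - of_real ((a0 (Suc n))\<^sup>2) / Q n"
    "\<eta> > 0" "\<And>n. cmod (Q n) \<ge> \<eta>" "\<And>n. \<kappa> (n + k) = \<kappa> n" "\<And>n. 1 \<le> \<kappa> n" "\<And>n. \<kappa> n \<le> Y" "0 \<le> q" "q < 1"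
    "\<And>n. (a0 (Suc n))\<^sup>2 / (cmod (Q n) * cmod (Q (Suc n))) * \<kappa> (Suc n) \<le> q * \<kappa> n"
    by (rule periodic_continued_fraction[where a=a0 and b=b0 and z=z and k=k, OF k pa pb z]) (rule that)
  have Q0: "Q n \<noteq> 0" for n using Q(3) Q(4)[of n] by auto
  have sub: "(\<Prod>i<k. a0 i) < cmod (\<Prod>i<k. Q i)"
    by (rule periodic_subdominant[where a=a0 and Q=Q and \<kappa>=\<kappa>, OF k pa Q(1,5,6) Q0 Q(8,9,10)])
  define U where "U = (\<Sum>i<k. ln (cmod (Q i))) / real k"
  have U: "(\<Sum>j<k. \<integral>t. ln (cmod (z - of_real (X j t))) \<partial>circ) / (real k * (2 * pi)) = U"
  proof -
    have "(\<Sum>j<k. \<integral>t. ln (cmod (z - of_real (X j t))) \<partial>circ) = 2 * pi * (\<Sum>i<k. ln (cmod (Q i)))"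
      by (rule potential_generating_function[where a=a0 and b=b0 and Q=Q and X=X and R=R, OF k apos pa pb z Q(1) Q0 Q(2) sub Xm Xb X])
    then show ?thesis by (simp add: U_def)
  qed
  obtain A where A: "\<And>n. \<bar>a0 n\<bar> \<le> A" using periodic_bounded[of k "\<lambda>n. \<bar>a0 n\<bar>"] k pa by auto
  define D where "D n = poly (char_poly (leading_block (jacobi a b c) n)) z" for n
  define \<epsilon> where "\<epsilon> j = cmod (a j - complex_of_real (a0 j)) + cmod (b j - complex_of_real (b0 j)) + cmod (c j - complex_of_real (a0 j))" for j
  have "\<exists>C1 C2. \<forall>n. cmod (D (Suc n)) \<le> C1 * (\<Prod>i<Suc n. cmod (Q i)) * exp (C2 * (\<Sum>j=1..n. \<epsilon> j))"
    unfolding \<epsilon>_def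
  proof (rule perturbed_recurrence_bound[where Q=Q and \<kappa>=\<kappa> and z=z])
    show "D (Suc (Suc n)) = (z - b (Suc n)) * D (Suc n) - a (Suc n) * c (Suc n) * D n" for n
      unfolding D_def by (rule char_poly_jacobi_recurrence(3))
  qed (use Q A in auto)
  then obtain C1 C2 where C: "\<And>n. cmod (D (Suc n)) \<le> C1 * (\<Prod>i<Suc n. cmod (Q i)) * exp (C2 * (\<Sum>j=1..n. \<epsilon> j))" by blast
  define C where "C = max 1 C1"
  define B where "B n = ln C / real n + (\<Sum>i<n. ln (cmod (Q i))) / real n + \<bar>C2\<bar> * ((1 / real n) * (\<Sum>j=1..n. \<epsilon> j))" for n
  have B: "cmod (D n) \<le> exp (real n * B n)" if n: "n > 0" for n
  proof -
    obtain m where m: "n = Suc m" using n by (cases n) auto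
    have e0: "\<epsilon> j \<ge> 0" for j by (simp add: \<epsilon>_def)
    have s: "(\<Sum>j=1..m. \<epsilon> j) \<le> (\<Sum>j=1..n. \<epsilon> j)" unfolding m using e0[of "Suc m"] by simp
    have s0: "0 \<le> (\<Sum>j=1..m. \<epsilon> j)" using e0 by (simp add: sum_nonneg)
    have "C2 * (\<Sum>j=1..m. \<epsilon> j) \<le> \<bar>C2\<bar> * (\<Sum>j=1..m. \<epsilon> j)" using s0 by (intro mult_right_mono) auto
    also have "\<dots> \<le> \<bar>C2\<bar> * (\<Sum>j=1..n. \<epsilon> j)" using s by (intro mult_left_mono) auto
    finally have s2: "exp (C2 * (\<Sum>j=1..m. \<epsilon> j)) \<le> exp (\<bar>C2\<bar> * (\<Sum>j=1..n. \<epsilon> j))" by simp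
    have P: "(\<Prod>i<n. cmod (Q i)) = exp (\<Sum>i<n. ln (cmod (Q i)))"
      unfolding exp_sum[OF finite_lessThan] using Q0 by (intro prod.cong) auto
    have "cmod (D n) \<le> C1 * (\<Prod>i<n. cmod (Q i)) * exp (C2 * (\<Sum>j=1..m. \<epsilon> j))" unfolding m by (rule C)
    also have "\<dots> \<le> C * (\<Prod>i<n. cmod (Q i)) * exp (\<bar>C2\<bar> * (\<Sum>j=1..n. \<epsilon> j))"
      by (rule mult_mono[OF mult_right_mono s2]) (auto simp: C_def intro!: prod_nonneg mult_nonneg_nonneg)
    also have "\<dots> = exp (ln C + (\<Sum>i<n. ln (cmod (Q i))) + \<bar>C2\<bar> * (\<Sum>j=1..n. \<epsilon> j))"
      unfolding P exp_add by (simp add: C_def)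
    also have "ln C + (\<Sum>i<n. ln (cmod (Q i))) + \<bar>C2\<bar> * (\<Sum>j=1..n. \<epsilon> j) = real n * B n"
      unfolding B_def using n by (simp add: distrib_left)
    finally show ?thesis .
  qed
  have "B \<longlonglongrightarrow> 0 + U + \<bar>C2\<bar> * 0"
    unfolding B_def U_def
  proof (intro tendsto_add tendsto_mult_left)
    show "(\<lambda>n. ln C / real n) \<longlonglongrightarrow> 0" by real_asymp
    show "(\<lambda>n. (\<Sum>i<n. ln (cmod (Q i))) / real n) \<longlonglongrightarrow> (\<Sum>i<k. ln (cmod (Q i))) / real k"
      by (rule periodic_average[OF k]) (simp add: Q(1))
    show "(\<lambda>n. (1 / real n) * (\<Sum>j=1..n. \<epsilon> j)) \<longlonglongrightarrow> 0" using lim unfolding \<epsilon>_def .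
  qed
  then have "\<forall>\<^sub>F n in sequentially. B n < U + e" using e by (intro order_tendstoD(2)[of B U]) auto
  then show ?thesis
    using eventually_gt_at_top[of 0] unfolding U
  proof eventually_elim
    case (elim n)
    have "cmod (D n) \<le> exp (real n * B n)" by (rule B[OF elim(2)])
    also have "\<dots> \<le> exp (real n * (U + e))" using elim by (simp add: mult_left_mono)
    finally show ?case unfolding D_def .
  qed
qed

lemma jacobi_potential_crude_bound:
  fixes a0 b0 :: "nat \<Rightarrow> real" and a b c :: "nat \<Rightarrow> complex"
  assumes k: "k \<ge> 1" and pa: "\<And>n. a0 (n + k) = a0 n" and pb: "\<And>n. b0 (n + k) = b0 n"
    and lim: "(\<lambda>n. (1 / real n) * (\<Sum>j=1..n. cmod (a j - complex_of_real (a0 j))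
             + cmod (b j - complex_of_real (b0 j)) + cmod (c j - complex_of_real (a0 j)))) \<longlonglongrightarrow> 0"
  shows "\<exists>C. \<forall>n z. cmod z \<le> R \<longrightarrow> cmod (poly (char_poly (leading_block (jacobi a b c) n)) z) \<le> exp (C * real n)"
proof -
  define \<epsilon> where "\<epsilon> j = cmod (a j - complex_of_real (a0 j)) + cmod (b j - complex_of_real (b0 j)) + cmod (c j - complex_of_real (a0 j))" for j
  have "Bseq (\<lambda>n. (1 / real n) * (\<Sum>j=1..n. \<epsilon> j))"
    using lim unfolding \<epsilon>_def by (intro convergent_imp_Bseq) (auto simp: convergent_def)
  then obtain E where E: "\<And>n. \<bar>(1 / real n) * (\<Sum>j=1..n. \<epsilon> j)\<bar> \<le> E" unfolding Bseq_def by auto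
  have E0: "E \<ge> 0" using E[of 0] by simp
  have Es: "(\<Sum>j=1..n. \<epsilon> j) \<le> real n * E" for n
  proof (cases "n = 0")
    case False
    then show ?thesis using E[of n] by (simp add: abs_le_iff divide_le_eq mult.commute)
  qed simp
  obtain A where A: "\<And>n. \<bar>a0 n\<bar> \<le> A" using periodic_bounded[of k "\<lambda>n. \<bar>a0 n\<bar>"] k pa by auto
  obtain B where B: "\<And>n. \<bar>b0 n\<bar> \<le> B" using periodic_bounded[of k "\<lambda>n. \<bar>b0 n\<bar>"] k pb by auto
  have A0: "A \<ge> 0" and B0: "B \<ge> 0" using A[of 0] B[of 0] by linarith+
  define C where "C = \<bar>R\<bar> + cmod (b 0) + (E + 2 * A + B)"
  have "cmod (poly (char_poly (leading_block (jacobi a b c) n)) z) \<le> exp (C * real n)" if z: "cmod z \<le> R" for n z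
  proof (cases n)
    case 0
    then show ?thesis using char_poly_jacobi_recurrence(1)[of a b c z] by simp
  next
    case (Suc m)
    define D where "D n = poly (char_poly (leading_block (jacobi a b c) n)) z" for n
    have D: "D 0 = 1" "D 1 = z - b 0" "D (Suc (Suc n)) = (z - b (Suc n)) * D (Suc n) - a (Suc n) * c (Suc n) * D n" for n
      unfolding D_def One_nat_def by (rule char_poly_jacobi_recurrence)+
    have "cmod (a j) + cmod (b j) + cmod (c j) \<le> \<epsilon> j + (2 * A + B)" for j
    proof -
      have "cmod x \<le> cmod (x - of_real y) + \<bar>y\<bar>" for x y using norm_triangle_sub[of x "of_real y"] by simp
      from this[of "a j" "a0 j"] this[of "b j" "b0 j"] this[of "c j" "a0 j"] A[of j] B[of j]
      show ?thesis unfolding \<epsilon>_def by linarith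
    qed
    then have "(\<Sum>j=1..m. cmod (a j) + cmod (b j) + cmod (c j)) \<le> (\<Sum>j=1..m. \<epsilon> j + (2 * A + B))" by (rule sum_mono)
    also have "\<dots> \<le> real m * (E + 2 * A + B)" using Es[of m] by (simp add: sum.distrib algebra_simps)
    finally have s: "(\<Sum>j=1..m. cmod (a j) + cmod (b j) + cmod (c j)) \<le> real m * (E + 2 * A + B)" .
    have "cmod (D 1) + cmod (D 0) \<le> 1 + (R + cmod (b 0))" unfolding D(1,2) using norm_triangle_ineq4[of z "b 0"] z by simp
    also have "\<dots> \<le> exp (R + cmod (b 0))" by (rule exp_ge_add_one_self)
    finally have i: "cmod (D 1) + cmod (D 0) \<le> exp (R + cmod (b 0))" .
    have "cmod (D (Suc m)) \<le> (cmod (D 1) + cmod (D 0)) * exp (real m * cmod z + (\<Sum>j=1..m. cmod (a j) + cmod (b j) + cmod (c j)))"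
      by (rule recurrence_crude_bound[where D=D and a=a and b=b and c=c and z=z, OF D(3)])
    also have "\<dots> \<le> exp (R + cmod (b 0)) * exp (real m * R + real m * (E + 2 * A + B))"
    proof (rule mult_mono[OF i])
      have "real m * cmod z \<le> real m * R" using z by (rule mult_left_mono) simp
      from add_mono[OF this s] show "exp (real m * cmod z + (\<Sum>j=1..m. cmod (a j) + cmod (b j) + cmod (c j))) \<le> exp (real m * R + real m * (E + 2 * A + B))"
        by (simp only: exp_le_cancel_iff)
    qed simp_all
    also have "\<dots> = exp (R + cmod (b 0) + real m * R + real m * (E + 2 * A + B))" by (simp add: exp_add)
    also have "\<dots> \<le> exp (C * real n)"
    proof -
      have R0: "R \<ge> 0" using z norm_ge_zero order_trans by blast
      have "C * real n = R + cmod (b 0) + real m * R + real m * (E + 2 * A + B) + (real m * cmod (b 0) + (E + 2 * A + B))"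
        using R0 by (simp add: C_def Suc algebra_simps)
      moreover have "0 \<le> real m * cmod (b 0) + (E + 2 * A + B)" using E0 A0 B0 by simp
      ultimately show ?thesis by simp
    qed
    finally show ?thesis by (simp add: D_def Suc)
  qed
  then show ?thesis by blast
qed

lemma eigenvalue_labelling:
  assumes A: "\<And>n. A n \<in> carrier_mat n n"
  shows "\<exists>lam :: nat \<Rightarrow> nat \<Rightarrow> complex. \<forall>n. char_poly (A n) = (\<Prod>j<n. [:- lam n j, 1:])"
proof -
  have "\<exists>f. char_poly (A n) = (\<Prod>j<n. [:- f j, 1:])" for n
  proof -
    obtain as where as: "char_poly (A n) = (\<Prod>a\<leftarrow>as. [:- a, 1:])" "length as = n"
      using char_poly_factorized[OF A] by blast
    have "(\<Prod>a\<leftarrow>as. [:- a, 1:]) = (\<Prod>j<n. [:- (as ! j), 1:])"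
      unfolding prod.list_conv_set_nth using as(2) by (intro prod.cong) auto
    then show ?thesis using as(1) by (intro exI[of _ "\<lambda>j. as ! j"]) simp
  qed
  then show ?thesis by (intro choice allI)
qed

theorem theorem4p5:
  fixes k :: nat
    and a0 b0 :: "nat \<Rightarrow> real"
    and a b c :: "nat \<Rightarrow> complex"
  assumes "k \<ge> 1"
    and "\<And>n. a0 n > 0"
    and "\<And>n. a0 (n + k) = a0 n"
    and "\<And>n. b0 (n + k) = b0 n"
    and "(\<lambda>n. (1 / real n) * (\<Sum>j=1..n. cmod (a j - complex_of_real (a0 j))
             + cmod (b j - complex_of_real (b0 j))
             + cmod (c j - complex_of_real (a0 j)))) \<longlonglongrightarrow> 0"
  defines "J \<equiv> leading_block (jacobi a b c)"
    and "\<theta> \<equiv> generating_function k a0 b0"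
    and "G \<equiv> {-pi..pi}"
  shows "eigenvalue_distributed J k \<theta> G
       \<and> weakly_clustered J (essential_range_mat k G \<theta>)
       \<and> (\<forall>s\<in>essential_range_mat k G \<theta>. strongly_attracts_infinite_order s J)"
proof -
  note k = assms(1) and hyps = assms(1-4) and lim = assms(5)
  have JA: "matrix_sequence J" by (simp add: matrix_sequence_def J_def)
  have Gm: "G \<in> lmeasurable" and mG: "measure lebesgue G = 2 * pi" unfolding G_def by simp_all
  have Gs: "G \<in> sets lebesgue" using Gm by (rule fmeasurableD)
  have G0: "0 < measure lebesgue G" using mG by simp
  obtain R where R: "R > 0" "\<And>t z. poly (char_poly (generating_function k a0 b0 t)) z = 0 \<Longrightarrow> cmod z \<le> R"
    using eigenvalues_generating_function_bounded[where a=a0 and b=b0, OF hyps] by blast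
  have "cos \<in> borel_measurable circ"
    by (rule borel_measurable_integrable[OF integrable_circle]) (intro continuous_intros)
  from measurable_eigenvalues_generating_function[where a=a0 and b=b0, OF hyps this]
  obtain X :: "nat \<Rightarrow> real \<Rightarrow> real" where X': "\<forall>j<k. X j \<in> borel_measurable circ"
    "\<forall>t\<in>space circ. char_poly (generating_function k a0 b0 t) = (\<Prod>j<k. [:- of_real (X j t), 1:])"
    by (elim exE conjE)
  have Xm: "X j \<in> borel_measurable circ" if "j < k" for j using X'(1) that by blast
  have X: "char_poly (generating_function k a0 b0 t) = (\<Prod>j<k. [:- of_real (X j t), 1:])" if "t \<in> {-pi..pi}" for t
    using X'(2) that by simp
  have Xb: "\<bar>X j t\<bar> \<le> R" if "j < k" "t \<in> {-pi..pi}" for j t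
  proof -
    have "poly (char_poly (generating_function k a0 b0 t)) (of_real (X j t)) = 0"
      unfolding X[OF that(2)] poly_prod by (rule prod_zero) (use that in auto)
    from R(2)[OF this] show ?thesis by simp
  qed
  obtain lam where lam: "\<And>n. char_poly (J n) = (\<Prod>j<n. [:- lam n j, 1:])"
    using eigenvalue_labelling[of J] by (auto simp: J_def)
  have pl: "(\<Prod>j<n. cmod (z - lam n j)) = cmod (poly (char_poly (leading_block (jacobi a b c) n)) z)" for n z
    unfolding lam[unfolded J_def] poly_prod prod_norm[symmetric] by simp
  have pb: "potential_bound circ k X (R / 2) lam"
  proof (rule potential_bound.intro)
    show "finite_measure circ" by (rule finite_measure_circle)
    show "measure circ (space circ) > 0" using measure_circle by simp
    show "k \<ge> 1" by (rule k)
    show "X j \<in> borel_measurable circ" if "j < k" for j using Xm[OF that] .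
    show "R / 2 > 0" using R by simp
    show "\<bar>X j t\<bar> \<le> 2 * (R / 2)" if "j < k" "t \<in> space circ" for j t using Xb[of j t] that by simp
    show "\<forall>\<^sub>F n in sequentially. (\<Prod>j<n. cmod (z - lam n j)) \<le>
        exp (real n * ((\<Sum>j<k. \<integral>t. ln (cmod (z - of_real (X j t))) \<partial>circ) / (real k * measure circ (space circ)) + e))"
      if "Im z \<noteq> 0" "e > 0" for z e
      unfolding pl measure_circle
      by (rule jacobi_potential_upper_bound[where a=a and b=b and c=c and X=X and z=z and e=e, OF hyps lim that Xm Xb X])
    show "\<exists>C. \<forall>n z. cmod z \<le> R' \<longrightarrow> (\<Prod>j<n. cmod (z - lam n j)) \<le> exp (C * real n)" for R'
      unfolding pl by (rule jacobi_potential_crude_bound[where a=a and b=b and c=c, OF k hyps(3,4) lim])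
  qed
  define l where "l j t = complex_of_real (X j t)" for j t
  have lm: "l j \<in> borel_measurable (lebesgue_on G)" if "j < k" for j
    unfolding l_def G_def using Xm[OF that] by measurable
  have me: "measurable_eigenvalues k \<theta> G l"
    unfolding measurable_eigenvalues_def
  proof (intro conjI allI impI ballI lm)
    fix t assume "t \<in> G"
    then show "eigs (\<theta> t) = image_mset (\<lambda>j. l j t) (mset_set {..<k})"
      unfolding \<theta>_def l_def G_def by (intro eigs_eq_of_char_poly X)
  qed
  have d: "distributed_with J k G l"
    unfolding distributed_with_def
  proof (intro allI impI)
    fix F :: "complex \<Rightarrow> complex"
    assume c: "continuous_on UNIV F" and b: "bounded {z. F z \<noteq> 0}"
    have "compact (F ` closure {z. F z \<noteq> 0})"
      using b by (intro compact_continuous_image continuous_on_subset[OF c]) (auto simp: compact_eq_bounded_closed)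
    then have "bounded (F ` closure {z. F z \<noteq> 0})" by (rule compact_imp_bounded)
    then obtain B where B: "\<And>z. z \<in> closure {z. F z \<noteq> 0} \<Longrightarrow> norm (F z) \<le> B" unfolding bounded_iff by blast
    have B': "norm (F z) \<le> max B 0" for z
    proof (cases "F z = 0")
      case False
      then have "z \<in> closure {z. F z \<noteq> 0}" using closure_subset by fastforce
      from B[OF this] show ?thesis by simp
    qed simp
    have "(\<Sum>z\<in>#eigs (J n). F z) = (\<Sum>j<n. F (lam n j))" for n
      unfolding eigs_eq_of_char_poly[OF lam] sum_unfold_sum_mset by (simp add: image_mset.compositionality comp_def)
    moreover have "(1 / (of_nat k * complex_of_real (measure lebesgue G))) * (\<Sum>j<k. \<integral>t. F (l j t) \<partial>lebesgue_on G)
        = potential_bound.avg circ k X (\<lambda>x. F (of_real x))"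
      unfolding potential_bound.avg_def[OF pb] measure_circle mG l_def G_def by (simp add: scaleR_conv_of_real)
    ultimately show "(\<lambda>n. (1 / of_nat n) * (\<Sum>z\<in>#eigs (J n). F z)) \<longlonglongrightarrow>
             (1 / (of_nat k * complex_of_real (measure lebesgue G))) * (\<Sum>j<k. \<integral>t. F (l j t) \<partial>lebesgue_on G)"
      using potential_bound.weak_convergence[OF pb c B'] by simp
  qed
  have ent: "integrable (lebesgue_on G) (\<lambda>t. \<theta> t $$ (p, q))" if "p < k" "q < k" for p q
    unfolding \<theta>_def G_def generating_function_entry[OF that]
  proof -
    have c: "continuous_on S (\<lambda>t. if P then f t else 0)" if "continuous_on S f" for S P and f :: "real \<Rightarrow> complex"
      using that by (cases P) auto
    show "integrable (lebesgue_on {-pi..pi}) (\<lambda>t. (if p = q then of_real (b0 p) else 0) + (if p = Suc q then of_real (a0 p) else 0) + (if q = Suc p then of_real (a0 q) else 0)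
      + (if p = 0 \<and> Suc q = k then of_real (a0 0) * cis t else 0)
      + (if Suc p = k \<and> q = 0 then of_real (a0 0) * cis (- t) else 0))"
      by (intro integrable_circle continuous_on_add c continuous_on_const continuous_intros)
  qed
  have dist: "eigenvalue_distributed J k \<theta> G"
    unfolding eigenvalue_distributed_def
  proof (intro conjI)
    show "\<forall>t\<in>G. \<theta> t \<in> carrier_mat k k" by (simp add: \<theta>_def)
    show "\<forall>p<k. \<forall>q<k. integrable (lebesgue_on G) (\<lambda>t. \<theta> t $$ (p, q))" using ent by blast
    show "\<exists>l. measurable_eigenvalues k \<theta> G l \<and>
        (\<forall>F::complex \<Rightarrow> complex. continuous_on UNIV F \<longrightarrow> bounded {z. F z \<noteq> 0} \<longrightarrow>
           (\<lambda>n. (1 / of_nat n) * (\<Sum>z\<in>#eigs (J n). F z)) \<longlonglongrightarrow>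
             (1 / (of_nat k * complex_of_real (measure lebesgue G)))
               * (\<Sum>j<k. \<integral>t. F (l j t) \<partial>lebesgue_on G))"
      by (rule exI[of _ l], rule conjI[OF me d[unfolded distributed_with_def]])
  qed (rule JA Gm G0)+
  have S: "essential_range_mat k G \<theta> = (\<Union>j<k. essential_range G (l j))"
    by (rule essential_range_mat_eq[OF Gs me])
  have bd: "bounded (\<Union>j<k. essential_range G (l j))"
  proof -
    have "cmod s \<le> R" if j: "j < k" and s: "s \<in> essential_range G (l j)" for j s
    proof (rule ccontr)
      assume n: "\<not> cmod s \<le> R"
      have none: "{t \<in> G. cmod (l j t - s) < cmod s - R} = {}"
      proof -
        have "cmod s - R \<le> cmod (l j t - s)" if "t \<in> G" for t
          using Xb[OF j, of t] that norm_triangle_ineq3[of "l j t" s] unfolding G_def l_def by simp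
        then show ?thesis by (auto simp: not_less)
      qed
      have "0 < emeasure lebesgue {t \<in> G. cmod (l j t - s) < cmod s - R}"
        using s n unfolding essential_range_def mem_Collect_eq by (simp only: not_le diff_gt_0_iff_gt)
      then show False unfolding none by simp
    qed
    then show ?thesis unfolding bounded_iff by blast
  qed
  have wc: "weakly_clustered J (essential_range_mat k G \<theta>)"
    unfolding S by (rule distributed_weakly_clustered[OF JA k Gm G0 lm d bd])
  have "strongly_attracts_infinite_order s J" if s: "s \<in> essential_range_mat k G \<theta>" for s
  proof -
    obtain i where i: "i < k" and si: "s \<in> essential_range G (l i)" using s unfolding S by blast
    show ?thesis by (rule distributed_strongly_attracts[OF JA Gm G0 _ d i si]) (rule lm)
  qed
  then show ?thesis using dist wc by blast
qed

end
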